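(* Let $\mathcal{C}$ be a path-connected covering symmetric operad with a good basepoint $\{e_k\}_{k\ge0}$. Then $\pi_1(\mathcal{C}/\mathcal{S})=\{\pi_1(\mathcal{C}(k)/S_k,S_ke_k)\}_{k\ge0}$, with the boundary homomorphisms $\pi:\pi_1(\mathcal{C}(k)/S_k,S_ke_k)\to S_k$ and with the composition $\gamma$ described in the context, is a crossed group operad.
   Context: All spaces are compactly generated Hausdorff. A (nonsymmetric) topological operad $\mathcal{C}$ consists of spaces $\mathcal{C}(n)$, $n\ge 0$, with $\mathcal{C}(0)=*$, continuous maps $\gamma:\mathcal{C}(k)\times\mathcal{C}(m_1)\times\cdots\times\mathcal{C}(m_k)\to\mathcal{C}(m_1+\cdots+m_k)$ ($k\ge1$, $m_i\ge0$) and a unit $1\in\mathcal{C}(1)$, such that $\gamma(\gamma(a;b_1,\ldots,b_k);c_1,\ldots,c_m)=\gamma(a;\gamma(b_1;c_1,\ldots,c_{m_1}),\ldots,\gamma(b_k;c_{m_1+\cdots+m_{k-1}+1},\ldots,c_m))$, $\gamma(1;a)=a$, $\gamma(a;1,\ldots,1)=a$. Morphisms preserve $\gamma$ and the unit. An operad of sets is a discrete topological operad. In $S_n$ the product is $(\sigma\tau)(i)=\tau(\sigma(i))$. The symmetric groups operad $\mathcal{S}=\{S_n\}_{n\ge0}$ has $\gamma(\sigma;\tau_1,\ldots,\tau_k)\in S_{m}$ sending the $j$-th element of the $i$-th block (blocks of sizes $m_1,\ldots,m_k$), i.e. $m_1+\cdots+m_{i-1}+j$, to $\sum_{l:\sigma(l)<\sigma(i)}m_l+\tau_i(j)$.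 A symmetric operad is a topological operad with left actions of $S_n$ on $\mathcal{C}(n)$ such that $\gamma(\sigma a;\tau_1b_1,\ldots,\tau_kb_k)=\gamma(\sigma;\tau_1,\ldots,\tau_k)\gamma(a;b_{\sigma^{-1}(1)},\ldots,b_{\sigma^{-1}(k)})$. It is covering if each action of $S_n$ on $\mathcal{C}(n)$ is a covering action (every point has a neighbourhood $U$ with $gU\cap U=\emptyset$ for $g\ne1$), and path-connected if each $\mathcal{C}(k)$ is. Group operad: an operad of sets $\mathcal{G}=\{G_n\}_{n\ge0}$ with a morphism of operads $\pi:\mathcal{G}\to\mathcal{S}$ such that each $G_n$ is a group and $\pi:G_n\to S_n$ is a homomorphism, the identity of $G_1$ is the operad unit, and $\gamma(aa';b_1b_1',\ldots,b_kb_k')=\gamma(a;b_1,\ldots,b_k)\gamma(a';b'_{a^{-1}(1)},\ldots,b'_{a^{-1}(k)})$, where $a(i)=\pi(a)(i)$. It is non-crossed if all $\pi$ are trivial and crossed otherwise. Good basepoint: $\mathcal{C}_1$ is the little intervals operad: $\mathcal{C}_1(k)$ is the space of $k$-tuples of increasing affine embeddings $[0,1]\to[0,1]$ with images having pairwise disjoint interiors, $\mathcal{C}_1(0)=*$, unit the identity, $\gamma(c;d^1,\ldots,d^k)$ the tuple of all composites $c_i\circ d^i_j$ in lexicographic order. Let $c_0=*$, $c_k=([0,\frac1k],\ldots,[\frac{k-1}k,1])$ and let $\mathcal{C}_1(k)_0$ be the path component of $c_k$; $(\mathcal{C}_1)_0=\{\mathcal{C}_1(k)_0\}$ is a nonsymmetric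 operad. A good basepoint of $\mathcal{C}$ is $\{e_k=\eta(c_k)\}$ for a chosen morphism of nonsymmetric operads $\eta:(\mathcal{C}_1)_0\to\mathcal{C}$. For $u,v\in\mathcal{C}_1(k)_0$ the path $t\mapsto\eta((1-t)u+tv)$ is the linear path from $\eta(u)$ to $\eta(v)$; the linear path from $e_m$ to $\gamma(e_k;e_{n_1},\ldots,e_{n_k})$ uses $u=c_m$, $v=\gamma(c_k;c_{n_1},\ldots,c_{n_k})$. Structure on $\pi_1(\mathcal{C}/\mathcal{S})$: By path lifting, $\pi_1(\mathcal{C}(k)/S_k,S_ke_k)$ is identified with the set $\pi_1(\mathcal{C}(k);e_k,S_ke_k)$ of homotopy classes rel endpoints of paths in $\mathcal{C}(k)$ from $e_k$ to a point of $S_ke_k$. The boundary homomorphism sends $[f]$ to the unique $\pi[f]=\pi f\in S_k$ with $f(1)=(\pi f)e_k$, and the product is $[f]*[g]=[f\cdot(\pi f)g]$ (paths composed left to right). For $[f]\in\pi_1(\mathcal{C}(k);e_k,S_ke_k)$, $[g_i]\in\pi_1(\mathcal{C}(m_i);e_{m_i},S_{m_i}e_{m_i})$ and $m=\sum m_i$, $$\gamma([f];[g_1],\ldots,[g_k])=\big[\delta_1\cdot\gamma(f;g_1,\ldots,g_k)\cdot\gamma(\pi f;\pi g_1,\ldots,\pi g_k)\,\delta_2^{-1}\big],$$ where $\delta_1$ is the linear path from $e_m$ to $\gamma(e_k;e_{m_1},\ldots,e_{m_k})$, $\delta_2$ is the linear path from $e_m$ to $\gamma(e_k;e_{m_{(\pi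 f)^{-1}(1)}},\ldots,e_{m_{(\pi f)^{-1}(k)}})$, and $\gamma(f;g_1,\ldots,g_k)(t)=\gamma(f(t);g_1(t),\ldots,g_k(t))$. *)

theory Defs
  imports "HOL-Analysis.Analysis" "HOL-Algebra.Group_Action" "HOL-Combinatorics.Permutations"
begin

section \<open>Topological operads\<close>

text \<open>
  The spaces of an operad need not be disjoint, so the composition carries its arities explicitly:
  \<open>ocomp C [m\<^sub>1,\<dots>,m\<^sub>k] a [b\<^sub>1,\<dots>,b\<^sub>k]\<close> is the element
  \<open>\<gamma>(a; b\<^sub>1,\<dots>,b\<^sub>k)\<close> for \<open>a \<in> C(k)\<close> and \<open>b\<^sub>i \<in> C(m\<^sub>i)\<close>.
\<close>

record 'a operad =
  ospace :: "nat \<Rightarrow> 'a topology"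
  ocomp :: "nat list \<Rightarrow> 'a \<Rightarrow> 'a list \<Rightarrow> 'a"
  ounit :: 'a

abbreviation oset :: "('a, 'z) operad_scheme \<Rightarrow> nat \<Rightarrow> 'a set" where
  "oset C n \<equiv> topspace (ospace C n)"

text \<open>
  All spaces are compactly generated Hausdorff; accordingly the source of \<open>\<gamma>\<close> is the
  product in that category, the k-ification of the ordinary product.

  The case \<open>k = 0\<close> of the composition is the only map \<open>C(0) \<rightarrow> C(0) = *\<close>, so it carries no
  information. It is allowed here because the associativity law mentions \<open>\<gamma>(b\<^sub>i;)\<close> whenever
  \<open>m\<^sub>i = 0\<close>. In that law \<open>nss ! i\<close> is the list of arities of the block
  \<open>css ! i\<close> that is inserted into \<open>bs ! i\<close>.
\<close>

locale topological_operad =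
  fixes C :: "('a, 'z) operad_scheme"
  assumes Hausdorff: "Hausdorff_space (ospace C n)"
    and k_space: "k_space (ospace C n)"
    and space_0: "\<exists>p. oset C 0 = {p}"
    and unit_in: "ounit C \<in> oset C 1"
    and comp_continuous:
      "continuous_map
        (kification (prod_topology (ospace C (length ms))
          (product_topology (\<lambda>i. ospace C (ms ! i)) {..<length ms})))
        (ospace C (sum_list ms))
        (\<lambda>(a, b). ocomp C ms a (map b [0..<length ms]))"
    and comp_assoc:
      "\<lbrakk>a \<in> oset C (length nss);
        list_all2 (\<lambda>ns b. b \<in> oset C (length ns)) nss bs;
        list_all2 (list_all2 (\<lambda>n c. c \<in> oset C n)) nss css\<rbrakk> \<Longrightarrow>
       ocomp C (concat nss) (ocomp C (map length nss) a bs) (concat css) =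
       ocomp C (map sum_list nss) a
         (map (\<lambda>i. ocomp C (nss ! i) (bs ! i) (css ! i)) [0..<length nss])"
    and unit_left: "a \<in> oset C n \<Longrightarrow> ocomp C [n] (ounit C) [a] = a"
    and unit_right: "a \<in> oset C n \<Longrightarrow>
      ocomp C (replicate n 1) a (replicate n (ounit C)) = a"

definition operad_morphism ::
  "('a, 'y) operad_scheme \<Rightarrow> ('b, 'z) operad_scheme \<Rightarrow> (nat \<Rightarrow> 'a \<Rightarrow> 'b) \<Rightarrow> bool" where
  "operad_morphism C D \<phi> \<longleftrightarrow>
    (\<forall>n. continuous_map (ospace C n) (ospace D n) (\<phi> n)) \<and>
    \<phi> 1 (ounit C) = ounit D \<and>
    (\<forall>ms a bs. a \<in> oset C (length ms) \<longrightarrow> list_all2 (\<lambda>m b. b \<in> oset C m) ms bs \<longrightarrow>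
      \<phi> (sum_list ms) (ocomp C ms a bs) = ocomp D ms (\<phi> (length ms) a) (map2 \<phi> ms bs))"


section \<open>The symmetric groups operad\<close>

text \<open>Permutations act on \<open>{0,\<dots>,n-1}\<close>; the product is \<open>(\<sigma>\<tau>)(i) = \<tau>(\<sigma>(i))\<close>.\<close>

definition perm_group :: "nat \<Rightarrow> (nat \<Rightarrow> nat) monoid" where
  "perm_group n = \<lparr>carrier = {\<sigma>. \<sigma> permutes {..<n}}, mult = (\<lambda>\<sigma> \<tau>. \<tau> \<circ> \<sigma>), one = id\<rparr>"

text \<open>\<open>block_perm ms \<sigma> \<tau>s\<close> is \<open>\<gamma>(\<sigma>; \<tau>\<^sub>1,\<dots>,\<tau>\<^sub>k)\<close>; it fixes all numbers beyond the blocks.\<close>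

definition block_perm :: "nat list \<Rightarrow> (nat \<Rightarrow> nat) \<Rightarrow> (nat \<Rightarrow> nat) list \<Rightarrow> nat \<Rightarrow> nat" where
  "block_perm ms \<sigma> \<tau>s x =
    (if x < sum_list ms then
       THE y. \<exists>i<length ms. \<exists>j<ms ! i.
         x = sum_list (take i ms) + j \<and>
         y = (\<Sum>l | l < length ms \<and> \<sigma> l < \<sigma> i. ms ! l) + (\<tau>s ! i) j
     else x)"

definition perm_operad :: "(nat \<Rightarrow> nat) operad" where
  "perm_operad = \<lparr>ospace = (\<lambda>n. discrete_topology (carrier (perm_group n))),
    ocomp = block_perm, ounit = id\<rparr>"

text \<open>\<open>[x\<^sub>1,\<dots>,x\<^sub>k]\<close> is sent to \<open>[x\<^bsub>\<sigma>\<inverse>(1)\<^esub>,\<dots>,x\<^bsub>\<sigma>\<inverse>(k)\<^esub>]\<close>.\<close>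

abbreviation permute_inv :: "(nat \<Rightarrow> nat) \<Rightarrow> 'a list \<Rightarrow> 'a list" where
  "permute_inv \<sigma> xs \<equiv> permute_list (inv_into UNIV \<sigma>) xs"


section \<open>Symmetric operads\<close>

record 'a sym_operad = "'a operad" +
  oact :: "nat \<Rightarrow> (nat \<Rightarrow> nat) \<Rightarrow> 'a \<Rightarrow> 'a"

text \<open>
  The library's notion of a group action wants each group element to act by an extensional
  function, whence the restriction; \<open>oact\<close> is unconstrained outside the spaces of \<open>C\<close>.
\<close>

locale symmetric_operad = topological_operad C
  for C :: "('a, 'z) sym_operad_scheme" +
  assumes act: "group_action (perm_group n) (oset C n) (\<lambda>\<sigma>. restrict (oact C n \<sigma>) (oset C n))"
    and act_continuous: "\<sigma> \<in> carrier (perm_group n) \<Longrightarrow>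
      continuous_map (ospace C n) (ospace C n) (oact C n \<sigma>)"
    and equivariant:
      "\<lbrakk>\<sigma> \<in> carrier (perm_group (length ms)); a \<in> oset C (length ms);
        list_all2 (\<lambda>m \<tau>. \<tau> \<in> carrier (perm_group m)) ms \<tau>s;
        list_all2 (\<lambda>m b. b \<in> oset C m) ms bs\<rbrakk> \<Longrightarrow>
       ocomp C ms (oact C (length ms) \<sigma> a)
         (map (\<lambda>i. oact C (ms ! i) (\<tau>s ! i) (bs ! i)) [0..<length ms]) =
       oact C (sum_list ms) (block_perm ms \<sigma> \<tau>s)
         (ocomp C (permute_inv \<sigma> ms) a (permute_inv \<sigma> bs))"

locale covering_symmetric_operad = symmetric_operad C
  for C :: "('a, 'z) sym_operad_scheme" +
  assumes covering: "x \<in> oset C n \<Longrightarrow>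
    \<exists>U. openin (ospace C n) U \<and> x \<in> U \<and>
      (\<forall>\<sigma>\<in>carrier (perm_group n). \<sigma> \<noteq> \<one>\<^bsub>perm_group n\<^esub> \<longrightarrow> oact C n \<sigma> ` U \<inter> U = {})"


section \<open>Group operads\<close>

locale group_operad =
  fixes G :: "nat \<Rightarrow> ('g, 'z) monoid_scheme"
    and comp :: "nat list \<Rightarrow> 'g \<Rightarrow> 'g list \<Rightarrow> 'g"
    and proj :: "nat \<Rightarrow> 'g \<Rightarrow> nat \<Rightarrow> nat"
  assumes operad_of_sets:
      "topological_operad \<lparr>ospace = (\<lambda>n. discrete_topology (carrier (G n))),
        ocomp = comp, ounit = \<one>\<^bsub>G 1\<^esub>\<rparr>"
    and morphism:
      "operad_morphism \<lparr>ospace = (\<lambda>n. discrete_topology (carrier (G n))),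
        ocomp = comp, ounit = \<one>\<^bsub>G 1\<^esub>\<rparr> perm_operad proj"
    and group: "group (G n)"
    and hom: "proj n \<in> hom (G n) (perm_group n)"
    and interchange:
      "\<lbrakk>a \<in> carrier (G (length ms)); a' \<in> carrier (G (length ms));
        list_all2 (\<lambda>m b. b \<in> carrier (G m)) ms bs;
        list_all2 (\<lambda>m b. b \<in> carrier (G m)) ms bs'\<rbrakk> \<Longrightarrow>
       comp ms (a \<otimes>\<^bsub>G (length ms)\<^esub> a')
         (map (\<lambda>i. bs ! i \<otimes>\<^bsub>G (ms ! i)\<^esub> bs' ! i) [0..<length ms]) =
       comp ms a bs \<otimes>\<^bsub>G (sum_list ms)\<^esub>
         comp (permute_inv (proj (length ms) a) ms) a' (permute_inv (proj (length ms) a) bs')"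

locale crossed_group_operad = group_operad +
  assumes crossed: "\<exists>n. \<exists>a\<in>carrier (G n). proj n a \<noteq> id"


section \<open>Little intervals and good basepoints\<close>

text \<open>
  An increasing affine embedding \<open>x \<mapsto> p + (q - p) x\<close> of \<open>[0,1]\<close> into itself is encoded by the
  endpoints \<open>(p, q)\<close> of its image. Affine interpolation of embeddings is then affine
  interpolation of endpoints.
\<close>

definition little_intervals_set :: "nat \<Rightarrow> (real \<times> real) list set" where
  "little_intervals_set k =
    {c. length c = k \<and> (\<forall>(p, q)\<in>set c. 0 \<le> p \<and> p < q \<and> q \<le> 1) \<and>
      (\<forall>i<k. \<forall>j<k. i \<noteq> j \<longrightarrow>
        {fst (c ! i)<..<snd (c ! i)} \<inter> {fst (c ! j)<..<snd (c ! j)} = {})}"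

definition little_intervals_space :: "nat \<Rightarrow> (real \<times> real) list topology" where
  "little_intervals_space k =
    pullback_topology (little_intervals_set k) (\<lambda>c. \<lambda>i\<in>{..<k}. c ! i)
      (product_topology (\<lambda>_. euclidean) {..<k})"

definition interval_comp :: "real \<times> real \<Rightarrow> real \<times> real \<Rightarrow> real \<times> real" where
  "interval_comp = (\<lambda>(p, q) (r, s). (p + (q - p) * r, p + (q - p) * s))"

definition std_intervals :: "nat \<Rightarrow> (real \<times> real) list" where
  "std_intervals k = map (\<lambda>i. (real i / real k, real (Suc i) / real k)) [0..<k]"

text \<open>The nonsymmetric operad \<open>(\<C>\<^sub>1)\<^sub>0\<close> of path components of the \<open>c\<^sub>k\<close>.\<close>

definition little_intervals0 :: "(real \<times> real) list operad" where
  "little_intervals0 =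
    \<lparr>ospace = (\<lambda>k. subtopology (little_intervals_space k)
       (path_component_of_set (little_intervals_space k) (std_intervals k))),
     ocomp = (\<lambda>ms c ds. concat (map2 (\<lambda>ci. map (interval_comp ci)) c ds)),
     ounit = [(0, 1)]\<rparr>"

text \<open>A good basepoint of \<open>C\<close> is given by an operad morphism \<open>\<eta>\<close> from \<open>(\<C>\<^sub>1)\<^sub>0\<close> to \<open>C\<close>.\<close>

definition basept :: "(nat \<Rightarrow> (real \<times> real) list \<Rightarrow> 'a) \<Rightarrow> nat \<Rightarrow> 'a" where
  "basept \<eta> k = \<eta> k (std_intervals k)"

definition linear_path ::
  "(nat \<Rightarrow> (real \<times> real) list \<Rightarrow> 'a) \<Rightarrow> nat \<Rightarrow> (real \<times> real) list \<Rightarrow> (real \<times> real) list \<Rightarrow> real \<Rightarrow> 'a"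
  where "linear_path \<eta> k u v t = \<eta> k (map2 (\<lambda>x y. (1 - t) *\<^sub>R x + t *\<^sub>R y) u v)"

text \<open>The linear path from \<open>e\<^sub>m\<close> to \<open>\<gamma>(e\<^sub>k; e\<^bsub>m\<^sub>1\<^esub>,\<dots>,e\<^bsub>m\<^sub>k\<^esub>)\<close>.\<close>

definition comp_linear_path ::
  "(nat \<Rightarrow> (real \<times> real) list \<Rightarrow> 'a) \<Rightarrow> nat list \<Rightarrow> real \<Rightarrow> 'a" where
  "comp_linear_path \<eta> ms =
    linear_path \<eta> (sum_list ms) (std_intervals (sum_list ms))
      (ocomp little_intervals0 ms (std_intervals (length ms)) (map std_intervals ms))"


section \<open>Homotopy classes of paths\<close>

text \<open>The library's \<open>joinpaths\<close> and \<open>reversepath\<close> are confined to types of class \<open>topological_space\<close>.\<close>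

definition path_join :: "(real \<Rightarrow> 'a) \<Rightarrow> (real \<Rightarrow> 'a) \<Rightarrow> real \<Rightarrow> 'a" where
  "path_join f g = (\<lambda>t. if t \<le> 1/2 then f (2 * t) else g (2 * t - 1))"

definition path_rev :: "(real \<Rightarrow> 'a) \<Rightarrow> real \<Rightarrow> 'a" where
  "path_rev f = (\<lambda>t. f (1 - t))"

text \<open>The homotopy class of \<open>f\<close> relative to its endpoints.\<close>

definition path_class :: "'a topology \<Rightarrow> (real \<Rightarrow> 'a) \<Rightarrow> (real \<Rightarrow> 'a) set" where
  "path_class X f =
    {g. homotopic_with (\<lambda>h. h 0 = f 0 \<and> h 1 = f 1) (top_of_set {0..1::real}) X f g}"

definition fundamental_group :: "'a topology \<Rightarrow> 'a \<Rightarrow> (real \<Rightarrow> 'a) set monoid" where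
  "fundamental_group X x =
    \<lparr>carrier = path_class X ` {f. pathin X f \<and> f 0 = x \<and> f 1 = x},
     mult = (\<lambda>A B. \<Union>f\<in>A. \<Union>g\<in>B. path_class X (path_join f g)),
     one = path_class X (\<lambda>_. x)\<rparr>"


section \<open>The quotients \<open>C(k)/S\<^sub>k\<close> and their fundamental groups\<close>

definition orbit_map :: "('a, 'z) sym_operad_scheme \<Rightarrow> nat \<Rightarrow> 'a \<Rightarrow> 'a set" where
  "orbit_map C k = orbit (perm_group k) (oact C k)"

definition orbit_space :: "('a, 'z) sym_operad_scheme \<Rightarrow> nat \<Rightarrow> 'a set topology" where
  "orbit_space C k = topology (\<lambda>U. U \<subseteq> orbit_map C k ` oset C k \<and>
     openin (ospace C k) {x \<in> oset C k. orbit_map C k x \<in> U})"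

lemma openin_orbit_space:
  "openin (orbit_space C k) U \<longleftrightarrow> U \<subseteq> orbit_map C k ` oset C k \<and>
     openin (ospace C k) {x \<in> oset C k. orbit_map C k x \<in> U}"
proof -
  have "istopology (\<lambda>U. U \<subseteq> orbit_map C k ` oset C k \<and>
     openin (ospace C k) {x \<in> oset C k. orbit_map C k x \<in> U})" (is "istopology ?P")
    unfolding istopology_def
  proof (intro conjI allI impI)
    fix S T assume "?P S" "?P T"
    moreover have "{x \<in> oset C k. orbit_map C k x \<in> S \<inter> T} =
      {x \<in> oset C k. orbit_map C k x \<in> S} \<inter> {x \<in> oset C k. orbit_map C k x \<in> T}" by auto
    ultimately show "S \<inter> T \<subseteq> orbit_map C k ` oset C k"
      and "openin (ospace C k) {x \<in> oset C k. orbit_map C k x \<in> S \<inter> T}" by auto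
  next
    fix \<K> assume "\<forall>K\<in>\<K>. ?P K"
    moreover have "{x \<in> oset C k. orbit_map C k x \<in> \<Union>\<K>} =
      (\<Union>K\<in>\<K>. {x \<in> oset C k. orbit_map C k x \<in> K})" by auto
    ultimately show "\<Union>\<K> \<subseteq> orbit_map C k ` oset C k"
      and "openin (ospace C k) {x \<in> oset C k. orbit_map C k x \<in> \<Union>\<K>}" by auto
  qed
  then show ?thesis
    by (simp add: orbit_space_def topology_inverse')
qed

lemma topspace_orbit_space: "topspace (orbit_space C k) = orbit_map C k ` oset C k"
proof (rule subset_antisym)
  show "topspace (orbit_space C k) \<subseteq> orbit_map C k ` oset C k"
    using openin_orbit_space openin_topspace by blast
  have "openin (orbit_space C k) (orbit_map C k ` oset C k)"
  proof -
    have "{x \<in> oset C k. orbit_map C k x \<in> orbit_map C k ` oset C k} = oset C k" by blast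
    then show ?thesis by (simp add: openin_orbit_space)
  qed
  then show "orbit_map C k ` oset C k \<subseteq> topspace (orbit_space C k)"
    by (rule openin_subset)
qed

lemma quotient_map_orbit_map: "quotient_map (ospace C k) (orbit_space C k) (orbit_map C k)"
  by (auto simp: quotient_map_def topspace_orbit_space openin_orbit_space)

definition pi1_quotient ::
  "('a, 'z) sym_operad_scheme \<Rightarrow> (nat \<Rightarrow> (real \<times> real) list \<Rightarrow> 'a) \<Rightarrow> nat \<Rightarrow> (real \<Rightarrow> 'a set) set monoid"
  where "pi1_quotient C \<eta> k =
    fundamental_group (orbit_space C k) (orbit_map C k (basept \<eta> k))"

text \<open>
  \<open>pi1_rel C \<eta> k\<close> is \<open>\<pi>\<^sub>1(C(k); e\<^sub>k, S\<^sub>k e\<^sub>k)\<close> with the product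
  \<open>[f] * [g] = [f \<cdot> (\<pi>f) g]\<close>. The structure maps on classes are written as unions over all
  representatives, which is the common class once the choice of representatives is immaterial.
\<close>

definition rel_paths ::
  "('a, 'z) sym_operad_scheme \<Rightarrow> (nat \<Rightarrow> (real \<times> real) list \<Rightarrow> 'a) \<Rightarrow> nat \<Rightarrow> (real \<Rightarrow> 'a) set" where
  "rel_paths C \<eta> k =
    {f. pathin (ospace C k) f \<and> f 0 = basept \<eta> k \<and> f 1 \<in> orbit_map C k (basept \<eta> k)}"

definition rel_boundary ::
  "('a, 'z) sym_operad_scheme \<Rightarrow> (nat \<Rightarrow> (real \<times> real) list \<Rightarrow> 'a) \<Rightarrow> nat \<Rightarrow>
    (real \<Rightarrow> 'a) set \<Rightarrow> nat \<Rightarrow> nat" where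
  "rel_boundary C \<eta> k A =
    (THE \<sigma>. \<sigma> \<in> carrier (perm_group k) \<and> (\<forall>f\<in>A. f 1 = oact C k \<sigma> (basept \<eta> k)))"

definition pi1_rel ::
  "('a, 'z) sym_operad_scheme \<Rightarrow> (nat \<Rightarrow> (real \<times> real) list \<Rightarrow> 'a) \<Rightarrow> nat \<Rightarrow>
    (real \<Rightarrow> 'a) set monoid" where
  "pi1_rel C \<eta> k =
    \<lparr>carrier = path_class (ospace C k) ` rel_paths C \<eta> k,
     mult = (\<lambda>A B. \<Union>f\<in>A. \<Union>g\<in>B.
       path_class (ospace C k) (path_join f (oact C k (rel_boundary C \<eta> k A) \<circ> g))),
     one = path_class (ospace C k) (\<lambda>_. basept \<eta> k)\<rparr>"

definition rel_comp ::
  "('a, 'z) sym_operad_scheme \<Rightarrow> (nat \<Rightarrow> (real \<times> real) list \<Rightarrow> 'a) \<Rightarrow> nat list \<Rightarrow>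
    (real \<Rightarrow> 'a) set \<Rightarrow> (real \<Rightarrow> 'a) set list \<Rightarrow> (real \<Rightarrow> 'a) set" where
  "rel_comp C \<eta> ms A Bs =
    (let \<sigma> = rel_boundary C \<eta> (length ms) A;
         \<tau>s = map2 (rel_boundary C \<eta>) ms Bs;
         \<delta>\<^sub>1 = comp_linear_path \<eta> ms;
         \<delta>\<^sub>2 = comp_linear_path \<eta> (permute_inv \<sigma> ms)
     in \<Union>f\<in>A. \<Union>gs\<in>listset Bs.
       path_class (ospace C (sum_list ms))
         (path_join
           (path_join \<delta>\<^sub>1 (\<lambda>t. ocomp C ms (f t) (map (\<lambda>g. g t) gs)))
           (oact C (sum_list ms) (block_perm ms \<sigma> \<tau>s) \<circ> path_rev \<delta>\<^sub>2)))"

text \<open>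
  The projection \<open>[f] \<mapsto> [orbit \<circ> f]\<close>, by which \<open>\<pi>\<^sub>1(C(k); e\<^sub>k, S\<^sub>k e\<^sub>k)\<close> is identified with
  \<open>\<pi>\<^sub>1(C(k)/S\<^sub>k, S\<^sub>k e\<^sub>k)\<close>, its inverse (path lifting), and the structure carried over along it.
\<close>

definition rel_project ::
  "('a, 'z) sym_operad_scheme \<Rightarrow> nat \<Rightarrow> (real \<Rightarrow> 'a) set \<Rightarrow> (real \<Rightarrow> 'a set) set" where
  "rel_project C k A = (\<Union>f\<in>A. path_class (orbit_space C k) (orbit_map C k \<circ> f))"

definition rel_lift ::
  "('a, 'z) sym_operad_scheme \<Rightarrow> (nat \<Rightarrow> (real \<times> real) list \<Rightarrow> 'a) \<Rightarrow> nat \<Rightarrow>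
    (real \<Rightarrow> 'a set) set \<Rightarrow> (real \<Rightarrow> 'a) set" where
  "rel_lift C \<eta> k = inv_into (carrier (pi1_rel C \<eta> k)) (rel_project C k)"

definition pi1_boundary ::
  "('a, 'z) sym_operad_scheme \<Rightarrow> (nat \<Rightarrow> (real \<times> real) list \<Rightarrow> 'a) \<Rightarrow> nat \<Rightarrow>
    (real \<Rightarrow> 'a set) set \<Rightarrow> nat \<Rightarrow> nat" where
  "pi1_boundary C \<eta> k x = rel_boundary C \<eta> k (rel_lift C \<eta> k x)"

definition pi1_comp ::
  "('a, 'z) sym_operad_scheme \<Rightarrow> (nat \<Rightarrow> (real \<times> real) list \<Rightarrow> 'a) \<Rightarrow> nat list \<Rightarrow>
    (real \<Rightarrow> 'a set) set \<Rightarrow> (real \<Rightarrow> 'a set) set list \<Rightarrow> (real \<Rightarrow> 'a set) set" where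
  "pi1_comp C \<eta> ms x ys =
    rel_project C (sum_list ms)
      (rel_comp C \<eta> ms (rel_lift C \<eta> (length ms) x) (map2 (rel_lift C \<eta>) ms ys))"

end

theory Submission
  imports Defs
begin

text \<open>
  The action of \<open>S\<^sub>k\<close> on \<open>C(k)\<close> is a covering action, so \<open>C(k) \<rightarrow> C(k)/S\<^sub>k\<close> is a covering map. Paths and
  homotopies lift through it, and a loop in the quotient is therefore the same, up to homotopy, as a
  path in \<open>C(k)\<close> from \<open>e\<^sub>k\<close> to a point of its orbit (\<open>rel_project_iso\<close>). All structure may
  be studied on such paths and carried over to the quotients at the end (\<open>group_operad_laws.transport\<close>).

  The difficulty upstairs is that the basepoints are not closed under composition: \<open>\<gamma>(f; g\<^sub>1,\<dots>,g\<^sub>k)\<close>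
  runs between points of the form \<open>\<gamma>(e\<^sub>k; e\<^bsub>m\<^sub>1\<^esub>,\<dots>)\<close> and has to be corrected by linear paths, and
  each law of a group operad would require the corrections on its two sides to be compared.
  The way out is to fatten the basepoint. The tuples of little intervals that are ordered from left to
  right form a convex set, and these sets are closed under the composition of little intervals. Call
  a path in \<open>C(k)\<close> \<^emph>\<open>ordered\<close> if it runs from \<open>\<eta>(u)\<close> to \<open>\<sigma>\<eta>(v)\<close> with \<open>u\<close> and \<open>v\<close> ordered
  tuples. Ordered paths are closed under pointwise composition and under concatenation, and linear
  paths at both ends straighten them to paths between basepoints. Two facts make this useful:

  \<^item> Straightened paths remain homotopic when the ends of a homotopy move along images of ordered tuples
    (\<open>path_homotopic_straighten\<close>).

  \<^item> Each ordered path is homotopic in this sense to its straightening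
    (\<open>ordered_homotopy_straighten\<close>).

  Consequently classes can be composed and multiplied through arbitrary ordered representatives
  (\<open>rel_comp_straight_class\<close>, \<open>straight_class_mult\<close>). Each law now compares the classes of two
  ordered paths that are equal point by point, by the same law in \<open>C\<close>. The tuples at their ends
  agree by the laws for little intervals, and the permutations agree because the action is free
  (\<open>straight_class_eqI\<close>). Finally, a path in \<open>C(2)\<close> from \<open>e\<^sub>2\<close> to its image under the transposition
  shows that the group operad is crossed.
\<close>


section \<open>Paths and homotopies relative to endpoints\<close>

abbreviation unit_square :: "(real \<times> real) topology" where
  "unit_square \<equiv> top_of_set ({0..1} \<times> {0..1})"

text \<open>
  Equality of the classes \<open>path_class X f\<close> and \<open>path_class X g\<close>, as a relation between
  representatives; see \<open>path_class_eq_iff\<close>.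
\<close>

definition path_homotopic :: "'a topology \<Rightarrow> (real \<Rightarrow> 'a) \<Rightarrow> (real \<Rightarrow> 'a) \<Rightarrow> bool" where
  "path_homotopic X f g \<longleftrightarrow> homotopic_with (\<lambda>h. h 0 = f 0 \<and> h 1 = f 1) (top_of_set {0..1::real}) X f g"

lemma path_homotopicI:
  fixes H :: "real \<Rightarrow> real \<Rightarrow> 'a"
  assumes "continuous_map unit_square X (\<lambda>z. H (fst z) (snd z))"
    and "\<And>t. t \<in> {0..1} \<Longrightarrow> H 0 t = f t" "\<And>t. t \<in> {0..1} \<Longrightarrow> H 1 t = g t"
    and "\<And>s. s \<in> {0..1} \<Longrightarrow> H s 0 = f 0" "\<And>s. s \<in> {0..1} \<Longrightarrow> H s 1 = f 1"
  shows "path_homotopic X f g"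
  unfolding path_homotopic_def
proof (subst homotopic_with)
  show "\<exists>h. continuous_map (prod_topology (top_of_set {0..1::real}) (top_of_set {0..1::real})) X h \<and>
      (\<forall>x\<in>topspace (top_of_set {0..1}). h (0, x) = f x) \<and>
      (\<forall>x\<in>topspace (top_of_set {0..1}). h (1, x) = g x) \<and>
      (\<forall>t\<in>{0..1}. h (t, 0) = f 0 \<and> h (t, 1) = f 1)"
    by (rule exI[of _ "\<lambda>z. H (fst z) (snd z)"]) (use assms in auto)
qed auto

lemma path_homotopicE:
  assumes "path_homotopic X f g"
  obtains H :: "real \<Rightarrow> real \<Rightarrow> 'a"
  where "continuous_map unit_square X (\<lambda>z. H (fst z) (snd z))"
    "\<And>t. t \<in> {0..1} \<Longrightarrow> H 0 t = f t" "\<And>t. t \<in> {0..1} \<Longrightarrow> H 1 t = g t"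
    "\<And>s. s \<in> {0..1} \<Longrightarrow> H s 0 = f 0" "\<And>s. s \<in> {0..1} \<Longrightarrow> H s 1 = f 1"
proof -
  from assms obtain h where h: "continuous_map unit_square X h"
    "\<And>x. h (0, x) = f x" "\<And>x. h (1, x) = g x"
    "\<And>t. t \<in> {0..1} \<Longrightarrow> h (t, 0) = f 0 \<and> h (t, 1) = f 1"
    unfolding path_homotopic_def homotopic_with_def by auto
  show thesis by (rule that[of "\<lambda>s t. h (s, t)"]) (use h in auto)
qed

lemma path_homotopic_refl: "pathin X f \<Longrightarrow> path_homotopic X f f"
  by (simp add: path_homotopic_def pathin_def)

lemma path_homotopic_endpoints: "path_homotopic X f g \<Longrightarrow> g 0 = f 0 \<and> g 1 = f 1"
  unfolding path_homotopic_def by (blast dest: homotopic_with_imp_property)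

lemma path_homotopic_sym: "path_homotopic X f g \<Longrightarrow> path_homotopic X g f"
  using path_homotopic_endpoints[of X f g] unfolding path_homotopic_def
      by (auto dest: homotopic_with_symD)

lemma path_homotopic_trans [trans]: "path_homotopic X f g \<Longrightarrow> path_homotopic X g h \<Longrightarrow> path_homotopic X f h"
  using path_homotopic_endpoints[of X f g] unfolding path_homotopic_def
      by (auto intro: homotopic_with_trans)

lemma path_homotopic_imp_pathin: "path_homotopic X f g \<Longrightarrow> pathin X f \<and> pathin X g"
  unfolding path_homotopic_def pathin_def by (blast dest: homotopic_with_imp_continuous_maps)

lemma path_homotopic_eq: "pathin X f \<Longrightarrow> (\<And>t. t \<in> {0..1} \<Longrightarrow> f t = g t) \<Longrightarrow> path_homotopic X f g"
  by (auto simp: path_homotopic_def pathin_def intro!: homotopic_with_equal)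

lemma pathin_eq: "pathin X f \<Longrightarrow> (\<And>t. t \<in> {0..1} \<Longrightarrow> f t = g t) \<Longrightarrow> pathin X g"
  using path_homotopic_eq path_homotopic_imp_pathin by blast

lemma pathin_in: "pathin X f \<Longrightarrow> t \<in> {0..1} \<Longrightarrow> f t \<in> topspace X"
  unfolding pathin_def continuous_map_def by auto

lemma mem_path_class: "g \<in> path_class X f \<longleftrightarrow> path_homotopic X f g"
  by (simp add: path_class_def path_homotopic_def)

lemma path_class_eqI:
  assumes "path_homotopic X f g"
  shows "path_class X f = path_class X g"
proof -
  have "path_homotopic X f h \<longleftrightarrow> path_homotopic X g h" for h
    using assms path_homotopic_sym[OF assms] path_homotopic_trans[of X f g h] path_homotopic_trans[of
        X g f h] by blast
  then show ?thesis by (auto simp: mem_path_class)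
qed

lemma path_class_self: "pathin X f \<Longrightarrow> f \<in> path_class X f"
  by (simp add: mem_path_class path_homotopic_refl)

lemma path_class_eq_iff: "pathin X g \<Longrightarrow> path_class X f = path_class X g \<longleftrightarrow> path_homotopic X f g"
  using path_class_self path_class_eqI mem_path_class by blast

lemma path_homotopic_compose: "continuous_map X Y q \<Longrightarrow> path_homotopic X f g \<Longrightarrow>
  path_homotopic Y (q \<circ> f) (q \<circ> g)"
  unfolding path_homotopic_def by (rule homotopic_with_compose_continuous_map_left[where p =
      "\<lambda>h. h 0 = f 0 \<and> h 1 = f 1"]) auto

lemma continuous_map_compose_on:
  assumes "continuous_map (top_of_set T) X F" "continuous_on S \<phi>" "\<phi> ` S \<subseteq> T"
  shows "continuous_map (top_of_set S) X (\<lambda>z. F (\<phi> z))"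
proof -
  have "continuous_map (top_of_set S) (top_of_set T) \<phi>"
    using assms by (auto simp: continuous_map_in_subtopology)
  from continuous_map_compose[OF this assms(1)] show ?thesis by (simp add: o_def)
qed

lemma continuous_map_if_le:
  fixes p :: "'b::topological_space \<Rightarrow> real"
  assumes "continuous_on S p"
    and "continuous_map (top_of_set {z\<in>S. p z \<le> c}) X f"
    and "continuous_map (top_of_set {z\<in>S. c \<le> p z}) X g"
    and "\<And>z. z \<in> S \<Longrightarrow> p z = c \<Longrightarrow> f z = g z"
  shows "continuous_map (top_of_set S) X (\<lambda>z. if p z \<le> c then f z else g z)"
proof (rule continuous_map_cases_le)
  show "continuous_map (top_of_set S) euclideanreal p"
      "continuous_map (top_of_set S) euclideanreal (\<lambda>_. c)"
    using assms(1) by auto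
  have *: "S \<inter> {z \<in> S. P z} = {z \<in> S. P z}" for P by auto
  show "continuous_map (subtopology (top_of_set S) {x \<in> topspace (top_of_set S). p x \<le> c}) X f"
    "continuous_map (subtopology (top_of_set S) {x \<in> topspace (top_of_set S). c \<le> p x}) X g"
    using assms(2,3) by (simp_all add: subtopology_subtopology *)
qed (use assms(4) in auto)

lemma continuous_map_path_join:
  fixes f g :: "'b::topological_space \<Rightarrow> real \<Rightarrow> 'a"
  assumes "continuous_map (top_of_set (S \<times> {0..1})) X (\<lambda>z. f (fst z) (snd z))"
    and "continuous_map (top_of_set (S \<times> {0..1})) X (\<lambda>z. g (fst z) (snd z))"
    and "\<And>s. s \<in> S \<Longrightarrow> f s 1 = g s 0"
  shows "continuous_map (top_of_set (S \<times> {0..1})) X (\<lambda>z. path_join (f (fst z)) (g (fst z)) (snd z))"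
  unfolding path_join_def
proof (rule continuous_map_if_le)
  show "continuous_map (top_of_set {z \<in> S \<times> {0..1}. snd z \<le> 1 / 2}) X (\<lambda>z. f (fst z) (2 * snd z))"
    by (rule continuous_map_compose_on[OF assms(1), of "{z \<in> S \<times> {0..1}. snd z \<le> 1 / 2}"
        "\<lambda>z. (fst z, 2 * snd z)", simplified fst_conv snd_conv])
      (auto intro!: continuous_intros)
  show "continuous_map (top_of_set {z \<in> S \<times> {0..1}. 1 / 2 \<le> snd z}) X (\<lambda>z. g (fst z) (2 * snd z - 1))"
    by (rule continuous_map_compose_on[OF assms(2), of "{z \<in> S \<times> {0..1}. 1 / 2 \<le> snd z}"
        "\<lambda>z. (fst z, 2 * snd z - 1)", simplified fst_conv snd_conv])
      (auto intro!: continuous_intros)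
next
  fix z :: "'b \<times> real" assume "z \<in> S \<times> {0..1}" and z: "snd z = 1 / 2"
  then show "f (fst z) (2 * snd z) = g (fst z) (2 * snd z - 1)"
    unfolding z using assms(3) by auto
qed (auto intro!: continuous_intros)

lemma pathin_iff_square: "pathin X f \<longleftrightarrow> continuous_map unit_square X (\<lambda>z. f (snd z))"
proof
  assume "pathin X f"
  then show "continuous_map unit_square X (\<lambda>z. f (snd z))"
    unfolding pathin_def by (rule continuous_map_compose_on) (auto intro!: continuous_intros)
next
  assume "continuous_map unit_square X (\<lambda>z. f (snd z))"
  then have "continuous_map (top_of_set {0..1}) X (\<lambda>t. f (snd (0::real, t)))"
    by (rule continuous_map_compose_on) (auto intro!: continuous_intros)
  then show "pathin X f" by (simp add: pathin_def)
qed

lemma pathin_slice: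
  assumes "continuous_map (top_of_set (S \<times> {0..1::real})) X (\<lambda>z. H (fst z) (snd z))" "s \<in> S"
  shows "pathin X (H s)"
proof -
  have "continuous_map (top_of_set {0..1}) X (\<lambda>t. H (fst (s, t)) (snd (s, t)))"
    by (rule continuous_map_compose_on[OF assms(1)]) (use assms(2) in \<open>auto intro!: continuous_intros\<close>)
  then show ?thesis by (simp add: pathin_def)
qed

lemma path_join_0 [simp]: "path_join f g 0 = f 0"
  and path_join_1 [simp]: "path_join f g 1 = g 1"
  by (auto simp: path_join_def)

lemma path_rev_0 [simp]: "path_rev f 0 = f 1"
  and path_rev_1 [simp]: "path_rev f 1 = f 0"
  by (auto simp: path_rev_def)

lemma compose_path_join: "q \<circ> path_join f g = path_join (q \<circ> f) (q \<circ> g)"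
  by (auto simp: path_join_def)

lemma path_join_eq:
  assumes "t \<in> {0..1}" "\<And>t. t \<in> {0..1} \<Longrightarrow> f t = f' t" "\<And>t. t \<in> {0..1} \<Longrightarrow> g t = g' t"
  shows "path_join f g t = path_join f' g' t"
  using assms by (auto simp: path_join_def)

lemma pathin_path_join: "pathin X f \<Longrightarrow> pathin X g \<Longrightarrow> f 1 = g 0 \<Longrightarrow> pathin X (path_join f g)"
  unfolding pathin_iff_square
  using continuous_map_path_join[of "{0..1::real}" X "\<lambda>_. f" "\<lambda>_. g"] by simp

lemma pathin_path_rev: "pathin X f \<Longrightarrow> pathin X (path_rev f)"
  unfolding pathin_def path_rev_def
  by (rule continuous_map_compose_on) (auto intro!: continuous_intros)

lemma path_homotopic_path_join:
  assumes "path_homotopic X f f'" "path_homotopic X g g'" "f 1 = g 0"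
  shows "path_homotopic X (path_join f g) (path_join f' g')"
proof -
  obtain H :: "real \<Rightarrow> real \<Rightarrow> 'a" where H: "continuous_map unit_square X (\<lambda>z. H (fst z) (snd z))"
    "\<And>t. t \<in> {0..1} \<Longrightarrow> H 0 t = f t" "\<And>t. t \<in> {0..1} \<Longrightarrow> H 1 t = f' t"
    "\<And>s. s \<in> {0..1} \<Longrightarrow> H s 0 = f 0" "\<And>s. s \<in> {0..1} \<Longrightarrow> H s 1 = f 1"
    using path_homotopicE[OF assms(1)] by blast
  obtain K :: "real \<Rightarrow> real \<Rightarrow> 'a" where K: "continuous_map unit_square X (\<lambda>z. K (fst z) (snd z))"
    "\<And>t. t \<in> {0..1} \<Longrightarrow> K 0 t = g t" "\<And>t. t \<in> {0..1} \<Longrightarrow> K 1 t = g' t"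
    "\<And>s. s \<in> {0..1} \<Longrightarrow> K s 0 = g 0" "\<And>s. s \<in> {0..1} \<Longrightarrow> K s 1 = g 1"
    using path_homotopicE[OF assms(2)] by blast
  show ?thesis
    by (rule path_homotopicI[where H = "\<lambda>s. path_join (H s) (K s)"],
        rule continuous_map_path_join[OF H(1) K(1)])
      (use H K assms(3) in \<open>auto intro!: path_join_eq\<close>)
qed

text \<open>
  Associativity, units and inverses of concatenation are instances of this: the two sides run
  through the same path \<open>F\<close>, at speeds that are homotopic because an interval is convex.
\<close>

lemma path_homotopic_reparam:
  fixes F :: "real \<Rightarrow> 'a"
  assumes F: "continuous_map (top_of_set {a..b}) X F"
    and \<phi>: "continuous_on {0..1} \<phi>" "\<phi> ` {0..1} \<subseteq> {a..b}"
    and \<psi>: "continuous_on {0..1} \<psi>" "\<psi> ` {0..1} \<subseteq> {a..b}"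
    and ends: "\<phi> 0 = \<psi> 0" "\<phi> 1 = \<psi> 1"
    and f: "\<And>t. t \<in> {0..1} \<Longrightarrow> f t = F (\<phi> t)"
    and g: "\<And>t. t \<in> {0..1} \<Longrightarrow> g t = F (\<psi> t)"
  shows "path_homotopic X f g"
proof (rule path_homotopicI[where H = "\<lambda>s t. F ((1 - s) * \<phi> t + s * \<psi> t)"])
  have "(1 - s) * \<phi> t + s * \<psi> t \<in> {a..b}" if "s \<in> {0..1}" "t \<in> {0..1}" for s t
  proof -
    have "\<phi> t \<in> {a..b}" "\<psi> t \<in> {a..b}" using \<phi>(2) \<psi>(2) that(2) by blast+
    then show ?thesis
      using convexD_alt[OF convex_real_interval(5), of "\<phi> t" a b "\<psi> t" s] that(1) by simp
  qed
  then show "continuous_map unit_square X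
      (\<lambda>z. F ((1 - fst z) * \<phi> (snd z) + fst z * \<psi> (snd z)))"
    by (intro continuous_map_compose_on[OF F])
      (auto intro!: continuous_intros continuous_on_compose2[OF \<phi>(1)] continuous_on_compose2[OF \<psi>(1)])
qed (use f g ends in \<open>auto simp: algebra_simps\<close>)

text \<open>
  Concatenation at unit speed, of which both ways to bracket three paths are reparametrisations.
\<close>

definition path_chain3 :: "(real \<Rightarrow> 'a) \<Rightarrow> (real \<Rightarrow> 'a) \<Rightarrow> (real \<Rightarrow> 'a) \<Rightarrow> real \<Rightarrow> 'a" where
  "path_chain3 f g h x = (if x \<le> 1 then f x else if x \<le> 2 then g (x - 1) else h (x - 2))"

lemma continuous_map_path_chain3:
  assumes "pathin X f" "pathin X g" "pathin X h" "f 1 = g 0" "g 1 = h 0"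
  shows "continuous_map (top_of_set {0..3}) X (path_chain3 f g h)"
proof -
  have "continuous_map (top_of_set {z\<in>{0..3}. 1 \<le> z}) X (\<lambda>x. if x \<le> 2 then g (x - 1) else h (x - 2))"
  proof (rule continuous_map_if_le[of _ "\<lambda>x. x"])
    show "continuous_map (top_of_set {z \<in> {z \<in> {0..3}. 1 \<le> z}. z \<le> 2}) X (\<lambda>z. g (z - 1))"
      using assms(2) unfolding pathin_def
      by (rule continuous_map_compose_on) (auto intro!: continuous_intros)
    show "continuous_map (top_of_set {z \<in> {z \<in> {0..3}. 1 \<le> z}. 2 \<le> z}) X (\<lambda>z. h (z - 2))"
      using assms(3) unfolding pathin_def
      by (rule continuous_map_compose_on) (auto intro!: continuous_intros)
  qed (use assms in auto)
  moreover have "continuous_map (top_of_set {z\<in>{0..3}. z \<le> 1}) X (\<lambda>z. f z)"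
    using assms(1) unfolding pathin_def
    by (rule continuous_map_compose_on) (auto intro!: continuous_intros)
  ultimately have "continuous_map (top_of_set {0..3}) X
      (\<lambda>x. if x \<le> 1 then f x else if x \<le> 2 then g (x - 1) else h (x - 2))"
    by - (rule continuous_map_if_le[of _ "\<lambda>x. x"], use assms(4) in auto)
  then show ?thesis by (simp add: path_chain3_def[abs_def])
qed

lemma path_join_left_chain3:
  assumes "f 1 = g 0" "g 1 = h 0"
  shows "path_join (path_join f g) h t = path_chain3 f g h (min (4 * t) (2 * t + 1))"
proof -
  consider "t \<le> 1/4" | "1/4 < t" "t \<le> 1/2" | "1/2 < t" by linarith
  then show ?thesis
    by cases (auto simp: path_join_def path_chain3_def min_def)
qed

lemma path_homotopic_assoc:
  assumes "pathin X f" "pathin X g" "pathin X h" "f 1 = g 0" "g 1 = h 0"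
  shows "path_homotopic X (path_join (path_join f g) h) (path_join f (path_join g h))"
proof (rule path_homotopic_reparam[OF continuous_map_path_chain3[OF assms]])
  show "path_join (path_join f g) h t = path_chain3 f g h (min (4 * t) (2 * t + 1))" for t
    using assms(4,5) by (rule path_join_left_chain3)
  show "path_join f (path_join g h) t = path_chain3 f g h (max (2 * t) (4 * t - 1))" for t
  proof -
    consider "t = 1/2" | "t < 1/2" | "1/2 < t" "t \<le> 3/4" | "3/4 < t" by linarith
    then show ?thesis
    proof cases
      case 1
      show ?thesis unfolding 1 by (simp add: path_join_def path_chain3_def)
    qed (auto simp: path_join_def path_chain3_def max_def)
  qed
qed (auto intro!: continuous_intros)

lemma path_homotopic_const_join:
  assumes "pathin X f" "a = f 0"
  shows "path_homotopic X (path_join (\<lambda>_. a) f) f"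
proof (rule path_homotopic_reparam[where F = f and \<phi> = "\<lambda>t. max 0 (2 * t - 1)" and \<psi> = "\<lambda>t. t" and a =
    0 and b = 1])
  show "path_join (\<lambda>_. a) f t = f (max 0 (2 * t - 1))" for t
  proof (cases "t = 1/2")
    case True
    show ?thesis unfolding True using assms(2) by (simp add: path_join_def)
  qed (use assms(2) in \<open>auto simp: path_join_def max_def\<close>)
qed (use assms in \<open>auto simp: pathin_def intro!: continuous_intros\<close>)

lemma path_homotopic_join_const:
  assumes "pathin X f" "a = f 1"
  shows "path_homotopic X (path_join f (\<lambda>_. a)) f"
proof (rule path_homotopic_reparam[where F = f and \<phi> = "\<lambda>t. min 1 (2 * t)" and \<psi> = "\<lambda>t. t" and a =
    0 and b = 1])
  show "path_join f (\<lambda>_. a) t = f (min 1 (2 * t))" for t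
  proof (cases "t = 1/2")
    case True
    show ?thesis unfolding True using assms(2) by (simp add: path_join_def)
  qed (use assms(2) in \<open>auto simp: path_join_def min_def\<close>)
qed (use assms in \<open>auto simp: pathin_def intro!: continuous_intros\<close>)

lemma path_homotopic_join_rev:
  assumes "pathin X f"
  shows "path_homotopic X (path_join f (path_rev f)) (\<lambda>_. f 0)"
proof (rule path_homotopic_reparam[where F = f and \<phi> = "\<lambda>t. min (2 * t) (2 - 2 * t)" and \<psi> =
    "\<lambda>t. 0" and a = 0 and b = 1])
  show "path_join f (path_rev f) t = f (min (2 * t) (2 - 2 * t))" for t
    by (auto simp: path_join_def path_rev_def min_def)
qed (use assms in \<open>auto simp: pathin_def intro!: continuous_intros\<close>)

lemma path_rev_rev [simp]: "path_rev (path_rev f) = f"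
  by (simp add: path_rev_def)

lemma path_homotopic_rev_join: "pathin X f \<Longrightarrow> path_homotopic X (path_join (path_rev f) f) (\<lambda>_. f 1)"
  using path_homotopic_join_rev[OF pathin_path_rev, of X f] by simp

lemma path_homotopic_cancel:
  assumes a: "pathin X a" and p: "pathin X p" and r: "pathin X r" and q: "pathin X q" and c: "pathin X c"
    and ends: "a 1 = p 0" "p 1 = r 1" "r 1 = q 0" "q 1 = c 0"
  shows "path_homotopic X (path_join (path_join (path_join a p) (path_rev r)) (path_join
    (path_join r q) c))
    (path_join (path_join a (path_join p q)) c)"
proof -
  let ?x = "path_join a p" and ?y = "path_join q c"
  have x: "pathin X ?x" and y: "pathin X ?y" and r': "pathin X (path_rev r)"
    using assms by (auto intro: pathin_path_join pathin_path_rev)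
  have ry: "pathin X (path_join r ?y)" using y r ends by (auto intro: pathin_path_join)
  have "path_homotopic X (path_join (path_rev r) (path_join r ?y)) (path_join (path_join
      (path_rev r) r) ?y)"
    using path_homotopic_assoc[OF r' r y] ends by (auto intro: path_homotopic_sym)
  also have "path_homotopic X \<dots> (path_join (\<lambda>_. r 1) ?y)"
    using path_homotopic_path_join[OF path_homotopic_rev_join[OF r] path_homotopic_refl[OF y]] ends
        by simp
  also have "path_homotopic X \<dots> ?y" using path_homotopic_const_join[OF y] ends by simp
  finally have cancel: "path_homotopic X (path_join (path_rev r) (path_join r ?y)) ?y" .
  have "path_homotopic X (path_join (path_join ?x (path_rev r)) (path_join (path_join r q) c))
      (path_join (path_join ?x (path_rev r)) (path_join r ?y))"
    using ends by (intro path_homotopic_path_join path_homotopic_refl pathin_path_join x r'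
        path_homotopic_assoc r q c) auto
  also have "path_homotopic X \<dots> (path_join ?x (path_join (path_rev r) (path_join r ?y)))"
    using path_homotopic_assoc[OF x r' ry] ends by simp
  also have "path_homotopic X \<dots> (path_join ?x ?y)"
    using path_homotopic_path_join[OF path_homotopic_refl[OF x] cancel] ends by simp
  also have "path_homotopic X \<dots> (path_join (path_join ?x q) c)"
    using path_homotopic_assoc[OF x q c] ends by (auto intro: path_homotopic_sym)
  also have "path_homotopic X \<dots> (path_join (path_join a (path_join p q)) c)"
    using ends by (intro path_homotopic_path_join path_homotopic_assoc path_homotopic_refl a p q c) auto
  finally show ?thesis .
qed


section \<open>Lifting squares through covering maps\<close>

text \<open>
  Evenly covered sets, phrased by sections: the sheet through a point over \<open>V\<close> is the image of the
  section \<open>r\<close> through it.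
\<close>

definition covering_proj :: "'a topology \<Rightarrow> 'b topology \<Rightarrow> ('a \<Rightarrow> 'b) \<Rightarrow> bool" where
  "covering_proj X Y q \<longleftrightarrow> Hausdorff_space X \<and> continuous_map X Y q \<and>
    (\<forall>x\<in>topspace X. \<exists>U. openin X U \<and> x \<in> U \<and> inj_on q U) \<and>
    (\<forall>y\<in>topspace Y. \<exists>V. openin Y V \<and> y \<in> V \<and>
      (\<forall>x\<in>topspace X. q x \<in> V \<longrightarrow>
        (\<exists>r. continuous_map (subtopology Y V) X r \<and> (\<forall>z\<in>V. q (r z) = z) \<and> r (q x) = x)))"

lemma covering_proj_chart:
  assumes "covering_proj X Y q" "y \<in> topspace Y"
  obtains V where "openin Y V" "y \<in> V"
    "\<And>x. x \<in> topspace X \<Longrightarrow> q x \<in> V \<Longrightarrow>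
      \<exists>r. continuous_map (subtopology Y V) X r \<and> (\<forall>z\<in>V. q (r z) = z) \<and> r (q x) = x"
proof -
  have "\<exists>V. openin Y V \<and> y \<in> V \<and> (\<forall>x\<in>topspace X. q x \<in> V \<longrightarrow>
      (\<exists>r. continuous_map (subtopology Y V) X r \<and> (\<forall>z\<in>V. q (r z) = z) \<and> r (q x) = x))"
    using assms by (simp add: covering_proj_def)
  then obtain V where V: "openin Y V \<and> y \<in> V \<and> (\<forall>x\<in>topspace X. q x \<in> V \<longrightarrow>
      (\<exists>r. continuous_map (subtopology Y V) X r \<and> (\<forall>z\<in>V. q (r z) = z) \<and> r (q x) = x))" ..
  show thesis by (rule that[of V]) (use V in simp_all)
qed

text \<open>
  The set on which two lifts agree is closed because \<open>X\<close> is Hausdorff, and open because \<open>q\<close> is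
  locally injective.
\<close>

lemma lift_unique:
  assumes q: "covering_proj X Y q"
    and f: "continuous_map Z X f" and g: "continuous_map Z X g" and Z: "connected_space Z"
    and eq: "\<And>z. z \<in> topspace Z \<Longrightarrow> q (f z) = q (g z)"
    and z0: "z0 \<in> topspace Z" "f z0 = g z0" and z: "z \<in> topspace Z"
  shows "f z = g z"
proof -
  let ?A = "{z \<in> topspace Z. f z = g z}"
  have "closedin Z ?A"
    using q f g by (auto simp: covering_proj_def intro: closedin_continuous_maps_eq)
  moreover have "openin Z ?A"
  proof (subst openin_subopen, intro ballI)
    fix w assume w: "w \<in> ?A"
    then have "f w \<in> topspace X" using continuous_map_image_subset_topspace[OF f] by blast
    then obtain U where U: "openin X U" "f w \<in> U" "inj_on q U"
      using q unfolding covering_proj_def by blast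
    let ?T = "{z \<in> topspace Z. f z \<in> U} \<inter> {z \<in> topspace Z. g z \<in> U}"
    have "openin Z ?T"
      using openin_continuous_map_preimage[OF f U(1)] openin_continuous_map_preimage[OF g U(1)] by blast
    moreover have "w \<in> ?T" using w U by auto
    moreover have "?T \<subseteq> ?A" using U(3) eq by (auto simp: inj_on_def)
    ultimately show "\<exists>T. openin Z T \<and> w \<in> T \<and> T \<subseteq> ?A" by blast
  qed
  ultimately have "?A = topspace Z"
    using Z z0 unfolding connected_space_clopen_in by blast
  then show ?thesis using z by blast
qed

text \<open>
  A lift is demanded through every point over every point of \<open>K\<close>, so that lifts over overlapping
  sets can be made to fit.
\<close>

definition liftable :: "'a topology \<Rightarrow> ('a \<Rightarrow> 'b) \<Rightarrow> ('c::topological_space \<Rightarrow> 'b) \<Rightarrow> 'c set \<Rightarrow> bool" where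
  "liftable X q H K \<longleftrightarrow> (\<forall>s\<in>K. \<forall>x\<in>topspace X. q x = H s \<longrightarrow>
    (\<exists>f. continuous_map (top_of_set K) X f \<and> (\<forall>z\<in>K. q (f z) = H z) \<and> f s = x))"

lemma liftableD:
  assumes "liftable X q H K" "s \<in> K" "x \<in> topspace X" "q x = H s"
  obtains f where "continuous_map (top_of_set K) X f" "\<And>z. z \<in> K \<Longrightarrow> q (f z) = H z" "f s = x"
  using assms unfolding liftable_def by blast

text \<open>
  The second lift is started at a point that the first one has reached. On the connected overlap the
  two agree by uniqueness, and closedness allows them to be pasted.
\<close>

lemma liftable_Un:
  assumes q: "covering_proj X Y q"
    and lift: "liftable X q H K" "liftable X q H L"
    and closed: "closed K" "closed L" and conn: "connected (K \<inter> L)" "K \<inter> L \<noteq> {}"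
  shows "liftable X q H (K \<union> L)"
proof -
  have glue: "\<exists>f. continuous_map (top_of_set (K \<union> L)) X f \<and> (\<forall>z\<in>K \<union> L. q (f z) = H z) \<and> f s = x"
    if lift: "liftable X q H K" "liftable X q H L" and closed: "closed K" "closed L"
      and conn: "connected (K \<inter> L)" "K \<inter> L \<noteq> {}"
      and s: "s \<in> K" and x: "x \<in> topspace X" "q x = H s" for K L s x
  proof -
    obtain f where f: "continuous_map (top_of_set K) X f" "\<And>z. z \<in> K \<Longrightarrow> q (f z) = H z" "f s = x"
      using lift(1) s x unfolding liftable_def by blast
    obtain u where u: "u \<in> K" "u \<in> L" using conn by blast
    have "f u \<in> topspace X" using f(1) u unfolding continuous_map_def by auto
    then obtain g where g: "continuous_map (top_of_set L) X g" "\<And>z. z \<in> L \<Longrightarrow> q (g z) = H z" "g u = f u"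
      using lift(2) u f(2)[of u] unfolding liftable_def by metis
    have agree: "f z = g z" if "z \<in> K" "z \<in> L" for z
    proof (rule lift_unique[OF q, of "top_of_set (K \<inter> L)" f g u])
      show "continuous_map (top_of_set (K \<inter> L)) X f" "continuous_map (top_of_set (K \<inter> L)) X g"
        using f(1) g(1) by (auto intro: continuous_map_from_subtopology_mono)
      show "connected_space (top_of_set (K \<inter> L))"
        using conn(1) by (simp add: connected_space_subtopology connectedin_def
            connectedin_iff_connected[symmetric])
    qed (use f g u that in auto)
    have 1: "(K \<union> L) \<inter> K = K" and 2: "(K \<union> L) \<inter> L = L" by auto
    have "continuous_map (top_of_set (K \<union> L)) X (\<lambda>z. if z \<in> K then f z else g z)"
    proof (rule pasting_lemma_closed[where I = "{True, False}" and T = "\<lambda>b. if b then K else L"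
          and f = "\<lambda>b. if b then f else g"])
      show "closedin (top_of_set (K \<union> L)) (if b then K else L)" for b
        using closed by (auto intro!: closed_subset)
    qed (use f(1) g(1) agree in \<open>auto simp: subtopology_subtopology 1 2\<close>)
    then show ?thesis using f g s by (intro exI[of _ "\<lambda>z. if z \<in> K then f z else g z"]) auto
  qed
  show ?thesis
    unfolding liftable_def
  proof (intro ballI impI)
    fix s x assume "s \<in> K \<union> L" "x \<in> topspace X" "q x = H s"
    then show "\<exists>f. continuous_map (top_of_set (K \<union> L)) X f \<and> (\<forall>z\<in>K \<union> L. q (f z) = H z) \<and> f s = x"
      using glue[of K L s x] glue[of L K s x] assms by (auto simp: Un_commute Int_commute)
  qed
qed

lemma liftable_in_chart:
  assumes H: "continuous_map (top_of_set K) Y H"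
    and V: "\<And>x. x \<in> topspace X \<Longrightarrow> q x \<in> V \<Longrightarrow>
        \<exists>r. continuous_map (subtopology Y V) X r \<and> (\<forall>z\<in>V. q (r z) = z) \<and> r (q x) = x"
    and HV: "\<And>z. z \<in> K \<Longrightarrow> H z \<in> V"
  shows "liftable X q H K"
  unfolding liftable_def
proof (intro ballI impI)
  fix s x assume s: "s \<in> K" "x \<in> topspace X" "q x = H s"
  then obtain r where r: "continuous_map (subtopology Y V) X r" "\<And>z. z\<in>V \<Longrightarrow> q (r z) = z" "r (q x) = x"
    using V[of x] HV[of s] by auto
  have "continuous_map (top_of_set K) (subtopology Y V) H"
    using H HV by (auto simp: continuous_map_in_subtopology)
  from continuous_map_compose[OF this r(1)]
  show "\<exists>f. continuous_map (top_of_set K) X f \<and> (\<forall>z\<in>K. q (f z) = H z) \<and> f s = x"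
    using r s HV by (intro exI[of _ "r \<circ> H"]) auto
qed

text \<open>
  Boxes that \<open>H\<close> sends into one evenly covered set are liftable. By compactness of the segment over
  \<open>x\<close>, finitely many of them cover a strip around it and can be glued along the second
  coordinate; the strips are then glued along the first.
\<close>

lemma liftable_square:
  assumes q: "covering_proj X Y q"
    and H: "continuous_map unit_square Y H"
  shows "liftable X q H ({0..1} \<times> {0..1})"
proof -
  let ?P = "\<lambda>a b. 0 \<le> a \<and> a \<le> b \<and> b \<le> 1 \<longrightarrow> liftable X q H ({a..b} \<times> {0..1})"
  have "?P 0 1"
  proof (rule Bolzano[where P = ?P])
    fix a b c :: real
    assume trans: "?P a b" "?P b c" "a \<le> b" "b \<le> c"
    show "?P a c"
    proof
      assume *: "0 \<le> a \<and> a \<le> c \<and> c \<le> 1"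
      have un: "{a..c} \<times> {0..1::real} = {a..b} \<times> {0..1} \<union> {b..c} \<times> {0..1}"
        and int: "({a..b} \<times> {0..1::real}) \<inter> ({b..c} \<times> {0..1}) = {b} \<times> {0..1}"
        using trans by auto
      show "liftable X q H ({a..c} \<times> {0..1})"
        unfolding un using trans * 
        by (intro liftable_Un[OF q]) (auto simp: int intro!: closed_Times connected_Times)
    qed
  next
    fix x :: real
    assume x: "0 \<le> x" "x \<le> 1"
    let ?Q = "\<lambda>c e. 0 \<le> c \<and> c \<le> e \<and> e \<le> 1 \<longrightarrow>
      (\<exists>d>0. \<forall>a b. 0 \<le> a \<and> a \<le> x \<and> x \<le> b \<and> b \<le> 1 \<and> b - a < d \<longrightarrow> liftable X q H ({a..b} \<times> {c..e}))"
    have "?Q 0 1"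
    proof (rule Bolzano[where P = ?Q])
      fix c d e :: real
      assume trans: "?Q c d" "?Q d e" "c \<le> d" "d \<le> e"
      show "?Q c e"
      proof
        assume *: "0 \<le> c \<and> c \<le> e \<and> e \<le> 1"
        obtain \<delta>1 where \<delta>1: "\<delta>1 > 0" "\<And>a b. \<lbrakk>0 \<le> a; a \<le> x; x \<le> b; b \<le> 1; b - a < \<delta>1\<rbrakk> \<Longrightarrow>
            liftable X q H ({a..b} \<times> {c..d})"
          using trans * by (metis order_trans)
        obtain \<delta>2 where \<delta>2: "\<delta>2 > 0" "\<And>a b. \<lbrakk>0 \<le> a; a \<le> x; x \<le> b; b \<le> 1; b - a < \<delta>2\<rbrakk> \<Longrightarrow>
            liftable X q H ({a..b} \<times> {d..e})"
          using trans * by (metis order_trans)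
        have "liftable X q H ({a..b} \<times> {c..e})"
          if "0 \<le> a" "a \<le> x" "x \<le> b" "b \<le> 1" "b - a < min \<delta>1 \<delta>2" for a b
        proof -
          have un: "{a..b} \<times> {c..e} = {a..b} \<times> {c..d} \<union> {a..b} \<times> {d..e}"
            and int: "({a..b} \<times> {c..d}) \<inter> ({a..b} \<times> {d..e}) = {a..b} \<times> {d}"
            using trans by auto
          show ?thesis
            unfolding un using trans * that \<delta>1 \<delta>2
            by (intro liftable_Un[OF q]) (auto simp: int intro!: closed_Times connected_Times)
        qed
        then show "\<exists>d>0. \<forall>a b. 0 \<le> a \<and> a \<le> x \<and> x \<le> b \<and> b \<le> 1 \<and> b - a < d \<longrightarrow>
            liftable X q H ({a..b} \<times> {c..e})"
          using \<delta>1(1) \<delta>2(1) by (intro exI[of _ "min \<delta>1 \<delta>2"]) auto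
      qed
    next
      fix y :: real
      assume y: "0 \<le> y" "y \<le> 1"
      have xy: "(x, y) \<in> {0..1} \<times> {0..1}"
        using x y by auto
      then have "H (x, y) \<in> topspace Y" using H by (auto simp: continuous_map_def)
      then obtain V where V: "openin Y V" "H (x, y) \<in> V" "\<And>u. u\<in>topspace X \<Longrightarrow> q u \<in> V \<Longrightarrow>
          \<exists>r. continuous_map (subtopology Y V) X r \<and> (\<forall>z\<in>V. q (r z) = z) \<and> r (q u) = u"
        using covering_proj_chart[OF q, of "H (x, y)"] by metis
      have "openin unit_square {z \<in> topspace unit_square. H z \<in> V}"
        using openin_continuous_map_preimage[OF H V(1)] .
      then have "\<exists>\<epsilon>>0. \<forall>z\<in>{0..1} \<times> {0..1}. dist z (x, y) < \<epsilon> \<longrightarrow> z \<in> {z \<in> topspace unit_square. H z \<in> V}"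
        unfolding openin_euclidean_subtopology_iff using xy V(2) by simp
      then obtain \<epsilon> where \<epsilon>: "\<epsilon> > 0" "\<And>z. z \<in> {0..1} \<times> {0..1} \<Longrightarrow> dist z (x, y) < \<epsilon> \<Longrightarrow> H z \<in> V"
        by blast
      have "liftable X q H ({a..b} \<times> {c..e})"
        if box: "0 \<le> a" "a \<le> x" "x \<le> b" "b \<le> 1" "b - a < \<epsilon> / 2"
          "0 \<le> c" "c \<le> y" "y \<le> e" "e \<le> 1" "e - c < \<epsilon> / 2" for a b c e
      proof (rule liftable_in_chart[OF _ V(3)])
        show "continuous_map (top_of_set ({a..b} \<times> {c..e})) Y H"
          by (rule continuous_map_from_subtopology_mono[OF H]) (use that in auto)
        show "H z \<in> V" if z: "z \<in> {a..b} \<times> {c..e}" for z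
        proof (rule \<epsilon>(2))
          obtain x' y' where z': "z = (x', y')" by (cases z)
          have "dist z (x, y) \<le> \<bar>x' - x\<bar> + \<bar>y' - y\<bar>"
            using sqrt_sum_squares_le_sum_abs[of "x' - x" "y' - y"]
            by (simp add: z' dist_Pair_Pair dist_real_def)
          then show "dist z (x, y) < \<epsilon>"
            using z \<open>0 \<le> a\<close> \<open>a \<le> x\<close> \<open>x \<le> b\<close> \<open>b - a < \<epsilon> / 2\<close> \<open>c \<le> y\<close> \<open>y \<le> e\<close> \<open>e - c < \<epsilon> / 2\<close>
            by (auto simp: z' abs_if split: if_splits)
        qed (use z box in auto)
      qed auto
      then have "\<forall>c e. c \<le> y \<and> y \<le> e \<and> e - c < \<epsilon> / 2 \<longrightarrow> ?Q c e"
        using \<epsilon>(1) half_gt_zero by blast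
      then show "\<exists>d>0. \<forall>c e. c \<le> y \<and> y \<le> e \<and> e - c < d \<longrightarrow> ?Q c e"
        using \<epsilon>(1) half_gt_zero by blast
    qed simp
    then obtain d where "d > 0"
      "\<And>a b. \<lbrakk>0 \<le> a; a \<le> x; x \<le> b; b \<le> 1; b - a < d\<rbrakk> \<Longrightarrow> liftable X q H ({a..b} \<times> {0..1})"
      by auto
    then show "\<exists>d>0. \<forall>a b. a \<le> x \<and> x \<le> b \<and> b - a < d \<longrightarrow> ?P a b" by blast
  qed simp
  then show ?thesis by simp
qed

text \<open>
  A path is a square that is constant in one coordinate.
\<close>

lemma path_lift:
  assumes q: "covering_proj X Y q" and p: "pathin Y p" and x: "x \<in> topspace X" "q x = p 0"
  obtains f where "pathin X f" "\<And>t. t \<in> {0..1} \<Longrightarrow> q (f t) = p t" "f 0 = x"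
proof -
  have "liftable X q (\<lambda>z. p (snd z)) ({0..1::real} \<times> {0..1})"
    using p liftable_square[OF q] by (simp add: pathin_iff_square)
  then obtain F where F: "continuous_map unit_square X F"
    "\<And>z. z \<in> {0..1::real} \<times> {0..1} \<Longrightarrow> q (F z) = p (snd z)" "F (0, 0) = x"
    by (rule liftableD[of X q _ _ "(0, 0)" x]) (use x in auto)
  show thesis
  proof (rule that[of "\<lambda>t. F (0, t)"])
    show "pathin X (\<lambda>t. F (0, t))"
      using pathin_slice[of "{0..1}" X "\<lambda>s t. F (s, t)" 0] F(1) by simp
  qed (use F in auto)
qed

lemma path_lift_unique:
  assumes q: "covering_proj X Y q" and "pathin X f" "pathin X g"
    and "\<And>t. t \<in> {0..1} \<Longrightarrow> q (f t) = q (g t)" "f 0 = g 0" "t \<in> {0..1}"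
  shows "f t = g t"
  by (rule lift_unique[OF q, of "top_of_set {0..1}" f g 0])
    (use assms in \<open>auto simp: pathin_def connected_space_subtopology
        connectedin_iff_connected[symmetric] connectedin_def\<close>)

text \<open>
  Lift the homotopy. Its two sides are constant paths in the base and so lift to constant paths; hence
  the lift is a homotopy relative to endpoints, from \<open>f\<close> to a lift of the second path that
  starts where \<open>g\<close> starts.
\<close>

lemma path_homotopic_lift:
  assumes q: "covering_proj X Y q" and f: "pathin X f" and g: "pathin X g" and start: "f 0 = g 0"
    and hom: "path_homotopic Y (q \<circ> f) (q \<circ> g)"
  shows "path_homotopic X f g"
proof -
  obtain H :: "real \<Rightarrow> real \<Rightarrow> 'b" where H: "continuous_map unit_square Y (\<lambda>z. H (fst z) (snd z))"
    "\<And>t. t \<in> {0..1} \<Longrightarrow> H 0 t = (q \<circ> f) t" "\<And>t. t \<in> {0..1} \<Longrightarrow> H 1 t = (q \<circ> g) t"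
    "\<And>s. s \<in> {0..1} \<Longrightarrow> H s 0 = (q \<circ> f) 0" "\<And>s. s \<in> {0..1} \<Longrightarrow> H s 1 = (q \<circ> f) 1"
    using path_homotopicE[OF hom] by blast
  obtain F :: "real \<times> real \<Rightarrow> 'a" where F: "continuous_map unit_square X F"
    "\<And>z. z \<in> {0..1} \<times> {0..1} \<Longrightarrow> q (F z) = H (fst z) (snd z)" "F (0, 0) = f 0"
    by (rule liftableD[OF liftable_square[OF q H(1)], of "(0, 0)" "f 0"])
      (use pathin_in[OF f, of 0] H(2)[of 0] in auto)
  have slice: "pathin X (\<lambda>t. F (s, t))" if "s \<in> {0..1}" for s
    using pathin_slice[of "{0..1}" X "\<lambda>s t. F (s, t)" s] F(1) that by simp
  have slice': "pathin X (\<lambda>s. F (s, t))" if "t \<in> {0..1}" for t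
    unfolding pathin_def by (rule continuous_map_compose_on[OF F(1)])
        (use that in \<open>auto intro!: continuous_intros\<close>)
  have const: "pathin X (\<lambda>_. f 0)" "pathin X (\<lambda>_. f 1)"
    using pathin_in[OF f] by (auto simp: pathin_def)
  have bottom: "F (0, t) = f t" if "t \<in> {0..1}" for t
    by (rule path_lift_unique[OF q slice f, of 0]) (use F H that in auto)
  have left: "F (s, 0) = f 0" if "s \<in> {0..1}" for s
    by (rule path_lift_unique[OF q slice' const(1), of 0]) (use F H that in auto)
  have right: "F (s, 1) = f 1" if "s \<in> {0..1}" for s
    by (rule path_lift_unique[OF q slice' const(2), of 1]) (use F H that bottom[of 1] in auto)
  have top: "F (1, t) = g t" if "t \<in> {0..1}" for t
    by (rule path_lift_unique[OF q slice g, of 1]) (use F H that left[of 1] start in auto)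
  show ?thesis
    by (rule path_homotopicI[where H = "\<lambda>s t. F (s, t)"]) (use F(1) bottom top left right in auto)
qed


section \<open>Block permutations\<close>

abbreviation offset :: "nat list \<Rightarrow> nat \<Rightarrow> nat" where
  "offset ms i \<equiv> sum_list (take i ms)"

lemma offset_le: "i < i' \<Longrightarrow> i' \<le> length ms \<Longrightarrow> offset ms i + ms ! i \<le> offset ms i'"
proof -
  assume "i < i'" "i' \<le> length ms"
  then have "offset ms i + ms ! i = offset ms (Suc i)" by (simp add: take_Suc_conv_app_nth)
  also have "take i' ms = take (Suc i) ms @ drop (Suc i) (take i' ms)"
    using \<open>i < i'\<close> append_take_drop_id[of "Suc i" "take i' ms"] by (simp add: min_def)
  then have "offset ms (Suc i) \<le> offset ms i'" by (metis le_add1 sum_list_append)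
  finally show ?thesis .
qed

lemma offset_less_sum_list: "i < length ms \<Longrightarrow> j < ms ! i \<Longrightarrow> offset ms i + j < sum_list ms"
  using offset_le[of i "length ms" ms] by simp

lemma offset_cases:
  assumes "x < sum_list ms"
  obtains i j where "i < length ms" "j < ms ! i" "x = offset ms i + j"
  using assms
proof (induction ms arbitrary: x thesis)
  case (Cons m ms)
  show ?case
  proof (cases "x < m")
    case True
    then show ?thesis using Cons.prems(1)[of 0 x] by simp
  next
    case False
    then have "x - m < sum_list ms" using Cons.prems(2) by auto
    then obtain i j where "i < length ms" "j < ms ! i" "x - m = offset ms i + j"
      by (rule Cons.IH[rotated])
    then show ?thesis using Cons.prems(1)[of "Suc i" j] False by simp
  qed
qed simp

lemma offset_inject:
  assumes "i < length ms" "j < ms ! i" "i' < length ms" "j' < ms ! i'"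
  shows "offset ms i + j = offset ms i' + j' \<longleftrightarrow> i = i' \<and> j = j'"
  using offset_le[of i i' ms] offset_le[of i' i ms] assms
  by (cases i i' rule: linorder_cases) auto

lemma concat_nth_offset:
  "i < length xss \<Longrightarrow> j < length (xss ! i) \<Longrightarrow>
    concat xss ! (offset (map length xss) i + j) = xss ! i ! j"
proof (induction xss arbitrary: i)
  case (Cons xs xss)
  then show ?case by (cases i) (auto simp: nth_append)
qed simp

lemma permute_inv_nth:
  assumes "\<sigma> permutes {..<length xs}" "i < length xs"
  shows "permute_inv \<sigma> xs ! (\<sigma> i) = xs ! i"
proof -
  have "\<sigma> i < length xs" using permutes_in_image[OF assms(1)] assms(2) by auto
  then show ?thesis
    by (simp add: permute_list_def permutes_inverses(2)[OF assms(1)])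
qed

lemma permutes_inv_less: "\<sigma> permutes {..<n} \<Longrightarrow> i < n \<Longrightarrow> inv_into UNIV \<sigma> i < n"
  using permutes_in_image[OF permutes_inv] by fastforce

lemma permutes_less: "\<sigma> permutes {..<n} \<Longrightarrow> i < n \<Longrightarrow> \<sigma> i < n"
  using permutes_in_image by fastforce

lemma sum_list_permute_inv:
  fixes ms :: "nat list"
  assumes "\<sigma> permutes {..<length ms}"
  shows "sum_list (permute_inv \<sigma> ms) = sum_list ms"
  using mset_permute_list[OF permutes_inv[OF assms]] by (metis sum_mset_sum_list)

lemma permute_inv_compose:
  assumes "\<sigma> permutes {..<length xs}" "\<sigma>' permutes {..<length xs}"
  shows "permute_inv (\<sigma>' \<circ> \<sigma>) xs = permute_inv \<sigma>' (permute_inv \<sigma> xs)"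
  using permute_list_compose[OF permutes_inv[OF assms(2)], of "inv_into UNIV \<sigma>"]
  by (simp add: o_inv_distrib permutes_bij[OF assms(1)] permutes_bij[OF assms(2)])

text \<open>
  The sum in the definition of \<open>block_perm\<close> is the position at which block \<open>\<sigma>(i)\<close> starts after
  the arities have been permuted.
\<close>

lemma block_perm_offset:
  assumes \<sigma>: "\<sigma> permutes {..<length ms}" and i: "i < length ms" "j < ms ! i"
  shows "block_perm ms \<sigma> \<tau>s (offset ms i + j) = offset (permute_inv \<sigma> ms) (\<sigma> i) + (\<tau>s ! i) j"
proof -
  have less: "\<sigma> l < length ms \<longleftrightarrow> l < length ms" for l using permutes_in_image[OF \<sigma>, of l] by simp
  have "(\<Sum>l | l < length ms \<and> \<sigma> l < \<sigma> i. ms ! l) = (\<Sum>k<\<sigma> i. permute_inv \<sigma> ms ! k)"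
  proof (rule sum.reindex_bij_witness[where i = "inv_into UNIV \<sigma>" and j = \<sigma>])
    fix k assume k: "k \<in> {..<\<sigma> i}"
    then have "k < length ms" using i less[of i] by auto
    then show "inv_into UNIV \<sigma> k \<in> {l. l < length ms \<and> \<sigma> l < \<sigma> i}"
      using k permutes_inv_less[OF \<sigma>] by (auto simp: permutes_inverses[OF \<sigma>])
  qed (use permute_inv_nth[OF \<sigma>] in \<open>auto simp: permutes_inverses[OF \<sigma>]\<close>)
  also have "\<dots> = offset (permute_inv \<sigma> ms) (\<sigma> i)"
    using i less[of i] by (simp add: sum_list_sum_nth atLeast0LessThan)
  finally have *: "(\<Sum>l | l < length ms \<and> \<sigma> l < \<sigma> i. ms ! l) = offset (permute_inv \<sigma> ms) (\<sigma> i)" .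
  show ?thesis
    unfolding block_perm_def
    using offset_less_sum_list[OF i] i
    by (auto intro!: the_equality simp: * offset_inject)
qed

lemma block_perm_permutes:
  assumes \<sigma>: "\<sigma> permutes {..<length ms}"
    and \<tau>: "\<And>i. i < length ms \<Longrightarrow> \<tau>s ! i permutes {..<ms ! i}"
  shows "block_perm ms \<sigma> \<tau>s permutes {..<sum_list ms}"
proof (rule bij_imp_permutes)
  let ?B = "block_perm ms \<sigma> \<tau>s" and ?ms = "permute_inv \<sigma> ms"
  have less: "\<sigma> i < length ?ms" "(\<tau>s ! i) j < ?ms ! (\<sigma> i)" if "i < length ms" "j < ms ! i" for i j
    using that permutes_less[OF \<sigma>] permutes_less[OF \<tau>] by (auto simp: permute_inv_nth[OF \<sigma>])
  have "?B ` {..<sum_list ms} \<subseteq> {..<sum_list ms}"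
  proof
    fix y assume "y \<in> ?B ` {..<sum_list ms}"
    then obtain i j where ij: "i < length ms" "j < ms ! i" "y = ?B (offset ms i + j)"
      by (auto elim: offset_cases)
    then show "y \<in> {..<sum_list ms}"
      using offset_less_sum_list[OF less[OF ij(1,2)]]
      by (simp add: block_perm_offset[OF \<sigma>] sum_list_permute_inv[OF \<sigma>])
  qed
  moreover have "inj_on ?B {..<sum_list ms}"
  proof (rule inj_onI)
    fix x y assume "x \<in> {..<sum_list ms}" "y \<in> {..<sum_list ms}" and eq: "?B x = ?B y"
    then obtain i j i' j' where x: "i < length ms" "j < ms ! i" "x = offset ms i + j"
      and y: "i' < length ms" "j' < ms ! i'" "y = offset ms i' + j'"
      by (auto elim!: offset_cases)
    from eq x y have "\<sigma> i = \<sigma> i' \<and> (\<tau>s ! i) j = (\<tau>s ! i') j'"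
      using offset_inject[OF less[OF x(1,2)] less[OF y(1,2)]] by (simp add: block_perm_offset[OF \<sigma>])
    then show "x = y"
      using x y permutes_inj[OF \<sigma>] permutes_inj[OF \<tau>[OF x(1)]] by (auto simp: inj_eq)
  qed
  ultimately show "bij_betw ?B {..<sum_list ms} {..<sum_list ms}"
    by (simp add: bij_betw_def endo_inj_surj)
  show "?B x = x" if "x \<notin> {..<sum_list ms}" for x
    using that by (simp add: block_perm_def)
qed

text \<open>
  Both sides move the \<open>j\<close>-th entry of the \<open>i\<close>-th block to place \<open>\<tau>\<^sub>i(j)\<close> of block \<open>\<sigma>(i)\<close>.
  The lemma is applied to lists of tuples of intervals; it is the reason why the two sides of the
  associativity law end at the same tuple.
\<close>

lemma permute_inv_concat:
  assumes \<sigma>: "\<sigma> permutes {..<length xss}"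
    and len: "length \<tau>s = length xss" "map length xss = ms"
    and \<tau>: "\<And>i. i < length xss \<Longrightarrow> \<tau>s ! i permutes {..<ms ! i}"
  shows "permute_inv (block_perm ms \<sigma> \<tau>s) (concat xss) =
    concat (permute_inv \<sigma> (map2 permute_inv \<tau>s xss))"
    (is "permute_inv ?B _ = concat ?yss")
proof (rule nth_equalityI)
  have lms: "length ms = length xss" using len by auto
  have \<sigma>': "\<sigma> permutes {..<length ms}" using \<sigma> lms by simp
  have ms: "map length ?yss = permute_inv \<sigma> ms"
  proof -
    have "map length (map2 permute_inv \<tau>s xss) = ms"
      using len by (auto intro!: nth_equalityI)
    then show ?thesis
      using permute_list_map[of "inv_into UNIV \<sigma>"
          "map2 permute_inv \<tau>s xss" length] permutes_inv[OF \<sigma>] len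
      by simp
  qed
  have sum: "length (concat xss) = sum_list ms" using len by (simp add: length_concat)
  show "length (permute_inv ?B (concat xss)) = length (concat ?yss)"
    using ms sum sum_list_permute_inv[OF \<sigma>'] by (simp add: length_concat)
  have B: "?B permutes {..<sum_list ms}"
    using \<tau> lms by (intro block_perm_permutes \<sigma>') simp
  fix y assume "y < length (permute_inv ?B (concat xss))"
  then have y: "y < sum_list ms" using sum by simp
  define x where "x = inv_into UNIV ?B y"
  have x: "x < sum_list ms" "?B x = y"
    using permutes_inv_less[OF B y] by (auto simp: x_def permutes_inverses[OF B])
  then obtain i j where ij: "i < length ms" "j < ms ! i" "x = offset ms i + j"
    by (auto elim: offset_cases)
  have y_eq: "y = offset (map length ?yss) (\<sigma> i) + (\<tau>s ! i) j"
    using x ij ms by (simp add: block_perm_offset[OF \<sigma>'])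
  have \<tau>': "\<tau>s ! i permutes {..<length (xss ! i)}" using \<tau>[of i] ij lms len(2) by auto
  have yi: "?yss ! \<sigma> i = permute_inv (\<tau>s ! i) (xss ! i)"
    using permute_inv_nth[of \<sigma> "map2 permute_inv \<tau>s xss" i] \<sigma> len ij lms by simp
  have j: "j < length (xss ! i)" using ij len lms by auto
  have "concat ?yss ! y = ?yss ! \<sigma> i ! (\<tau>s ! i) j"
    unfolding y_eq using permutes_less[OF \<sigma>] permutes_less[OF \<tau>'] ij lms j len yi
    by (intro concat_nth_offset) auto
  also have "\<dots> = xss ! i ! j"
    unfolding yi by (rule permute_inv_nth[OF \<tau>' j])
  also have "\<dots> = concat xss ! x"
    using concat_nth_offset[of i xss j] ij lms j len(2) by simp
  also have "\<dots> = permute_inv ?B (concat xss) ! y"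
    using y sum by (simp add: x_def permute_list_def)
  finally show "permute_inv ?B (concat xss) ! y = concat ?yss ! y" by simp
qed


section \<open>Ordered tuples of little intervals\<close>

text \<open>
  The path component of \<open>std_intervals k\<close>, given by inequalities that make its convexity and its
  stability under composition accessible.
\<close>

definition ordered_intervals :: "nat \<Rightarrow> (real \<times> real) list set" where
  "ordered_intervals k = {c. length c = k \<and>
    (\<forall>i<k. 0 \<le> fst (c ! i) \<and> fst (c ! i) < snd (c ! i) \<and> snd (c ! i) \<le> 1) \<and>
    (\<forall>i<k. \<forall>j<k. i < j \<longrightarrow> snd (c ! i) \<le> fst (c ! j))}"

definition blend :: "real \<Rightarrow> (real \<times> real) list \<Rightarrow> (real \<times> real) list \<Rightarrow> (real \<times> real) list" where
  "blend t u v = map2 (\<lambda>x y. (1 - t) *\<^sub>R x + t *\<^sub>R y) u v"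

definition intervals_comp :: "(real \<times> real) list \<Rightarrow> (real \<times> real) list list \<Rightarrow> (real \<times> real) list" where
  "intervals_comp c ds = concat (map2 (\<lambda>ci. map (interval_comp ci)) c ds)"

lemma ocomp_little_intervals0: "ocomp little_intervals0 ms c ds = intervals_comp c ds"
  by (simp add: little_intervals0_def intervals_comp_def)

lemma linear_path_blend: "linear_path \<eta> k u v t = \<eta> k (blend t u v)"
  by (simp add: linear_path_def blend_def)

lemma length_std_intervals [simp]: "length (std_intervals k) = k"
  by (simp add: std_intervals_def)

lemma length_ordered: "c \<in> ordered_intervals k \<Longrightarrow> length c = k"
  by (simp add: ordered_intervals_def)

lemma std_ordered: "std_intervals k \<in> ordered_intervals k"
  by (auto simp: ordered_intervals_def std_intervals_def divide_right_mono divide_strict_right_mono)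

lemma std_intervals_1: "std_intervals (Suc 0) = [(0, 1)]"
  by (simp add: std_intervals_def)

lemma length_blend [simp]: "length (blend t u v) = min (length u) (length v)"
  by (simp add: blend_def)

lemma blend_nth: "i < length u \<Longrightarrow> i < length v \<Longrightarrow> blend t u v ! i = (1 - t) *\<^sub>R (u ! i) + t *\<^sub>R (v ! i)"
  by (simp add: blend_def)

lemma blend_0: "length u = length v \<Longrightarrow> blend 0 u v = u"
  and blend_1: "length u = length v \<Longrightarrow> blend 1 u v = v"
  and blend_same: "blend t u u = u"
  by (auto intro!: nth_equalityI simp: blend_nth scaleR_left_distrib[symmetric])

lemma blend_ordered:
  assumes "u \<in> ordered_intervals k" "v \<in> ordered_intervals k" "t \<in> {0..1}"
  shows "blend t u v \<in> ordered_intervals k"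
proof -
  have conv: "(1 - t) * a + t * b \<le> (1 - t) * c + t * d" if "a \<le> c" "b \<le> d" for a b c d :: real
    using assms(3) that by (intro add_mono mult_left_mono) auto
  have strict: "(1 - t) * a + t * b < (1 - t) * c + t * d" if "a < c" "b < d" for a b c d :: real
  proof (cases "t = 0")
    case False
    then have "t * b < t * d" using assms(3) that by auto
    then show ?thesis using mult_left_mono[of a c "1 - t"] assms(3) that by auto
  qed (use that in simp)
  have "length u = k" "length v = k" using assms by (auto simp: length_ordered)
  then show ?thesis
    using assms conv[of 0 _ 0] conv[of _ 1 _ 1] conv strict
    unfolding ordered_intervals_def by (simp add: blend_nth)
qed

lemma intervals_comp_nth:
  assumes "length c = length ds" "i < length ds" "j < length (ds ! i)"
  shows "intervals_comp c ds ! (offset (map length ds) i + j) = interval_comp (c ! i) (ds ! i ! j)"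
proof -
  have "map length (map2 (\<lambda>ci. map (interval_comp ci)) c ds) = map length ds"
    using assms(1) by (auto intro!: nth_equalityI)
  then show ?thesis
    using concat_nth_offset[of i "map2 (\<lambda>ci. map (interval_comp ci)) c ds" j] assms
    by (simp add: intervals_comp_def)
qed

lemma length_intervals_comp:
  assumes "length c = length ds"
  shows "length (intervals_comp c ds) = sum_list (map length ds)"
proof -
  have "map length (map2 (\<lambda>ci. map (interval_comp ci)) c ds) = map length ds"
    using assms(1) by (auto intro!: nth_equalityI)
  then show ?thesis by (simp add: intervals_comp_def length_concat)
qed

lemma intervals_comp_Cons [simp]: "intervals_comp (x # c) (d # ds) =
  map (interval_comp x) d @ intervals_comp c ds"
  and intervals_comp_Nil [simp]: "intervals_comp [] ds = []"
  by (simp_all add: intervals_comp_def)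

lemma intervals_comp_append:
  "length c = length ds \<Longrightarrow> intervals_comp (c @ c') (ds @ ds') =
      intervals_comp c ds @ intervals_comp c' ds'"
  by (simp add: intervals_comp_def)

lemma interval_comp_assoc: "interval_comp (interval_comp x y) z = interval_comp x (interval_comp y z)"
  by (auto simp: interval_comp_def algebra_simps split: prod.splits)

lemma map_interval_comp_intervals_comp:
  "map (interval_comp x) (intervals_comp b c) = intervals_comp (map (interval_comp x) b) c"
  by (induction b c rule: list_induct2') (simp_all add: intervals_comp_def interval_comp_assoc)

lemma intervals_comp_assoc:
  assumes "length a = length bs" "list_all2 (\<lambda>b cs. length b = length cs) bs css"
  shows "intervals_comp (intervals_comp a bs) (concat css) =
    intervals_comp a (map2 intervals_comp bs css)"
  using assms(2,1)
proof (induction bs css arbitrary: a rule: list_all2_induct)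
  case (Cons b bs cs css)
  then obtain x a' where "a = x # a'" "length a' = length bs" by (cases a) auto
  then show ?case using Cons
    by (simp add: intervals_comp_append map_interval_comp_intervals_comp)
qed simp

lemma intervals_comp_ordered:
  assumes c: "c \<in> ordered_intervals (length ms)" and len: "length ds = length ms"
    and ds: "\<And>i. i < length ms \<Longrightarrow> ds ! i \<in> ordered_intervals (ms ! i)"
  shows "intervals_comp c ds \<in> ordered_intervals (sum_list ms)"
proof -
  have ms: "map length ds = ms"
    using len length_ordered[OF ds] by (auto intro!: nth_equalityI)
  have lc: "length c = length ds" using c len by (simp add: length_ordered)
  let ?w = "intervals_comp c ds"
  have nth: "?w ! (offset ms i + j) = interval_comp (c ! i) (ds ! i ! j)"
      if "i < length ms" "j < ms ! i" for i j
    using intervals_comp_nth[OF lc, of i j] that len length_ordered[OF ds] ms by simp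
  have inside: "fst x \<le> fst (interval_comp x y) \<and> fst (interval_comp x y) < snd (interval_comp x y) \<and>
      snd (interval_comp x y) \<le> snd x"
    if "fst x < snd x" "0 \<le> fst y" "fst y < snd y" "snd y \<le> 1" for x y
  proof -
    define d where "d = snd x - fst x"
    have d: "0 < d" "snd x = fst x + d" using that by (auto simp: d_def)
    have "d * snd y \<le> d" "d * fst y < d * snd y" "0 \<le> d * fst y"
      using that d mult_left_le[of "snd y" d] by auto
    then show ?thesis
      unfolding interval_comp_def case_prod_beta fst_conv snd_conv d_def[symmetric] d(2) by auto
  qed
  have mono: "snd (interval_comp x y) \<le> fst (interval_comp x z)"
    if "fst x < snd x" "snd y \<le> fst z" for x y z
    using that by (auto simp: interval_comp_def mult_left_mono split: prod.splits)
  have C: "0 \<le> fst (c ! i)" "fst (c ! i) < snd (c ! i)" "snd (c ! i) \<le> 1" if "i < length ms" for i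
    using c that by (auto simp: ordered_intervals_def)
  have C': "snd (c ! i) \<le> fst (c ! j)" if "i < j" "j < length ms" for i j
    using c that by (auto simp: ordered_intervals_def)
  have D: "0 \<le> fst (ds ! i ! j)" "fst (ds ! i ! j) < snd (ds ! i ! j)" "snd (ds ! i ! j) \<le> 1"
    if "i < length ms" "j < ms ! i" for i j
    using ds[OF that(1)] that by (auto simp: ordered_intervals_def)
  have D': "snd (ds ! i ! j) \<le> fst (ds ! i ! j')" if "i < length ms" "j < j'" "j' < ms ! i" for i j j'
    using ds[OF that(1)] that by (auto simp: ordered_intervals_def)
  have "0 \<le> fst (?w ! x) \<and> fst (?w ! x) < snd (?w ! x) \<and> snd (?w ! x) \<le> 1" if x: "x < sum_list ms" for x
  proof -
    obtain i j where ij: "i < length ms" "j < ms ! i" "x = offset ms i + j"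
      using x by (rule offset_cases)
    show ?thesis
      using inside[OF C(2)[OF ij(1)] D[OF ij(1,2)]] C[OF ij(1)] nth[OF ij(1,2)] ij(3) by auto
  qed
  moreover have "snd (?w ! x) \<le> fst (?w ! y)" if xy: "x < sum_list ms" "y < sum_list ms" "x < y" for x y
  proof -
    obtain i j where ij: "i < length ms" "j < ms ! i" "x = offset ms i + j"
      using xy(1) by (rule offset_cases)
    obtain i' j' where ij': "i' < length ms" "j' < ms ! i'" "y = offset ms i' + j'"
      using xy(2) by (rule offset_cases)
    consider "i = i'" "j < j'" | "i < i'"
      using xy(3) ij ij' offset_le[of i' i ms] by (cases i i' rule: linorder_cases) auto
    then show ?thesis
    proof cases
      case 1
      then show ?thesis
        using mono[OF C(2)[OF ij(1)] D'[OF ij(1) 1(2)]] nth[OF ij(1,2)] nth[OF ij'(1,2)] ij ij' by simp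
    next
      case 2
      then show ?thesis
        using inside[OF C(2)[OF ij(1)] D[OF ij(1,2)]] inside[OF C(2)[OF ij'(1)] D[OF ij'(1,2)]]
          C'[OF 2 ij'(1)] nth[OF ij(1,2)] nth[OF ij'(1,2)] ij ij' by simp
    qed
  qed
  ultimately show ?thesis
    using ms length_intervals_comp[OF lc] by (auto simp: ordered_intervals_def)
qed

text \<open>
  Continuity is required of each coordinate, as for the topology of \<open>little_intervals_space\<close>.
\<close>

definition interval_family :: "nat \<Rightarrow> 'b::topological_space set \<Rightarrow> ('b \<Rightarrow> (real \<times> real) list) \<Rightarrow> bool" where
  "interval_family k S u \<longleftrightarrow> (\<forall>z\<in>S. u z \<in> ordered_intervals k) \<and> (\<forall>i<k. continuous_on S (\<lambda>z. u z ! i))"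

lemma interval_family_const: "u \<in> ordered_intervals k \<Longrightarrow> interval_family k S (\<lambda>_. u)"
  by (simp add: interval_family_def)

lemma interval_family_compose:
  "interval_family k T u \<Longrightarrow> continuous_on S \<phi> \<Longrightarrow> \<phi> ` S \<subseteq> T \<Longrightarrow> interval_family k S (\<lambda>z. u (\<phi> z))"
  unfolding interval_family_def by (auto intro: continuous_on_compose2)

lemma interval_family_blend:
  assumes "interval_family k S u" "interval_family k S v" "continuous_on S w" "w ` S \<subseteq> {0..1}"
  shows "interval_family k S (\<lambda>z. blend (w z) (u z) (v z))"
  unfolding interval_family_def
proof (intro conjI ballI allI impI)
  show "blend (w z) (u z) (v z) \<in> ordered_intervals k" if "z \<in> S" for z
    using assms that unfolding interval_family_def by (intro blend_ordered) auto
  fix i assume i: "i < k"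
  have "continuous_on S (\<lambda>z. (1 - w z) *\<^sub>R (u z ! i) + w z *\<^sub>R (v z ! i))"
    using assms i unfolding interval_family_def by (intro continuous_intros) auto
  moreover have "blend (w z) (u z) (v z) ! i = (1 - w z) *\<^sub>R (u z ! i) + w z *\<^sub>R (v z ! i)"
      if "z \<in> S" for z
    using assms i that unfolding interval_family_def
    by (intro blend_nth) (auto dest!: bspec length_ordered)
  ultimately show "continuous_on S (\<lambda>z. blend (w z) (u z) (v z) ! i)"
    by (simp cong: continuous_on_cong)
qed

lemma interval_family_comp:
  assumes c: "interval_family (length ms) S c"
    and ds: "\<And>i. i < length ms \<Longrightarrow> interval_family (ms ! i) S (ds i)"
  shows "interval_family (sum_list ms) S (\<lambda>z. intervals_comp (c z) (map (\<lambda>i. ds i z) [0..<length ms]))"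
  unfolding interval_family_def
proof (intro conjI ballI allI impI)
  show "intervals_comp (c z) (map (\<lambda>i. ds i z) [0..<length ms]) \<in> ordered_intervals (sum_list ms)"
    if "z \<in> S" for z
    using assms that unfolding interval_family_def by (intro intervals_comp_ordered) auto
  fix x assume "x < sum_list ms"
  then obtain i j where ij: "i < length ms" "j < ms ! i" "x = offset ms i + j" by (rule offset_cases)
  have eq: "intervals_comp (c z) (map (\<lambda>i. ds i z) [0..<length ms]) ! x =
      interval_comp (c z ! i) (ds i z ! j)"
    if "z \<in> S" for z
  proof -
    have "length (ds i z) = ms ! i" if "i < length ms" for i
      using ds[OF that] \<open>z \<in> S\<close> by (auto simp: interval_family_def length_ordered)
    then have "map length (map (\<lambda>i. ds i z) [0..<length ms]) = ms" by (auto intro!: nth_equalityI)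
    moreover have "length (c z) = length ms" using c that
        by (auto simp: interval_family_def length_ordered)
    ultimately show ?thesis
      using intervals_comp_nth[of "c z" "map (\<lambda>i. ds i z) [0..<length ms]" i j] ij
        \<open>\<And>i. i < length ms \<Longrightarrow> length (ds i z) = ms ! i\<close> by simp
  qed
  have "continuous_on S (\<lambda>z. interval_comp (c z ! i) (ds i z ! j))"
  proof -
    have "continuous_on S (\<lambda>z. c z ! i)" "continuous_on S (\<lambda>z. ds i z ! j)"
      using c ds[OF ij(1)] ij by (auto simp: interval_family_def)
    then show ?thesis
      by (simp add: interval_comp_def case_prod_beta) (intro continuous_intros)
  qed
  then show "continuous_on S (\<lambda>z. intervals_comp (c z) (map (\<lambda>i. ds i z) [0..<length ms]) ! x)"
    by (simp add: eq cong: continuous_on_cong)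
qed

lemma ordered_subset_little_intervals: "ordered_intervals k \<subseteq> little_intervals_set k"
proof
  fix c assume c: "c \<in> ordered_intervals k"
  have "{fst (c ! i)<..<snd (c ! i)} \<inter> {fst (c ! j)<..<snd (c ! j)} = {}"
      if "i < k" "j < k" "i \<noteq> j" for i j
  proof -
    have "snd (c ! i) \<le> fst (c ! j) \<or> snd (c ! j) \<le> fst (c ! i)"
      using c that by (cases i j rule: linorder_cases) (auto simp: ordered_intervals_def)
    then show ?thesis by auto
  qed
  then show "c \<in> little_intervals_set k"
    using c unfolding little_intervals_set_def case_prod_beta all_set_conv_all_nth
    by (simp add: ordered_intervals_def)
qed

lemma continuous_map_little_intervals_space:
  assumes "interval_family k S u"
  shows "continuous_map (top_of_set S) (little_intervals_space k) u"
  unfolding little_intervals_space_def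
proof (rule continuous_map_pullback')
  show "topspace (top_of_set S) \<subseteq> u -` little_intervals_set k"
    using assms ordered_subset_little_intervals by (auto simp: interval_family_def)
  show "continuous_map (top_of_set S) (product_topology (\<lambda>_. euclidean) {..<k})
      ((\<lambda>c. \<lambda>i\<in>{..<k}. c ! i) \<circ> u)"
    using assms by (auto simp: continuous_map_componentwise interval_family_def o_def cong:
        restrict_cong)
qed

text \<open>
  The linear path from the standard tuple stays among the ordered tuples, which puts each of them into
  the path component of the standard one.
\<close>

lemma continuous_map_little_intervals0:
  assumes "interval_family k S u"
  shows "continuous_map (top_of_set S) (ospace little_intervals0 k) u"
proof -
  have "u z \<in> path_component_of_set (little_intervals_space k) (std_intervals k)" if "z \<in> S" for z
  proof -
    have uz: "u z \<in> ordered_intervals k" using assms that by (auto simp: interval_family_def)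
    then have "pathin (little_intervals_space k) (\<lambda>t. blend t (std_intervals k) (u z))"
      unfolding pathin_def
      by (intro continuous_map_little_intervals_space interval_family_blend interval_family_const
          std_ordered)
        (auto intro!: continuous_intros)
    then have "path_component_of (little_intervals_space k) (std_intervals k) (u z)"
      unfolding path_component_of_def using length_ordered[OF uz] by (auto simp: blend_0 blend_1)
    then show ?thesis by simp
  qed
  then show ?thesis
    using continuous_map_little_intervals_space[OF assms]
    by (auto simp: little_intervals0_def continuous_map_in_subtopology)
qed

lemma ordered_in_little_intervals0: "c \<in> ordered_intervals k \<Longrightarrow> c \<in> oset little_intervals0 k"
  using continuous_map_image_subset_topspace
      [OF continuous_map_little_intervals0[OF interval_family_const, of c k "{0::real}"]]
  by simp


section \<open>Ordered paths\<close>

lemma carrier_perm_group [simp]: "\<sigma> \<in> carrier (perm_group k) \<longleftrightarrow> \<sigma> permutes {..<k}"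
  by (simp add: perm_group_def)

lemma mult_perm_group: "\<sigma> \<otimes>\<^bsub>perm_group k\<^esub> \<tau> = \<tau> \<circ> \<sigma>"
  and one_perm_group: "\<one>\<^bsub>perm_group k\<^esub> = id"
  by (simp_all add: perm_group_def)

locale based_operad = covering_symmetric_operad C
  for C :: "('a, 'z) sym_operad_scheme" +
  fixes \<eta> :: "nat \<Rightarrow> (real \<times> real) list \<Rightarrow> 'a"
  assumes path_connected: "path_connected_space (ospace C k)"
    and eta_morphism: "operad_morphism little_intervals0 C \<eta>"
begin

lemma act_in: "\<sigma> permutes {..<k} \<Longrightarrow> x \<in> oset C k \<Longrightarrow> oact C k \<sigma> x \<in> oset C k"
  using continuous_map_image_subset_topspace[OF act_continuous[of \<sigma> k]] by auto

lemma act_id: "x \<in> oset C k \<Longrightarrow> oact C k id x = x"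
  using group_action.id_eq_one[OF act[of k]] by (metis one_perm_group restrict_apply')

lemma act_comp:
  assumes "\<sigma> permutes {..<k}" "\<tau> permutes {..<k}" "x \<in> oset C k"
  shows "oact C k (\<tau> \<circ> \<sigma>) x = oact C k \<sigma> (oact C k \<tau> x)"
  using group_action.composition_rule[OF act[of k], of x \<sigma> \<tau>] act_in[of \<tau> k x] assms
  by (simp add: mult_perm_group)

lemma act_inv:
  assumes "\<sigma> permutes {..<k}" "x \<in> oset C k"
  shows "oact C k (inv_into UNIV \<sigma>) (oact C k \<sigma> x) = x"
  using act_comp[OF permutes_inv[OF assms(1)] assms(1,2)] act_id[OF assms(2)]
  by (simp add: permutes_inv_o[OF assms(1)])

lemma act_free:
  assumes \<sigma>: "\<sigma> permutes {..<k}" and \<tau>: "\<tau> permutes {..<k}" and x: "x \<in> oset C k"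
    and eq: "oact C k \<sigma> x = oact C k \<tau> x"
  shows "\<sigma> = \<tau>"
proof -
  let ?\<rho> = "\<tau> \<circ> inv_into UNIV \<sigma>"
  have "oact C k ?\<rho> x = x"
    using act_comp[OF permutes_inv[OF \<sigma>] \<tau> x] act_inv[OF \<sigma> x] eq by simp
  moreover obtain U where U: "x \<in> U" "\<And>\<rho>. \<rho> permutes {..<k} \<Longrightarrow> \<rho> \<noteq> id \<Longrightarrow> oact C k \<rho> ` U \<inter> U = {}"
  proof -
    obtain U where U: "x \<in> U"
      "\<forall>\<sigma>\<in>carrier (perm_group k). \<sigma> \<noteq> \<one>\<^bsub>perm_group k\<^esub> \<longrightarrow> oact C k \<sigma> ` U \<inter> U = {}"
      using covering[OF x] by blast
    show thesis by (rule that[OF U(1)]) (use U(2) in \<open>simp add: one_perm_group\<close>)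
  qed
  ultimately have "oact C k ?\<rho> ` U \<inter> U \<noteq> {}"
    by (metis IntI empty_iff imageI)
  then have "?\<rho> = id"
    using U(2)[OF permutes_compose[OF permutes_inv[OF \<sigma>] \<tau>]] by blast
  then have "?\<rho> \<circ> \<sigma> = id \<circ> \<sigma>" by simp
  then show ?thesis
    by (simp add: o_assoc[symmetric] permutes_inv_o[OF \<sigma>])
qed

lemma act_path: "pathin (ospace C k) f \<Longrightarrow> \<sigma> permutes {..<k} \<Longrightarrow> pathin (ospace C k) (oact C k \<sigma> \<circ> f)"
  unfolding pathin_def using act_continuous[of \<sigma> k] by (auto intro: continuous_map_compose)

lemma eta_continuous: "interval_family k S u \<Longrightarrow>
  continuous_map (top_of_set S) (ospace C k) (\<lambda>z. \<eta> k (u z))"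
  using continuous_map_compose[OF continuous_map_little_intervals0, of k S u "ospace C k"
      "\<eta> k"] eta_morphism
  by (auto simp: operad_morphism_def o_def)

lemma eta_in: "u \<in> ordered_intervals k \<Longrightarrow> \<eta> k u \<in> oset C k"
  using continuous_map_image_subset_topspace[OF eta_continuous[OF interval_family_const[of u k
      "{0::real}"]]]
  by auto

lemma eta_unit: "\<eta> (Suc 0) (std_intervals (Suc 0)) = ounit C"
  using eta_morphism by (simp add: operad_morphism_def std_intervals_1 little_intervals0_def)

lemma eta_comp:
  assumes "c \<in> ordered_intervals (length ms)" "length ds = length ms"
    and "\<And>i. i < length ms \<Longrightarrow> ds ! i \<in> ordered_intervals (ms ! i)"
  shows "\<eta> (sum_list ms) (intervals_comp c ds) = ocomp C ms (\<eta> (length ms) c) (map2 \<eta> ms ds)"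
proof -
  have "list_all2 (\<lambda>m b. b \<in> oset little_intervals0 m) ms ds"
    using assms ordered_in_little_intervals0 by (auto simp: list_all2_conv_all_nth)
  then show ?thesis
    using eta_morphism ordered_in_little_intervals0[OF assms(1)]
    by (auto simp: operad_morphism_def ocomp_little_intervals0)
qed

text \<open>
  The composition of an operad is continuous for the k-ification of the product. A compact parameter
  space is a k-space, and for maps out of a k-space the ordinary product has the same continuous maps.
\<close>

lemma ocomp_continuous:
  fixes S :: "'b::topological_space set"
  assumes S: "compact S" and f: "continuous_map (top_of_set S) (ospace C (length ms)) f"
    and g: "\<And>i. i < length ms \<Longrightarrow> continuous_map (top_of_set S) (ospace C (ms ! i)) (g i)"
  shows "continuous_map (top_of_set S) (ospace C (sum_list ms))
    (\<lambda>z. ocomp C ms (f z) (map (\<lambda>i. g i z) [0..<length ms]))"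
proof -
  let ?P = "prod_topology (ospace C (length ms)) (product_topology (\<lambda>i. ospace C
      (ms ! i)) {..<length ms})"
  let ?h = "\<lambda>z. (f z, \<lambda>i\<in>{..<length ms}. g i z)"
  have "continuous_map (top_of_set S) ?P ?h"
    using f g by (auto simp: continuous_map_pairwise o_def continuous_map_componentwise cong:
        restrict_cong)
  moreover have "k_space (top_of_set S)"
    using S by (intro compact_imp_k_space) (simp add: compact_space_subtopology)
  ultimately have "continuous_map (top_of_set S) (kification ?P) ?h"
    by (simp add: continuous_map_into_kification)
  from continuous_map_compose[OF this comp_continuous]
  show ?thesis
    by (rule continuous_map_eq) (auto intro!: arg_cong[where f = "ocomp C ms _"])
qed

definition path_comp :: "nat list \<Rightarrow> (real \<Rightarrow> 'a) \<Rightarrow> (nat \<Rightarrow> real \<Rightarrow> 'a) \<Rightarrow> real \<Rightarrow> 'a" where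
  "path_comp ms f g = (\<lambda>t. ocomp C ms (f t) (map (\<lambda>i. g i t) [0..<length ms]))"

text \<open>
  Equivariance collects the permutations in front, and \<open>\<eta>\<close> turns the composite of the remaining
  points into the image of a composite of little intervals.
\<close>

lemma comp_act_eta:
  assumes \<sigma>: "\<sigma> permutes {..<length ms}" and len: "length \<tau>s = length ms" "length vs = length ms"
    and v: "v \<in> ordered_intervals (length ms)"
    and \<tau>: "\<And>i. i < length ms \<Longrightarrow> \<tau>s ! i permutes {..<ms ! i}"
    and vs: "\<And>i. i < length ms \<Longrightarrow> vs ! i \<in> ordered_intervals (ms ! i)"
  shows "ocomp C ms (oact C (length ms) \<sigma> (\<eta> (length ms) v))
      (map (\<lambda>i. oact C (ms ! i) (\<tau>s ! i) (\<eta> (ms ! i) (vs ! i))) [0..<length ms]) =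
    oact C (sum_list ms) (block_perm ms \<sigma> \<tau>s)
      (\<eta> (sum_list ms) (intervals_comp v (permute_inv \<sigma> vs)))"
proof -
  let ?bs = "map2 \<eta> ms vs"
  have bs: "list_all2 (\<lambda>m b. b \<in> oset C m) ms ?bs"
    using len vs by (auto simp: list_all2_conv_all_nth intro!: eta_in)
  have perm: "permute_inv \<sigma> ?bs = map2 \<eta> (permute_inv \<sigma> ms) (permute_inv \<sigma> vs)"
    using len \<sigma> permutes_inv_less[OF \<sigma>] by (auto intro!: nth_equalityI simp: permute_list_def)
  have "\<eta> (sum_list (permute_inv \<sigma> ms)) (intervals_comp v (permute_inv \<sigma> vs)) =
      ocomp C (permute_inv \<sigma> ms) (\<eta> (length (permute_inv \<sigma> ms)) v) (map2 \<eta> (permute_inv \<sigma> ms)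
          (permute_inv \<sigma> vs))"
    using v len vs permutes_inv_less[OF \<sigma>] by (intro eta_comp) (auto simp: permute_list_def)
  moreover have "map (\<lambda>i. oact C (ms ! i) (\<tau>s ! i) (?bs ! i)) [0..<length ms] =
      map (\<lambda>i. oact C (ms ! i) (\<tau>s ! i) (\<eta> (ms ! i) (vs ! i))) [0..<length ms]"
    using len by auto
  moreover have "ocomp C ms (oact C (length ms) \<sigma> (\<eta> (length ms) v))
      (map (\<lambda>i. oact C (ms ! i) (\<tau>s ! i) (?bs ! i)) [0..<length ms]) =
    oact C (sum_list ms) (block_perm ms \<sigma> \<tau>s)
      (ocomp C (permute_inv \<sigma> ms) (\<eta> (length ms) v) (permute_inv \<sigma> ?bs))"
    using \<sigma> \<tau> len eta_in[OF v] bs by (intro equivariant) (auto simp: list_all2_conv_all_nth)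
  ultimately show ?thesis
    by (simp only: perm sum_list_permute_inv[OF \<sigma>] length_permute_list)
qed

text \<open>
  Unlike the paths in \<open>rel_paths\<close>, whose ends are the basepoint and its translates, these are closed
  under pointwise composition (\<open>ordered_path_comp\<close>).
\<close>

definition ordered_path :: "nat \<Rightarrow> (real \<times> real) list \<Rightarrow> (nat \<Rightarrow> nat) \<Rightarrow> (real \<times> real) list \<Rightarrow> (real \<Rightarrow>
  'a) \<Rightarrow> bool" where
  "ordered_path k u \<sigma> v f \<longleftrightarrow> pathin (ospace C k) f \<and> \<sigma> permutes {..<k} \<and>
    u \<in> ordered_intervals k \<and> v \<in> ordered_intervals k \<and> f 0 = \<eta> k u \<and> f 1 = oact C k \<sigma> (\<eta> k v)"

text \<open>
  The composition \<open>rel_comp\<close> is the class of a straightened pointwise composite; see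
  \<open>rel_comp_class\<close>.
\<close>

definition straighten :: "nat \<Rightarrow> (real \<times> real) list \<Rightarrow> (nat \<Rightarrow> nat) \<Rightarrow> (real \<times> real) list \<Rightarrow> (real \<Rightarrow> 'a) \<Rightarrow>
  real \<Rightarrow> 'a" where
  "straighten k u \<sigma> v f = path_join (path_join (linear_path \<eta> k (std_intervals k) u) f)
    (oact C k \<sigma> \<circ> path_rev (linear_path \<eta> k (std_intervals k) v))"

text \<open>
  A homotopy of ordered paths whose ends may move, but only along the images of paths \<open>\<alpha>\<close> and
  \<open>\<beta>\<close> of ordered tuples and with a fixed permutation. The tuples at the four
  corners are arguments, since \<open>\<eta>\<close> need not be injective and the paths do not determine them.
\<close>

definition ordered_homotopy ::
  "nat \<Rightarrow> (nat \<Rightarrow> nat) \<Rightarrow> (real \<times> real) list \<Rightarrow> (real \<times> real) list \<Rightarrow> (real \<Rightarrow> 'a) \<Rightarrow>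
    (real \<times> real) list \<Rightarrow> (real \<times> real) list \<Rightarrow> (real \<Rightarrow> 'a) \<Rightarrow> bool" where
  "ordered_homotopy k \<sigma> u v f u' v' f' \<longleftrightarrow> \<sigma> permutes {..<k} \<and>
    (\<exists>(H :: real \<Rightarrow> real \<Rightarrow> 'a) \<alpha> \<beta>.
      continuous_map unit_square (ospace C k) (\<lambda>z. H (fst z) (snd z)) \<and>
      interval_family k {0..1} \<alpha> \<and> interval_family k {0..1} \<beta> \<and>
      (\<forall>t\<in>{0..1}. H 0 t = f t \<and> H 1 t = f' t) \<and>
      (\<forall>s\<in>{0..1}. H s 0 = \<eta> k (\<alpha> s) \<and> H s 1 = oact C k \<sigma> (\<eta> k (\<beta> s))) \<and>
      \<alpha> 0 = u \<and> \<alpha> 1 = u' \<and> \<beta> 0 = v \<and> \<beta> 1 = v')"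

lemma ordered_homotopyI:
  fixes H :: "real \<Rightarrow> real \<Rightarrow> 'a"
  assumes "\<sigma> permutes {..<k}"
    and "continuous_map unit_square (ospace C k) (\<lambda>z. H (fst z) (snd z))"
    and "interval_family k {0..1} \<alpha>" "interval_family k {0..1} \<beta>"
    and "\<And>t. t \<in> {0..1} \<Longrightarrow> H 0 t = f t" "\<And>t. t \<in> {0..1} \<Longrightarrow> H 1 t = f' t"
    and "\<And>s. s \<in> {0..1} \<Longrightarrow> H s 0 = \<eta> k (\<alpha> s)"
    and "\<And>s. s \<in> {0..1} \<Longrightarrow> H s 1 = oact C k \<sigma> (\<eta> k (\<beta> s))"
    and "\<alpha> 0 = u" "\<alpha> 1 = u'" "\<beta> 0 = v" "\<beta> 1 = v'"
  shows "ordered_homotopy k \<sigma> u v f u' v' f'"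
  unfolding ordered_homotopy_def
  by (rule conjI, fact, rule exI[of _ H], rule exI[of _ \<alpha>], rule exI[of _ \<beta>]) (use assms in simp)

lemma pathin_linear_path:
  assumes "u \<in> ordered_intervals k" "v \<in> ordered_intervals k"
  shows "pathin (ospace C k) (linear_path \<eta> k u v)"
  unfolding pathin_def linear_path_blend[abs_def]
  by (intro eta_continuous interval_family_blend interval_family_const assms)
    (auto intro!: continuous_intros)

lemma linear_path_ends:
  assumes "u \<in> ordered_intervals k" "v \<in> ordered_intervals k"
  shows "linear_path \<eta> k u v 0 = \<eta> k u" "linear_path \<eta> k u v 1 = \<eta> k v"
  using assms by (simp_all add: linear_path_blend blend_0 blend_1 length_ordered)

lemma straighten_ordered:
  assumes f: "ordered_path k u \<sigma> v f"
  shows "ordered_path k (std_intervals k) \<sigma> (std_intervals k) (straighten k u \<sigma> v f)"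
  using f std_ordered[of k] unfolding ordered_path_def straighten_def
  by (auto intro!: pathin_path_join act_path pathin_path_rev pathin_linear_path simp: linear_path_ends)

lemma ordered_homotopy_ends:
  assumes "ordered_homotopy k \<sigma> u v f u' v' f'"
  shows "ordered_path k u \<sigma> v f" "ordered_path k u' \<sigma> v' f'"
proof -
  obtain H :: "real \<Rightarrow> real \<Rightarrow> 'a" and \<alpha> \<beta> where H:
      "continuous_map unit_square (ospace C k) (\<lambda>z. H (fst z) (snd z))"
    and ab: "interval_family k {0..1} \<alpha>" "interval_family k {0..1} \<beta>"
    and eq: "\<forall>t\<in>{0..1}. H 0 t = f t \<and> H 1 t = f' t"
      "\<forall>s\<in>{0..1}. H s 0 = \<eta> k (\<alpha> s) \<and> H s 1 = oact C k \<sigma> (\<eta> k (\<beta> s))"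
      "\<alpha> 0 = u" "\<alpha> 1 = u'" "\<beta> 0 = v" "\<beta> 1 = v'"
    and \<sigma>: "\<sigma> permutes {..<k}"
    using assms unfolding ordered_homotopy_def by blast
  have mem: "u \<in> ordered_intervals k" "v \<in> ordered_intervals k" "u' \<in> ordered_intervals k"
      "v' \<in> ordered_intervals k"
    using ab eq(3-6) by (auto simp: interval_family_def)
  have "pathin (ospace C k) f"
    using pathin_slice[OF H, of 0] eq(1) by (auto elim: pathin_eq)
  moreover have "pathin (ospace C k) f'"
    using pathin_slice[OF H, of 1] eq(1) by (auto elim: pathin_eq)
  moreover have "f 0 = \<eta> k u" "f 1 = oact C k \<sigma> (\<eta> k v)" "f' 0 = \<eta> k u'" "f' 1 = oact C k \<sigma> (\<eta> k v')"
    using bspec[OF eq(1), of 0] bspec[OF eq(1), of 1] bspec[OF eq(2), of 0] bspec[OF eq(2), of 1] eq(3-6)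
    by auto
  ultimately show "ordered_path k u \<sigma> v f" "ordered_path k u' \<sigma> v' f'"
    using mem \<sigma> by (auto simp: ordered_path_def)
qed

lemma ordered_homotopy_of_path_homotopic:
  assumes f: "ordered_path k u \<sigma> v f" and hom: "path_homotopic (ospace C k) f f'"
  shows "ordered_homotopy k \<sigma> u v f u v f'"
proof -
  obtain H :: "real \<Rightarrow> real \<Rightarrow> 'a" where H: "continuous_map unit_square (ospace C k) (\<lambda>z. H (fst z)
      (snd z))"
    "\<And>t. t \<in> {0..1} \<Longrightarrow> H 0 t = f t" "\<And>t. t \<in> {0..1} \<Longrightarrow> H 1 t = f' t"
    "\<And>s. s \<in> {0..1} \<Longrightarrow> H s 0 = f 0" "\<And>s. s \<in> {0..1} \<Longrightarrow> H s 1 = f 1"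
    using path_homotopicE[OF hom] by blast
  show ?thesis
    by (rule ordered_homotopyI[where H = H and \<alpha> = "\<lambda>_. u" and \<beta> = "\<lambda>_. v"])
      (use f H in \<open>auto simp: ordered_path_def intro: interval_family_const\<close>)
qed

text \<open>
  Although the ends of an ordered homotopy move, those of the straightened paths do not: at time
  \<open>s\<close> the tails run to the basepoint from where the ends are at that time.
\<close>

lemma path_homotopic_straighten:
  assumes "ordered_homotopy k \<sigma> u v f u' v' f'"
  shows "path_homotopic (ospace C k) (straighten k u \<sigma> v f) (straighten k u' \<sigma> v' f')"
proof -
  obtain H :: "real \<Rightarrow> real \<Rightarrow> 'a" and \<alpha> \<beta> where H:
      "continuous_map unit_square (ospace C k) (\<lambda>z. H (fst z) (snd z))"
    and ab: "interval_family k {0..1} \<alpha>" "interval_family k {0..1} \<beta>"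
    and eq: "\<forall>t\<in>{0..1}. H 0 t = f t \<and> H 1 t = f' t"
      "\<forall>s\<in>{0..1}. H s 0 = \<eta> k (\<alpha> s) \<and> H s 1 = oact C k \<sigma> (\<eta> k (\<beta> s))"
      "\<alpha> 0 = u" "\<alpha> 1 = u'" "\<beta> 0 = v" "\<beta> 1 = v'"
    and \<sigma>: "\<sigma> permutes {..<k}"
    using assms unfolding ordered_homotopy_def by blast
  have ordered: "\<alpha> s \<in> ordered_intervals k" "\<beta> s \<in> ordered_intervals k" if "s \<in> {0..1}" for s
    using ab that by (auto simp: interval_family_def)
  let ?a = "\<lambda>s. linear_path \<eta> k (std_intervals k) (\<alpha> s)"
  let ?b = "\<lambda>s. oact C k \<sigma> \<circ> path_rev (linear_path \<eta> k (std_intervals k) (\<beta> s))"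
  have a: "continuous_map unit_square (ospace C k) (\<lambda>z. ?a (fst z) (snd z))"
    unfolding linear_path_blend
    by (intro eta_continuous interval_family_blend interval_family_const std_ordered
        interval_family_compose[OF ab(1)]) (auto intro!: continuous_intros)
  have "continuous_map unit_square (ospace C k)
      (\<lambda>z. \<eta> k (blend (1 - snd z) (std_intervals k) (\<beta> (fst z))))"
    by (intro eta_continuous interval_family_blend interval_family_const std_ordered
        interval_family_compose[OF ab(2)]) (auto intro!: continuous_intros)
  then have b: "continuous_map unit_square (ospace C k) (\<lambda>z. ?b (fst z) (snd z))"
    using continuous_map_compose[OF _ act_continuous[of \<sigma> k]] \<sigma>
    by (simp add: o_def path_rev_def linear_path_blend)
  have aH: "?a s 1 = H s 0" and Hb: "H s 1 = ?b s 0" if "s \<in> {0..1}" for s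
    using that eq(2) ordered[OF that] std_ordered by (auto simp: linear_path_ends)
  have st: "straighten k u \<sigma> v f = path_join (path_join (?a 0) f) (?b 0)"
    "straighten k u' \<sigma> v' f' = path_join (path_join (?a 1) f') (?b 1)"
    using eq(3-6) by (simp_all add: straighten_def)
  show ?thesis
    unfolding st
  proof (rule path_homotopicI[where H = "\<lambda>s. path_join (path_join (?a s) (H s)) (?b s)"])
    show "continuous_map unit_square (ospace C k)
        (\<lambda>z. path_join (path_join (?a (fst z)) (H (fst z))) (?b (fst z)) (snd z))"
      by (rule continuous_map_path_join[OF continuous_map_path_join[OF a H] b])
        (use aH Hb in auto)
  qed (use eq(1) ordered std_ordered in \<open>auto intro!: path_join_eq simp: linear_path_ends\<close>)
qed

text \<open>
  The linear tails grow out of the ends of \<open>f\<close>.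
\<close>

lemma ordered_homotopy_straighten:
  assumes f: "ordered_path k u \<sigma> v f"
  shows "ordered_homotopy k \<sigma> u v f (std_intervals k) (std_intervals k) (straighten k u \<sigma> v f)"
proof -
  let ?a = "linear_path \<eta> k (std_intervals k) u"
  let ?b = "oact C k \<sigma> \<circ> path_rev (linear_path \<eta> k (std_intervals k) v)"
  have \<sigma>: "\<sigma> permutes {..<k}" and u: "u \<in> ordered_intervals k" and v: "v \<in> ordered_intervals k"
    and fp: "pathin (ospace C k) f" "f 0 = \<eta> k u" "f 1 = oact C k \<sigma> (\<eta> k v)"
    using f by (auto simp: ordered_path_def)
  have a: "pathin (ospace C k) ?a" and b: "pathin (ospace C k) ?b"
    using u v \<sigma> by (auto intro!: act_path pathin_path_rev pathin_linear_path std_ordered)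
  have ends: "?a 1 = f 0" "f 1 = ?b 0"
    using fp u v std_ordered by (auto simp: linear_path_ends)
  let ?F = "path_chain3 ?a f ?b"
  \<comment> \<open>At time \<open>s\<close> the path runs through a part of the chain that grows from \<open>f\<close> to the whole chain.\<close>
  let ?\<phi> = "\<lambda>s t. (1 - s) * (t + 1) + s * min (4 * t) (2 * t + 1)"
  have range: "?\<phi> s t \<in> {0..3}" if "s \<in> {0..1}" "t \<in> {0..1}" for s t :: real
    using convexD_alt[OF convex_real_interval(5), of "t + 1" 0 3 "min (4 * t) (2 * t + 1)" s] that
        by auto
  have H: "continuous_map unit_square (ospace C k) (\<lambda>z. ?F (?\<phi> (fst z) (snd z)))"
    by (rule continuous_map_compose_on[OF continuous_map_path_chain3[OF a fp(1) b ends]])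
      (use range in \<open>auto intro!: continuous_intros\<close>)
  show ?thesis
  proof (rule ordered_homotopyI[where H = "\<lambda>s t. ?F (?\<phi> s t)",
        where \<alpha> = "\<lambda>s. blend (1 - s) (std_intervals k) u" and \<beta> =
            "\<lambda>s. blend (1 - s) (std_intervals k) v", OF \<sigma> H])
    show "interval_family k {0..1} (\<lambda>s. blend (1 - s) (std_intervals k) u)"
      "interval_family k {0..1} (\<lambda>s. blend (1 - s) (std_intervals k) v)"
      by (auto intro!: interval_family_blend interval_family_const std_ordered u v continuous_intros)
    show "?F (?\<phi> 0 t) = f t" if "t \<in> {0..1}" for t
      using that ends by (auto simp: path_chain3_def)
    show "?F (?\<phi> 1 t) = straighten k u \<sigma> v f t" for t
      using path_join_left_chain3[of ?a f ?b t, OF ends] by (simp add: straighten_def)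
    show "?F (?\<phi> s 0) = \<eta> k (blend (1 - s) (std_intervals k) u)" if "s \<in> {0..1}" for s
      using that by (simp add: path_chain3_def linear_path_blend)
    show "?F (?\<phi> s 1) = oact C k \<sigma> (\<eta> k (blend (1 - s) (std_intervals k) v))" if "s \<in> {0..1}" for s
    proof (cases "s = 0")
      case True
      then show ?thesis using fp(3) v by (simp add: path_chain3_def blend_1 length_ordered)
    next
      case False
      then show ?thesis using that by (simp add: path_chain3_def linear_path_blend path_rev_def)
    qed
  qed (use u v in \<open>simp_all add: blend_0 blend_1 length_ordered\<close>)
qed

lemma path_homotopic_straighten_strict:
  assumes f: "ordered_path k (std_intervals k) \<sigma> (std_intervals k) f"
  shows "path_homotopic (ospace C k) (straighten k (std_intervals k) \<sigma> (std_intervals k) f) f"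
proof -
  have fp: "pathin (ospace C k) f" and \<sigma>: "\<sigma> permutes {..<k}" using f by (auto simp: ordered_path_def)
  have c: "linear_path \<eta> k (std_intervals k) (std_intervals k) = (\<lambda>_. f 0)"
    "oact C k \<sigma> \<circ> path_rev (\<lambda>_. f 0) = (\<lambda>_. f 1)"
    using f by (auto simp: ordered_path_def linear_path_blend blend_same path_rev_def)
  have c1: "pathin (ospace C k) (\<lambda>_. f 1)" using pathin_in[OF fp, of 1] by (simp add: pathin_def)
  have "path_homotopic (ospace C k) (path_join (path_join (\<lambda>_. f 0) f) (\<lambda>_. f 1)) (path_join f
      (\<lambda>_. f 1))"
    using path_homotopic_path_join[OF path_homotopic_const_join[OF fp refl] path_homotopic_refl[OF
        c1]] by simp
  also have "path_homotopic (ospace C k) \<dots> f" using path_homotopic_join_const[OF fp] by simp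
  finally show ?thesis unfolding straighten_def c .
qed

text \<open>
  Homotopies are composed pointwise. Their ends again move along images of ordered tuples, since these
  are closed under the composition of little intervals.
\<close>

lemma ordered_homotopy_comp:
  assumes f: "ordered_homotopy (length ms) \<sigma> u v f u' v' f'"
    and len: "length \<tau>s = length ms" "length us = length ms" "length vs = length ms"
      "length us' = length ms" "length vs' = length ms"
    and g: "\<And>i. i < length ms \<Longrightarrow>
      ordered_homotopy (ms ! i) (\<tau>s ! i) (us ! i) (vs ! i) (g i) (us' ! i) (vs' ! i) (g' i)"
  shows "ordered_homotopy (sum_list ms) (block_perm ms \<sigma> \<tau>s)
    (intervals_comp u us) (intervals_comp v (permute_inv \<sigma> vs)) (path_comp ms f g)
    (intervals_comp u' us') (intervals_comp v' (permute_inv \<sigma> vs')) (path_comp ms f' g')"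
proof -
  let ?k = "length ms"
  obtain H :: "real \<Rightarrow> real \<Rightarrow> 'a" and \<alpha> \<beta> where H:
      "continuous_map unit_square (ospace C ?k) (\<lambda>z. H (fst z) (snd z))"
    and ab: "interval_family ?k {0..1} \<alpha>" "interval_family ?k {0..1} \<beta>"
    and eq: "\<forall>t\<in>{0..1}. H 0 t = f t \<and> H 1 t = f' t"
      "\<forall>s\<in>{0..1}. H s 0 = \<eta> ?k (\<alpha> s) \<and> H s 1 = oact C ?k \<sigma> (\<eta> ?k (\<beta> s))"
      "\<alpha> 0 = u" "\<alpha> 1 = u'" "\<beta> 0 = v" "\<beta> 1 = v'"
    and \<sigma>: "\<sigma> permutes {..<?k}"
    using f unfolding ordered_homotopy_def by blast
  have "\<forall>i. \<exists>(H :: real \<Rightarrow> real \<Rightarrow> 'a) \<alpha> \<beta>. i < ?k \<longrightarrow>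
      continuous_map unit_square (ospace C (ms ! i)) (\<lambda>z. H (fst z) (snd z)) \<and>
      interval_family (ms ! i) {0..1} \<alpha> \<and> interval_family (ms ! i) {0..1} \<beta> \<and>
      (\<forall>t\<in>{0..1}. H 0 t = g i t \<and> H 1 t = g' i t) \<and>
      (\<forall>s\<in>{0..1}. H s 0 = \<eta> (ms ! i) (\<alpha> s) \<and> H s 1 = oact C (ms ! i) (\<tau>s ! i) (\<eta> (ms ! i) (\<beta> s))) \<and>
      \<alpha> 0 = us ! i \<and> \<alpha> 1 = us' ! i \<and> \<beta> 0 = vs ! i \<and> \<beta> 1 = vs' ! i"
    using g unfolding ordered_homotopy_def by blast
  then obtain K :: "nat \<Rightarrow> real \<Rightarrow> real \<Rightarrow> 'a" and A B where K: "\<forall>i. i < ?k \<longrightarrow>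
      continuous_map unit_square (ospace C (ms ! i)) (\<lambda>z. K i (fst z) (snd z)) \<and>
      interval_family (ms ! i) {0..1} (A i) \<and> interval_family (ms ! i) {0..1} (B i) \<and>
      (\<forall>t\<in>{0..1}. K i 0 t = g i t \<and> K i 1 t = g' i t) \<and>
      (\<forall>s\<in>{0..1}. K i s 0 = \<eta> (ms ! i) (A i s) \<and> K i s 1 =
          oact C (ms ! i) (\<tau>s ! i) (\<eta> (ms ! i) (B i s))) \<and>
      A i 0 = us ! i \<and> A i 1 = us' ! i \<and> B i 0 = vs ! i \<and> B i 1 = vs' ! i"
    unfolding choice_iff by (elim exE) (rule that)
  have \<tau>: "\<tau>s ! i permutes {..<ms ! i}" if "i < ?k" for i
    using g[OF that] by (simp add: ordered_homotopy_def)
  let ?A = "\<lambda>s. map (\<lambda>i. A i s) [0..<?k]" and ?B = "\<lambda>s. map (\<lambda>i. B i s) [0..<?k]"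
  have perm: "permute_inv \<sigma> (?B s) = map (\<lambda>i. B (inv_into UNIV \<sigma> i) s) [0..<?k]" for s
    using permutes_inv_less[OF \<sigma>] by (auto simp: permute_list_def)
  have lists: "?A 0 = us" "?A 1 = us'" "?B 0 = vs" "?B 1 = vs'"
    using K len by (auto intro!: nth_equalityI)
  have "interval_family (sum_list (permute_inv \<sigma> ms)) {0..1}
      (\<lambda>s. intervals_comp (\<beta> s) (map (\<lambda>i. B (inv_into UNIV \<sigma> i) s) [0..<length (permute_inv \<sigma> ms)]))"
    using ab K permutes_inv_less[OF \<sigma>] by (intro interval_family_comp) (auto simp: permute_list_def)
  then have famB: "interval_family (sum_list ms) {0..1} (\<lambda>s. intervals_comp (\<beta> s) (permute_inv \<sigma>
      (?B s)))"
    by (simp add: perm sum_list_permute_inv[OF \<sigma>])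
  show ?thesis
  proof (rule ordered_homotopyI[where H = "\<lambda>s. path_comp ms (H s) (\<lambda>i. K i s)",
        where \<alpha> = "\<lambda>s. intervals_comp (\<alpha> s) (?A s)" and \<beta> =
            "\<lambda>s. intervals_comp (\<beta> s) (permute_inv \<sigma> (?B s))"])
    show "block_perm ms \<sigma> \<tau>s permutes {..<sum_list ms}" using \<sigma> \<tau> by (rule block_perm_permutes)
    show "continuous_map unit_square (ospace C (sum_list ms))
        (\<lambda>z. path_comp ms (H (fst z)) (\<lambda>i. K i (fst z)) (snd z))"
      unfolding path_comp_def by (rule ocomp_continuous) (use H K in \<open>auto intro: compact_Times\<close>)
    show "interval_family (sum_list ms) {0..1} (\<lambda>s. intervals_comp (\<alpha> s) (?A s))"
      using ab K by (intro interval_family_comp) auto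
    show "path_comp ms (H 0) (\<lambda>i. K i 0) t = path_comp ms f g t" 
      "path_comp ms (H 1) (\<lambda>i. K i 1) t = path_comp ms f' g' t" if "t \<in> {0..1}" for t
      using that K eq(1) unfolding path_comp_def by (auto intro!: arg_cong2[where f = "ocomp C ms"])
    fix s :: real assume s: "s \<in> {0..1}"
    have ord: "\<alpha> s \<in> ordered_intervals ?k" "\<beta> s \<in> ordered_intervals ?k"
      using ab s by (auto simp: interval_family_def)
    have ords: "A i s \<in> ordered_intervals (ms ! i)" "B i s \<in> ordered_intervals (ms ! i)"
        if "i < ?k" for i
      using K that s by (auto simp: interval_family_def)
    have "path_comp ms (H s) (\<lambda>i. K i s) 0 = ocomp C ms (\<eta> ?k (\<alpha> s)) (map2 \<eta> ms (?A s))"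
      using K eq(2) s unfolding path_comp_def
      by (auto intro!: arg_cong2[where f = "ocomp C ms"] nth_equalityI)
    also have "\<dots> = \<eta> (sum_list ms) (intervals_comp (\<alpha> s) (?A s))"
      using ord ords by (intro eta_comp[symmetric]) auto
    finally show "path_comp ms (H s) (\<lambda>i. K i s) 0 = \<eta> (sum_list ms) (intervals_comp (\<alpha> s) (?A s))" .
    have "path_comp ms (H s) (\<lambda>i. K i s) 1 = ocomp C ms (oact C ?k \<sigma> (\<eta> ?k (\<beta> s)))
        (map (\<lambda>i. oact C (ms ! i) (\<tau>s ! i) (\<eta> (ms ! i) (?B s ! i))) [0..<?k])"
      using K eq(2) s unfolding path_comp_def by (auto intro!: arg_cong2[where f = "ocomp C ms"])
    also have "\<dots> = oact C (sum_list ms) (block_perm ms \<sigma> \<tau>s)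
        (\<eta> (sum_list ms) (intervals_comp (\<beta> s) (permute_inv \<sigma> (?B s))))"
      using ord ords \<sigma> \<tau> len by (intro comp_act_eta) auto
    finally show "path_comp ms (H s) (\<lambda>i. K i s) 1 = oact C (sum_list ms) (block_perm ms \<sigma> \<tau>s)
        (\<eta> (sum_list ms) (intervals_comp (\<beta> s) (permute_inv \<sigma> (?B s))))" .
  qed (use lists eq(3-6) famB in auto)
qed

lemma ordered_homotopy_refl: "ordered_path k u \<sigma> v f \<Longrightarrow> ordered_homotopy k \<sigma> u v f u v f"
  by (auto intro!: ordered_homotopy_of_path_homotopic path_homotopic_refl simp: ordered_path_def)

lemma ordered_path_comp:
  assumes f: "ordered_path (length ms) u \<sigma> v f"
    and len: "length \<tau>s = length ms" "length us = length ms" "length vs = length ms"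
    and g: "\<And>i. i < length ms \<Longrightarrow> ordered_path (ms ! i) (us ! i) (\<tau>s ! i) (vs ! i) (g i)"
  shows "ordered_path (sum_list ms) (intervals_comp u us) (block_perm ms \<sigma> \<tau>s)
    (intervals_comp v (permute_inv \<sigma> vs)) (path_comp ms f g)"
  by (rule ordered_homotopy_ends(1)
      [OF ordered_homotopy_comp[OF ordered_homotopy_refl[OF f] len len(2,3) ordered_homotopy_refl[OF
          g]]])

end


section \<open>Group operads as algebraic structures\<close>

text \<open>
  A group operad, freed from the topology of its underlying operad: on discrete spaces continuity of the
  composition amounts to \<open>closed\<close>.
\<close>

locale group_operad_laws =
  fixes G :: "nat \<Rightarrow> ('g, 'z) monoid_scheme"
    and comp :: "nat list \<Rightarrow> 'g \<Rightarrow> 'g list \<Rightarrow> 'g"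
    and proj :: "nat \<Rightarrow> 'g \<Rightarrow> nat \<Rightarrow> nat"
  assumes group: "group (G n)"
    and zero: "\<exists>p. carrier (G 0) = {p}"
    and closed: "\<lbrakk>a \<in> carrier (G (length ms)); list_all2 (\<lambda>m b. b \<in> carrier (G m)) ms bs\<rbrakk> \<Longrightarrow>
      comp ms a bs \<in> carrier (G (sum_list ms))"
    and assoc:
      "\<lbrakk>a \<in> carrier (G (length nss));
        list_all2 (\<lambda>ns b. b \<in> carrier (G (length ns))) nss bs;
        list_all2 (list_all2 (\<lambda>n c. c \<in> carrier (G n))) nss css\<rbrakk> \<Longrightarrow>
       comp (concat nss) (comp (map length nss) a bs) (concat css) =
       comp (map sum_list nss) a (map (\<lambda>i. comp (nss ! i) (bs ! i) (css ! i)) [0..<length nss])"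
    and comp_unit_left: "a \<in> carrier (G n) \<Longrightarrow> comp [n] \<one>\<^bsub>G 1\<^esub> [a] = a"
    and comp_unit_right: "a \<in> carrier (G n) \<Longrightarrow> comp (replicate n 1) a (replicate n \<one>\<^bsub>G 1\<^esub>) = a"
    and hom: "proj n \<in> hom (G n) (perm_group n)"
    and proj_comp: "\<lbrakk>a \<in> carrier (G (length ms)); list_all2 (\<lambda>m b. b \<in> carrier (G m)) ms bs\<rbrakk> \<Longrightarrow>
      proj (sum_list ms) (comp ms a bs) = block_perm ms (proj (length ms) a) (map2 proj ms bs)"
    and interchange:
      "\<lbrakk>a \<in> carrier (G (length ms)); a' \<in> carrier (G (length ms));
        list_all2 (\<lambda>m b. b \<in> carrier (G m)) ms bs;
        list_all2 (\<lambda>m b. b \<in> carrier (G m)) ms bs'\<rbrakk> \<Longrightarrow>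
       comp ms (a \<otimes>\<^bsub>G (length ms)\<^esub> a')
         (map (\<lambda>i. bs ! i \<otimes>\<^bsub>G (ms ! i)\<^esub> bs' ! i) [0..<length ms]) =
       comp ms a bs \<otimes>\<^bsub>G (sum_list ms)\<^esub>
         comp (permute_inv (proj (length ms) a) ms) a' (permute_inv (proj (length ms) a) bs')"

lemma sum_list_concat_map: "sum_list (map sum_list nss) = sum_list (concat nss)"
  by (induction nss) simp_all

lemma product_discrete_topology:
  assumes "finite I"
  shows "product_topology (\<lambda>i. discrete_topology (B i)) I = discrete_topology (Pi\<^sub>E I B)"
proof (rule sym, subst discrete_topology_unique, intro conjI ballI)
  fix x assume x: "x \<in> Pi\<^sub>E I B"
  have "openin (product_topology (\<lambda>i. discrete_topology (B i)) I) (Pi\<^sub>E I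
      (\<lambda>i. if i \<in> I then {x i} else B i))"
    by (rule product_topology_basis) (use x assms in \<open>auto intro: finite_subset[of _ I]\<close>)
  also have "Pi\<^sub>E I (\<lambda>i. if i \<in> I then {x i} else B i) = Pi\<^sub>E I (\<lambda>i. {x i})"
    by (rule PiE_cong) auto
  also have "\<dots> = {x}" using x by (intro PiE_singleton) (auto simp: PiE_def)
  finally show "openin (product_topology (\<lambda>i. discrete_topology (B i)) I) {x}" .
qed simp

lemma group_perm_group: "group (perm_group n)"
proof (rule groupI)
  fix \<sigma> assume "\<sigma> \<in> carrier (perm_group n)"
  then have \<sigma>: "\<sigma> permutes {..<n}" by simp
  show "\<exists>\<tau>\<in>carrier (perm_group n). \<tau> \<otimes>\<^bsub>perm_group n\<^esub> \<sigma> = \<one>\<^bsub>perm_group n\<^esub>"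
    by (rule bexI[of _ "inv_into UNIV \<sigma>"])
      (use permutes_inv[OF \<sigma>] in \<open>simp_all add: mult_perm_group one_perm_group permutes_inv_o[OF \<sigma>]\<close>)
qed (auto simp: mult_perm_group one_perm_group o_assoc intro: permutes_compose permutes_id)

context group_operad_laws
begin

lemma discrete_operad:
  "topological_operad \<lparr>ospace = (\<lambda>n. discrete_topology (carrier (G n))), ocomp = comp, ounit = \<one>\<^bsub>G 1\<^esub>\<rparr>"
  (is "topological_operad ?D")
proof (rule topological_operad.intro)
  fix ms :: "nat list"
  let ?A = "carrier (G (length ms))" and ?B = "\<lambda>i. carrier (G (ms ! i))" and ?I = "{..<length ms}"
  have discrete: "prod_topology (discrete_topology ?A) (product_topology (\<lambda>i. discrete_topology
      (?B i)) ?I) =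
      discrete_topology (?A \<times> Pi\<^sub>E ?I ?B)"
    unfolding prod_topology_discrete_topology product_discrete_topology[OF finite_lessThan] ..
  have "comp ms a (map b [0..<length ms]) \<in> carrier (G (sum_list ms))"
      if "a \<in> ?A" "b \<in> Pi\<^sub>E ?I ?B" for a b
    by (rule closed[OF that(1)]) (use that(2) in \<open>auto simp: list_all2_conv_all_nth\<close>)
  then have "continuous_map (discrete_topology (?A \<times> Pi\<^sub>E ?I ?B)) (discrete_topology (carrier (G
      (sum_list ms))))
      (\<lambda>(a, b). comp ms a (map b [0..<length ms]))"
    by (simp add: Pi_iff)
  then show "continuous_map
      (kification (prod_topology (ospace ?D (length ms)) (product_topology (\<lambda>i. ospace ?D (ms ! i)) ?I)))
      (ospace ?D (sum_list ms)) (\<lambda>(a, b). ocomp ?D ms a (map b [0..<length ms]))"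
    by (simp add: discrete continuous_map_from_kification)
next
  fix a nss bs css
  assume "a \<in> oset ?D (length nss)" "list_all2 (\<lambda>ns b. b \<in> oset ?D (length ns)) nss bs"
    "list_all2 (list_all2 (\<lambda>n c. c \<in> oset ?D n)) nss css"
  then show "ocomp ?D (concat nss) (ocomp ?D (map length nss) a bs) (concat css) =
      ocomp ?D (map sum_list nss) a (map (\<lambda>i. ocomp ?D (nss ! i) (bs ! i) (css ! i)) [0..<length nss])"
    using assoc[of a nss bs css] by simp
next
  show "ocomp ?D (replicate n 1) a (replicate n (ounit ?D)) = a" if "a \<in> oset ?D n" for a n
    using comp_unit_right[of a n] that by simp
  show "ocomp ?D [n] (ounit ?D) [a] = a" if "a \<in> oset ?D n" for a n
    using comp_unit_left[of a n] that by simp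
  show "ounit ?D \<in> oset ?D 1" using monoid.one_closed[OF group.is_monoid[OF group[of 1]]] by simp
qed (use zero in \<open>simp_all add: k_space_discrete_topology Hausdorff_space_discrete_topology\<close>)

lemma group_operad: "group_operad G comp proj"
proof (rule group_operad.intro[OF discrete_operad])
  have "proj 1 \<one>\<^bsub>G 1\<^esub> = id"
    using hom_one[OF hom group group_perm_group] by (simp add: one_perm_group)
  moreover have "proj n \<in> carrier (G n) \<rightarrow> carrier (perm_group n)" for n
    using hom by (auto simp: hom_def)
  ultimately show "operad_morphism
      \<lparr>ospace = (\<lambda>n. discrete_topology (carrier (G n))), ocomp = comp, ounit = \<one>\<^bsub>G 1\<^esub>\<rparr> perm_operad proj"
    using proj_comp by (simp add: operad_morphism_def perm_operad_def)
qed (rule group hom interchange; assumption)+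

lemma transport:
  fixes G' :: "nat \<Rightarrow> ('h, 'y) monoid_scheme"
  assumes iso: "\<And>n. \<phi> n \<in> iso (G n) (G' n)" and group': "\<And>n. group (G' n)"
    and \<psi>: "\<And>n. \<psi> n = inv_into (carrier (G n)) (\<phi> n)"
    and comp': "\<And>ms x ys. comp' ms x ys = \<phi> (sum_list ms) (comp ms (\<psi> (length ms) x) (map2 \<psi> ms ys))"
    and proj': "\<And>n x. proj' n x = proj n (\<psi> n x)"
  shows "group_operad_laws G' comp' proj'"
proof -
  have bij: "bij_betw (\<phi> n) (carrier (G n)) (carrier (G' n))" and \<phi>_hom: "\<phi> n \<in> hom (G n) (G' n)" for n
    using iso[of n] by (auto simp: iso_def)
  have \<psi>\<phi>: "\<psi> n (\<phi> n x) = x" if "x \<in> carrier (G n)" for n x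
    using bij_betw_inv_into_left[OF bij that] by (simp add: \<psi>)
  have \<phi>\<psi>: "\<phi> n (\<psi> n x) = x" if "x \<in> carrier (G' n)" for n x
    using bij_betw_inv_into_right[OF bij that] by (simp add: \<psi>)
  have \<phi>_in: "\<phi> n x \<in> carrier (G' n)" if "x \<in> carrier (G n)" for n x
    using bij_betwE[OF bij] that by blast
  have \<psi>_hom: "\<psi> n \<in> hom (G' n) (G n)" for n
    using group.iso_set_sym[OF group iso[of n]] by (auto simp: \<psi> iso_def)
  have \<psi>_in: "\<psi> n x \<in> carrier (G n)" if "x \<in> carrier (G' n)" for n x
    using \<psi>_hom[of n] that by (auto simp: hom_def)
  have \<psi>_mult: "\<psi> n (x \<otimes>\<^bsub>G' n\<^esub> y) = \<psi> n x \<otimes>\<^bsub>G n\<^esub> \<psi> n y"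
      if "x \<in> carrier (G' n)" "y \<in> carrier (G' n)" for n x y
    using hom_mult[OF \<psi>_hom] that by blast
  have \<psi>_one: "\<psi> n \<one>\<^bsub>G' n\<^esub> = \<one>\<^bsub>G n\<^esub>" for n
    using hom_one[OF \<psi>_hom group' group] .
  have \<psi>_list: "list_all2 (\<lambda>m b. b \<in> carrier (G m)) ms (map2 \<psi> ms bs)"
    if "list_all2 (\<lambda>m b. b \<in> carrier (G' m)) ms bs" for ms bs
    using that \<psi>_in by (auto simp: list_all2_conv_all_nth)
  have comp'_in: "comp' ms a bs \<in> carrier (G' (sum_list ms))"
    and \<psi>_comp': "\<psi> (sum_list ms) (comp' ms a bs) = comp ms (\<psi> (length ms) a) (map2 \<psi> ms bs)"
    if "a \<in> carrier (G' (length ms))" "list_all2 (\<lambda>m b. b \<in> carrier (G' m)) ms bs" for ms a bs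
    using closed[OF \<psi>_in[OF that(1)] \<psi>_list[OF that(2)]] by (simp_all add: comp' \<phi>_in \<psi>\<phi>)
  show ?thesis
  proof (rule group_operad_laws.intro)
    show "\<exists>p. carrier (G' 0) = {p}"
      using zero bij_betw_imp_surj_on[OF bij[of 0]] by (metis image_empty image_insert)
  next
    fix a nss bs css
    assume a: "a \<in> carrier (G' (length nss))"
      and bs: "list_all2 (\<lambda>ns b. b \<in> carrier (G' (length ns))) nss bs"
      and css: "list_all2 (list_all2 (\<lambda>n c. c \<in> carrier (G' n))) nss css"
    let ?bs = "map2 \<psi> (map length nss) bs" and ?css = "map2 (map2 \<psi>) nss css"
    have lens: "length bs = length nss" "length css = length nss"
      using list_all2_lengthD[OF bs] list_all2_lengthD[OF css] by simp_all
    have bs': "list_all2 (\<lambda>m b. b \<in> carrier (G' m)) (map length nss) bs"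
      using bs by (simp add: list_all2_conv_all_nth)
    have inner: "\<psi> (sum_list (nss ! i)) (comp' (nss ! i) (bs ! i) (css ! i)) =
        comp (nss ! i) (?bs ! i) (?css ! i)"
      if "i < length nss" for i
      using \<psi>_comp'[of "bs ! i" "nss ! i" "css ! i"] bs css that lens
      by (simp add: list_all2_conv_all_nth)
    have "map2 \<psi> (concat nss) (concat css) = concat ?css"
      using css by (induction nss css rule: list_all2_induct) (auto simp: list_all2_lengthD)
    then have "comp' (concat nss) (comp' (map length nss) a bs) (concat css) =
        \<phi> (sum_list (concat nss)) (comp (concat nss) (comp (map length nss) (\<psi> (length nss) a) ?bs)
            (concat ?css))"
      using \<psi>_comp'[OF _ bs', of a] a by (simp add: comp'[of "concat nss"] length_concat)
    also have "comp (concat nss) (comp (map length nss) (\<psi> (length nss) a) ?bs) (concat ?css) =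
        comp (map sum_list nss) (\<psi> (length nss) a) (map (\<lambda>i. comp (nss ! i) (?bs ! i) (?css ! i))
            [0..<length nss])"
      using bs css lens \<psi>_in[OF a]
      by (intro assoc) (auto simp: list_all2_conv_all_nth \<psi>_in)
    also have "map (\<lambda>i. comp (nss ! i) (?bs ! i) (?css ! i)) [0..<length nss] =
        map2 \<psi> (map sum_list nss) (map (\<lambda>i. comp' (nss ! i) (bs ! i) (css ! i)) [0..<length nss])"
      using inner by (auto intro!: nth_equalityI)
    finally show "comp' (concat nss) (comp' (map length nss) a bs) (concat css) =
        comp' (map sum_list nss) a (map (\<lambda>i. comp' (nss ! i) (bs ! i) (css ! i)) [0..<length nss])"
      by (simp add: comp'[of "map sum_list nss"] sum_list_concat_map)
  next
    fix a n assume a: "a \<in> carrier (G' n)"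
    then show "comp' [n] \<one>\<^bsub>G' 1\<^esub> [a] = a"
      using comp_unit_left[OF \<psi>_in[OF a]] \<psi>_one[of 1] by (simp add: comp' \<phi>\<psi>)
    have units: "map2 \<psi> (replicate n 1) (replicate n \<one>\<^bsub>G' 1\<^esub>) = replicate n \<one>\<^bsub>G 1\<^esub>"
      using \<psi>_one[of 1] by (simp add: zip_replicate)
    have "comp' (replicate n 1) a (replicate n \<one>\<^bsub>G' 1\<^esub>) =
        \<phi> n (comp (replicate n 1) (\<psi> n a) (replicate n \<one>\<^bsub>G 1\<^esub>))"
      unfolding comp' units by (simp add: sum_list_replicate)
    then show "comp' (replicate n 1) a (replicate n \<one>\<^bsub>G' 1\<^esub>) = a"
      using comp_unit_right[OF \<psi>_in[OF a]] \<phi>\<psi>[OF a] by simp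
  next
    show "proj' n \<in> hom (G' n) (perm_group n)" for n
      using hom_compose[OF \<psi>_hom hom, of n] by (simp add: proj'[abs_def] o_def)
  next
    fix a ms bs
    assume a: "a \<in> carrier (G' (length ms))" and bs: "list_all2 (\<lambda>m b. b \<in> carrier (G' m)) ms bs"
    show "comp' ms a bs \<in> carrier (G' (sum_list ms))" using a bs by (rule comp'_in)
    have "map2 proj ms (map2 \<psi> ms bs) = map2 proj' ms bs"
      using list_all2_lengthD[OF bs] by (auto intro!: nth_equalityI simp: proj')
    then show "proj' (sum_list ms) (comp' ms a bs) =
        block_perm ms (proj' (length ms) a) (map2 proj' ms bs)"
      using proj_comp[OF \<psi>_in[OF a] \<psi>_list[OF bs]] \<psi>_comp'[OF a bs] by (simp add: proj')
  next
    fix a ms a' bs bs'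
    assume a: "a \<in> carrier (G' (length ms))" "a' \<in> carrier (G' (length ms))"
      and bs: "list_all2 (\<lambda>m b. b \<in> carrier (G' m)) ms bs" "list_all2 (\<lambda>m b. b \<in> carrier (G' m)) ms bs'"
    let ?\<sigma> = "proj' (length ms) a"
    have lens: "length bs = length ms" "length bs' = length ms"
      using list_all2_lengthD[OF bs(1)] list_all2_lengthD[OF bs(2)] by simp_all
    have mem: "bs ! i \<in> carrier (G' (ms ! i))" "bs' ! i \<in> carrier (G' (ms ! i))" if "i < length ms" for i
      using bs that by (auto simp: list_all2_conv_all_nth)
    have \<sigma>: "?\<sigma> permutes {..<length ms}"
      using hom[of "length ms"] \<psi>_in[OF a(1)] by (auto simp: hom_def proj')
    let ?c = "map (\<lambda>i. bs ! i \<otimes>\<^bsub>G' (ms ! i)\<^esub> bs' ! i) [0..<length ms]"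
    let ?c' = "map (\<lambda>i. map2 \<psi> ms bs ! i \<otimes>\<^bsub>G (ms ! i)\<^esub> map2 \<psi> ms bs' ! i) [0..<length ms]"
    let ?ms = "permute_inv ?\<sigma> ms" and ?bs' = "permute_inv ?\<sigma> bs'"
    have c: "map2 \<psi> ms ?c = ?c'"
      using lens mem by (auto intro!: nth_equalityI simp: \<psi>_mult)
    have p: "map2 \<psi> ?ms ?bs' = permute_inv ?\<sigma> (map2 \<psi> ms bs')"
      using lens permutes_inv_less[OF \<sigma>] by (auto intro!: nth_equalityI simp: permute_list_def)
    have pm: "list_all2 (\<lambda>m b. b \<in> carrier (G' m)) ?ms ?bs'"
      using lens mem permutes_inv_less[OF \<sigma>] by (auto simp: list_all2_conv_all_nth permute_list_def)
    have sum: "sum_list ?ms = sum_list ms" by (rule sum_list_permute_inv[OF \<sigma>])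
    let ?x = "comp ms (\<psi> (length ms) a) (map2 \<psi> ms bs)"
    let ?y = "comp ?ms (\<psi> (length ms) a') (permute_inv ?\<sigma> (map2 \<psi> ms bs'))"
    have xy: "?x \<in> carrier (G (sum_list ms))" "?y \<in> carrier (G (sum_list ms))"
      using closed[OF \<psi>_in[OF a(1)] \<psi>_list[OF bs(1)]] closed[of "\<psi> (length ms) a'" ?ms,
          OF _ \<psi>_list[OF pm]] \<psi>_in[OF a(2)]
      by (simp_all add: p sum)
    have "comp' ms (a \<otimes>\<^bsub>G' (length ms)\<^esub> a') ?c =
        \<phi> (sum_list ms) (comp ms (\<psi> (length ms) a \<otimes>\<^bsub>G (length ms)\<^esub> \<psi> (length ms) a') ?c')"
      by (simp only: comp' c \<psi>_mult[OF a])
    also have "comp ms (\<psi> (length ms) a \<otimes>\<^bsub>G (length ms)\<^esub> \<psi> (length ms) a') ?c' =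
        ?x \<otimes>\<^bsub>G (sum_list ms)\<^esub> ?y"
      using interchange[OF \<psi>_in[OF a(1)] \<psi>_in[OF a(2)] \<psi>_list[OF bs(1)] \<psi>_list[OF bs(2)]]
      by (simp only: proj')
    also have "\<phi> (sum_list ms) \<dots> = \<phi> (sum_list ms) ?x \<otimes>\<^bsub>G' (sum_list ms)\<^esub> \<phi> (sum_list ms) ?y"
      using hom_mult[OF \<phi>_hom] xy by blast
    also have "\<dots> = comp' ms a bs \<otimes>\<^bsub>G' (sum_list ms)\<^esub> comp' ?ms a' ?bs'"
      by (simp only: comp' p sum length_permute_list)
    finally show "comp' ms (a \<otimes>\<^bsub>G' (length ms)\<^esub> a') ?c =
        comp' ms a bs \<otimes>\<^bsub>G' (sum_list ms)\<^esub> comp' ?ms a' ?bs'" .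
  qed (rule group')
qed

end


section \<open>The group operad of homotopy classes\<close>

lemma listset_iff: "xs \<in> listset As \<longleftrightarrow> list_all2 (\<in>) xs As"
proof (induction As arbitrary: xs)
  case (Cons A As)
  then show ?case by (cases xs) (auto simp: set_Cons_def)
qed simp

lemma UN2_const:
  assumes "\<And>a b. a \<in> A \<Longrightarrow> b \<in> B \<Longrightarrow> F a b = c" "a0 \<in> A" "b0 \<in> B"
  shows "(\<Union>a\<in>A. \<Union>b\<in>B. F a b) = c"
  using assms by fast

lemma interval_comp_unit: "interval_comp (0, 1) x = x" "interval_comp x (0, 1) = x"
  by (auto simp: interval_comp_def split: prod.splits)

lemma intervals_comp_unit_left: "intervals_comp [(0, 1)] [c] = c"
  by (simp add: intervals_comp_def interval_comp_unit map_idI)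

lemma intervals_comp_unit_right: "intervals_comp c (replicate (length c) [(0, 1)]) = c"
  by (induction c) (simp_all add: interval_comp_unit)

context based_operad
begin

abbreviation based_path :: "nat \<Rightarrow> (nat \<Rightarrow> nat) \<Rightarrow> (real \<Rightarrow> 'a) \<Rightarrow> bool" where
  "based_path k \<sigma> f \<equiv> ordered_path k (std_intervals k) \<sigma> (std_intervals k) f"

definition straight_class :: "nat \<Rightarrow> (real \<times> real) list \<Rightarrow> (nat \<Rightarrow> nat) \<Rightarrow> (real \<times> real) list \<Rightarrow>
    (real \<Rightarrow> 'a) \<Rightarrow> (real \<Rightarrow> 'a) set" where
  "straight_class k u \<sigma> v f = path_class (ospace C k) (straighten k u \<sigma> v f)"

lemma ordered_pathD:
  assumes "ordered_path k u \<sigma> v f"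
  shows "pathin (ospace C k) f" "\<sigma> permutes {..<k}" "u \<in> ordered_intervals k" "v \<in> ordered_intervals k"
    "f 0 = \<eta> k u" "f 1 = oact C k \<sigma> (\<eta> k v)"
  using assms by (auto simp: ordered_path_def)

lemma rel_paths_iff: "f \<in> rel_paths C \<eta> k \<longleftrightarrow> (\<exists>\<sigma>. based_path k \<sigma> f)"
  by (auto simp: rel_paths_def ordered_path_def basept_def orbit_map_def orbit_def std_ordered)

lemma carrier_pi1_rel: "carrier (pi1_rel C \<eta> k) = path_class (ospace C k) ` rel_paths C \<eta> k"
  by (simp add: pi1_rel_def)

lemma class_in_carrier: "based_path k \<sigma> f \<Longrightarrow> path_class (ospace C k) f \<in> carrier (pi1_rel C \<eta> k)"
  using rel_paths_iff carrier_pi1_rel by blast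

lemma pi1_rel_cases:
  assumes "A \<in> carrier (pi1_rel C \<eta> k)"
  obtains \<sigma> f where "based_path k \<sigma> f" "A = path_class (ospace C k) f"
  using assms rel_paths_iff by (auto simp: carrier_pi1_rel)

lemma pi1_rel_list_cases:
  assumes "list_all2 (\<lambda>m b. b \<in> carrier (pi1_rel C \<eta> m)) ms bs"
  obtains \<tau>s gs where "length \<tau>s = length ms" "length gs = length ms"
    "\<And>i. i < length ms \<Longrightarrow> based_path (ms ! i) (\<tau>s ! i) (gs ! i)"
    "bs = map (\<lambda>i. path_class (ospace C (ms ! i)) (gs ! i)) [0..<length ms]"
proof -
  have "\<forall>i. \<exists>\<sigma> f. i < length ms \<longrightarrow> based_path (ms ! i) \<sigma> f \<and> bs ! i = path_class (ospace C (ms ! i)) f"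
  proof (intro allI)
    fix i
    show "\<exists>\<sigma> f. i < length ms \<longrightarrow> based_path (ms ! i) \<sigma> f \<and> bs ! i = path_class (ospace C (ms ! i)) f"
    proof (cases "i < length ms")
      case True
      then have "bs ! i \<in> carrier (pi1_rel C \<eta> (ms ! i))" using assms
          by (simp add: list_all2_conv_all_nth)
      then show ?thesis by (rule pi1_rel_cases) blast
    qed simp
  qed
  then obtain S F where SF: "\<forall>i. i < length ms \<longrightarrow> based_path (ms ! i) (S i) (F i) \<and>
      bs ! i = path_class (ospace C (ms ! i)) (F i)"
    unfolding choice_iff by (elim exE) (rule that)
  show thesis
    by (rule that[of "map S [0..<length ms]" "map F [0..<length ms]"])
      (use SF assms in \<open>auto simp: list_all2_lengthD intro!: nth_equalityI\<close>)
qed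

lemma rel_boundary_class:
  assumes f: "based_path k \<sigma> f"
  shows "rel_boundary C \<eta> k (path_class (ospace C k) f) = \<sigma>"
  unfolding rel_boundary_def
proof (rule the_equality)
  note f' = ordered_pathD[OF f]
  have "g 1 = oact C k \<sigma> (basept \<eta> k)" if "g \<in> path_class (ospace C k) f" for g
    using path_homotopic_endpoints[of "ospace C k" f g] that f'(6)
        by (simp add: mem_path_class basept_def)
  then show "\<sigma> \<in> carrier (perm_group k) \<and> (\<forall>g\<in>path_class (ospace C k) f. g 1 = oact C k \<sigma> (basept \<eta> k))"
    using f'(2) by simp
  fix \<tau> assume \<tau>: "\<tau> \<in> carrier (perm_group k) \<and> (\<forall>g\<in>path_class (ospace C k) f. g 1 =
      oact C k \<tau> (basept \<eta> k))"
  then have "f 1 = oact C k \<tau> (basept \<eta> k)" using path_class_self[OF f'(1)] by blast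
  then show "\<tau> = \<sigma>"
    using act_free[OF _ f'(2) eta_in[OF f'(4)], of \<tau>] f'(6) \<tau> by (simp add: basept_def)
qed

lemma straight_class_based: "based_path k \<sigma> f \<Longrightarrow>
  straight_class k (std_intervals k) \<sigma> (std_intervals k) f = path_class (ospace C k) f"
  unfolding straight_class_def by (intro path_class_eqI path_homotopic_straighten_strict)

lemma straight_class_homotopy: "ordered_homotopy k \<sigma> u v f u' v' f' \<Longrightarrow> straight_class k u \<sigma> v f =
  straight_class k u' \<sigma> v' f'"
  unfolding straight_class_def by (intro path_class_eqI path_homotopic_straighten)

lemma straight_class_in_carrier: "ordered_path k u \<sigma> v f \<Longrightarrow>
  straight_class k u \<sigma> v f \<in> carrier (pi1_rel C \<eta> k)"
  unfolding straight_class_def by (rule class_in_carrier[OF straighten_ordered])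

lemma rel_boundary_straight_class: "ordered_path k u \<sigma> v f \<Longrightarrow>
  rel_boundary C \<eta> k (straight_class k u \<sigma> v f) = \<sigma>"
  unfolding straight_class_def by (intro rel_boundary_class straighten_ordered)

text \<open>
  The permutations agree as soon as the ends of the paths do, because the action is free. All identities
  between block permutations that enter the laws are obtained in this way.
\<close>

lemma straight_class_eqI:
  assumes f: "ordered_path k u \<sigma> v f" and f': "ordered_path k u' \<sigma>' v' f'" and uv: "u = u'" "v = v'"
    and eq: "\<And>t. t \<in> {0..1} \<Longrightarrow> f t = f' t"
  shows "straight_class k u \<sigma> v f = straight_class k u' \<sigma>' v' f'"
proof -
  note F = ordered_pathD[OF f] and F' = ordered_pathD[OF f']
  have "\<sigma> = \<sigma>'"
    by (rule act_free[OF F(2) F'(2) eta_in[OF F(4)]]) (use F(6) F'(6) eq[of 1] uv in simp)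
  then show ?thesis
    using straight_class_homotopy[OF ordered_homotopy_of_path_homotopic[OF f path_homotopic_eq[OF F(1)
        eq]]] uv by simp
qed

lemma rel_comp_class:
  assumes f: "based_path (length ms) \<sigma> f" and len: "length \<tau>s = length ms"
    and g: "\<And>i. i < length ms \<Longrightarrow> based_path (ms ! i) (\<tau>s ! i) (g i)"
  shows "rel_comp C \<eta> ms (path_class (ospace C (length ms)) f)
      (map (\<lambda>i. path_class (ospace C (ms ! i)) (g i)) [0..<length ms]) =
    straight_class (sum_list ms) (intervals_comp (std_intervals (length ms)) (map std_intervals ms))
      (block_perm ms \<sigma> \<tau>s)
      (intervals_comp (std_intervals (length ms)) (permute_inv \<sigma> (map std_intervals ms))) (path_comp
          ms f g)"
proof -
  let ?k = "length ms"
  let ?Bs = "map (\<lambda>i. path_class (ospace C (ms ! i)) (g i)) [0..<?k]"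
  let ?B = "block_perm ms \<sigma> \<tau>s"
  let ?U = "intervals_comp (std_intervals ?k) (map std_intervals ms)"
  let ?V = "intervals_comp (std_intervals ?k) (permute_inv \<sigma> (map std_intervals ms))"
  have \<sigma>: "\<sigma> permutes {..<?k}" using f by (rule ordered_pathD)
  have \<tau>s: "map2 (rel_boundary C \<eta>) ms ?Bs = \<tau>s"
    using len g by (auto intro!: nth_equalityI simp: rel_boundary_class)
  have perm: "permute_inv \<sigma> (map std_intervals ms) = map std_intervals (permute_inv \<sigma> ms)"
    using permutes_inv[OF \<sigma>] by (rule permute_list_map)
  have \<delta>: "comp_linear_path \<eta> ms = linear_path \<eta> (sum_list ms) (std_intervals (sum_list ms)) ?U"
    "comp_linear_path \<eta> (permute_inv \<sigma> ms) = linear_path \<eta> (sum_list ms) (std_intervals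
        (sum_list ms)) ?V"
    by (simp_all add: comp_linear_path_def ocomp_little_intervals0 sum_list_permute_inv[OF \<sigma>] perm)
  have same: "path_class (ospace C (sum_list ms))
         (path_join
           (path_join (comp_linear_path \<eta> ms) (\<lambda>t. ocomp C ms (f' t) (map (\<lambda>g. g t) gs)))
           (oact C (sum_list ms) ?B \<circ> path_rev (comp_linear_path \<eta> (permute_inv \<sigma> ms)))) =
      straight_class (sum_list ms) ?U ?B ?V (path_comp ms f g)" (is "?L = _")
    if f': "f' \<in> path_class (ospace C ?k) f" and gs: "gs \<in> listset ?Bs" for f' gs
  proof -
    have lgs: "length gs = ?k" and gs': "\<And>i. i < ?k \<Longrightarrow> path_homotopic (ospace C (ms ! i)) (g i) (gs ! i)"
      using gs by (auto simp: listset_iff list_all2_conv_all_nth mem_path_class)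
    have "map (\<lambda>g. g t) gs = map (\<lambda>i. (gs ! i) t) [0..<?k]" for t
      using lgs by (auto intro!: nth_equalityI)
    then have "?L = straight_class (sum_list ms) ?U ?B ?V (path_comp ms f' ((!) gs))"
      by (simp add: straight_class_def straighten_def \<delta> path_comp_def)
    also have "ordered_homotopy (sum_list ms) ?B ?U ?V (path_comp ms f g) ?U ?V (path_comp ms f'
        ((!) gs))"
      by (rule ordered_homotopy_comp)
        (use f g f' gs' len in \<open>auto intro!: ordered_homotopy_of_path_homotopic simp: mem_path_class\<close>)
    from straight_class_homotopy[OF this]
    have "straight_class (sum_list ms) ?U ?B ?V (path_comp ms f' ((!) gs)) =
      straight_class (sum_list ms) ?U ?B ?V (path_comp ms f g)" by simp
    finally show ?thesis .
  qed
  have "f \<in> path_class (ospace C ?k) f"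
    using f by (auto intro: path_class_self ordered_pathD)
  moreover have "map g [0..<?k] \<in> listset ?Bs"
    using g by (auto simp: listset_iff list_all2_conv_all_nth intro: path_class_self ordered_pathD)
  ultimately show ?thesis
    unfolding rel_comp_def Let_def \<tau>s rel_boundary_class[OF f] using same by (intro UN2_const)
qed

text \<open>
  Each path is joined to its straightening by an ordered homotopy, so the composite of the straightened
  paths is joined by one to the composite of the original paths.
\<close>

lemma rel_comp_straight_class:
  assumes f: "ordered_path (length ms) u \<sigma> v f"
    and len: "length \<tau>s = length ms" "length us = length ms" "length vs = length ms"
    and g: "\<And>i. i < length ms \<Longrightarrow> ordered_path (ms ! i) (us ! i) (\<tau>s ! i) (vs ! i) (g i)"
  shows "rel_comp C \<eta> ms (straight_class (length ms) u \<sigma> v f)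
      (map (\<lambda>i. straight_class (ms ! i) (us ! i) (\<tau>s ! i) (vs ! i) (g i)) [0..<length ms]) =
    straight_class (sum_list ms) (intervals_comp u us) (block_perm ms \<sigma> \<tau>s)
      (intervals_comp v (permute_inv \<sigma> vs)) (path_comp ms f g)"
proof -
  let ?f = "straighten (length ms) u \<sigma> v f"
  let ?g = "\<lambda>i. straighten (ms ! i) (us ! i) (\<tau>s ! i) (vs ! i) (g i)"
  let ?s = "map std_intervals ms"
  have "rel_comp C \<eta> ms (straight_class (length ms) u \<sigma> v f)
      (map (\<lambda>i. straight_class (ms ! i) (us ! i) (\<tau>s ! i) (vs ! i) (g i)) [0..<length ms]) =
    straight_class (sum_list ms) (intervals_comp (std_intervals (length ms)) ?s) (block_perm ms \<sigma> \<tau>s)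
      (intervals_comp (std_intervals (length ms)) (permute_inv \<sigma> ?s)) (path_comp ms ?f ?g)"
    unfolding straight_class_def[of _ _ _ _ "g _"] straight_class_def[of _ _ _ _ f]
    by (rule rel_comp_class) (use f g len in \<open>auto intro: straighten_ordered\<close>)
  also have "\<dots> = straight_class (sum_list ms) (intervals_comp u us) (block_perm ms \<sigma> \<tau>s)
      (intervals_comp v (permute_inv \<sigma> vs)) (path_comp ms f g)"
    by (rule straight_class_homotopy[symmetric], rule ordered_homotopy_comp)
      (use f g len in \<open>auto intro!: ordered_homotopy_straighten\<close>)
  finally show ?thesis .
qed

lemma pi1_rel_mult_class:
  assumes f: "based_path k \<sigma> f" and g: "based_path k \<tau> g"
  shows "path_class (ospace C k) f \<otimes>\<^bsub>pi1_rel C \<eta> k\<^esub> path_class (ospace C k) g =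
    path_class (ospace C k) (path_join f (oact C k \<sigma> \<circ> g))"
proof -
  note F = ordered_pathD[OF f] and G = ordered_pathD[OF g]
  have same: "path_class (ospace C k) (path_join f' (oact C k \<sigma> \<circ> g')) =
      path_class (ospace C k) (path_join f (oact C k \<sigma> \<circ> g))"
    if "f' \<in> path_class (ospace C k) f" "g' \<in> path_class (ospace C k) g" for f' g'
    by (rule path_class_eqI[symmetric], rule path_homotopic_path_join[OF _ path_homotopic_compose[OF
        act_continuous]])
      (use that F G in \<open>auto simp: mem_path_class\<close>)
  have "path_class (ospace C k) f \<otimes>\<^bsub>pi1_rel C \<eta> k\<^esub> path_class (ospace C k) g =
      (\<Union>f'\<in>path_class (ospace C k) f. \<Union>g'\<in>path_class (ospace C k) g.
        path_class (ospace C k) (path_join f' (oact C k \<sigma> \<circ> g')))"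
    by (simp add: pi1_rel_def rel_boundary_class[OF f])
  also have "\<dots> = path_class (ospace C k) (path_join f (oact C k \<sigma> \<circ> g))"
    using path_class_self[OF F(1)] path_class_self[OF G(1)] same by (intro UN2_const)
  finally show ?thesis .
qed

lemma ordered_path_join:
  assumes f: "ordered_path k u \<sigma> v f" and g: "ordered_path k v \<tau> w g"
  shows "ordered_path k u (\<tau> \<circ> \<sigma>) w (path_join f (oact C k \<sigma> \<circ> g))"
proof -
  note F = ordered_pathD[OF f] and G = ordered_pathD[OF g]
  show ?thesis
    unfolding ordered_path_def
    using F G act_comp[OF F(2) G(2) eta_in[OF G(4)]]
    by (auto intro!: pathin_path_join act_path permutes_compose)
qed

text \<open>
  The tail at the end of the first path cancels with the tail at the start of the second.
\<close>

lemma straight_class_mult: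
  assumes f: "ordered_path k u \<sigma> v f" and g: "ordered_path k v \<tau> w g"
  shows "straight_class k u \<sigma> v f \<otimes>\<^bsub>pi1_rel C \<eta> k\<^esub> straight_class k v \<tau> w g =
    straight_class k u (\<tau> \<circ> \<sigma>) w (path_join f (oact C k \<sigma> \<circ> g))"
proof -
  note F = ordered_pathD[OF f] and G = ordered_pathD[OF g]
  let ?l = "linear_path \<eta> k (std_intervals k)"
  let ?s = "oact C k \<sigma>"
  have l: "pathin (ospace C k) (?l x)" "?l x 0 = \<eta> k (std_intervals k)" "?l x 1 = \<eta> k x"
    if "x \<in> ordered_intervals k" for x
    using that by (auto intro: pathin_linear_path linear_path_ends std_ordered)
  let ?c = "?s \<circ> (oact C k \<tau> \<circ> path_rev (?l w))"
  have c: "?c t = (oact C k (\<tau> \<circ> \<sigma>) \<circ> path_rev (?l w)) t" if "t \<in> {0..1}" for t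
    using act_comp[OF F(2) G(2) pathin_in[OF pathin_path_rev[OF l(1)[OF G(4)]] that]] by simp
  have cp: "pathin (ospace C k) ?c"
    using F(2) G(2) l(1)[OF G(4)] by (intro act_path pathin_path_rev)
  have join: "ordered_path k u (\<tau> \<circ> \<sigma>) w (path_join f (?s \<circ> g))"
    using f g by (rule ordered_path_join)
  have rev: "?s \<circ> path_rev (?l v) = path_rev (?s \<circ> ?l v)" by (simp add: path_rev_def o_def)
  have "straight_class k u \<sigma> v f \<otimes>\<^bsub>pi1_rel C \<eta> k\<^esub> straight_class k v \<tau> w g =
      path_class (ospace C k) (path_join (straighten k u \<sigma> v f) (?s \<circ> straighten k v \<tau> w g))"
    unfolding straight_class_def by (rule pi1_rel_mult_class[OF straighten_ordered[OF f]
        straighten_ordered[OF g]])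
  also have "\<dots> = path_class (ospace C k) (path_join (path_join (?l u) (path_join f (?s \<circ> g))) ?c)"
    unfolding straighten_def compose_path_join rev
    by (rule path_class_eqI, rule path_homotopic_cancel)
      (use F G l cp in \<open>auto intro!: act_path simp: path_rev_def\<close>)
  also have "\<dots> = path_class (ospace C k) (straighten k u (\<tau> \<circ> \<sigma>) w (path_join f (?s \<circ> g)))"
    unfolding straighten_def
  proof (rule path_class_eqI, rule path_homotopic_eq)
    show "pathin (ospace C k) (path_join (path_join (?l u) (path_join f (?s \<circ> g))) ?c)"
      using F G l cp by (auto intro!: pathin_path_join act_path simp: path_rev_def)
  qed (use c in \<open>auto intro!: path_join_eq\<close>)
  finally show ?thesis by (simp add: straight_class_def)
qed

lemma based_path_const: "based_path k id (\<lambda>_. basept \<eta> k)"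
  using eta_in[OF std_ordered] act_id[OF eta_in[OF std_ordered]]
  by (auto simp: ordered_path_def basept_def std_ordered pathin_def permutes_id)

lemma one_pi1_rel: "\<one>\<^bsub>pi1_rel C \<eta> k\<^esub> = path_class (ospace C k) (\<lambda>_. basept \<eta> k)"
  by (simp add: pi1_rel_def)

lemma group_pi1_rel: "group (pi1_rel C \<eta> k)"
proof (rule groupI)
  let ?G = "pi1_rel C \<eta> k" and ?X = "ospace C k"
  fix A assume "A \<in> carrier ?G"
  then obtain \<sigma> f where f: "based_path k \<sigma> f" "A = path_class ?X f" by (rule pi1_rel_cases)
  note F = ordered_pathD[OF f(1)]
  show "\<one>\<^bsub>?G\<^esub> \<otimes>\<^bsub>?G\<^esub> A = A"
  proof -
    have "path_class ?X (path_join (\<lambda>_. basept \<eta> k) (oact C k id \<circ> f)) = path_class ?X (oact C k id \<circ> f)"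
      using F act_path[OF F(1) permutes_id] act_id[OF eta_in[OF std_ordered]]
      by (intro path_class_eqI path_homotopic_const_join) (auto simp: basept_def)
    also have "\<dots> = path_class ?X f"
      using F(1) act_id[OF pathin_in[OF F(1)]]
          by (intro path_class_eqI[symmetric] path_homotopic_eq) auto
    finally show ?thesis
      by (simp add: one_pi1_rel f(2) pi1_rel_mult_class[OF based_path_const f(1)])
  qed
  show "\<exists>B\<in>carrier ?G. B \<otimes>\<^bsub>?G\<^esub> A = \<one>\<^bsub>?G\<^esub>"
  proof
    let ?\<rho> = "inv_into UNIV \<sigma>"
    let ?h = "oact C k ?\<rho> \<circ> path_rev f"
    have \<rho>: "?\<rho> permutes {..<k}" using F(2) by (rule permutes_inv)
    have h: "based_path k ?\<rho> ?h"
      unfolding ordered_path_def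
      using F \<rho> act_inv[OF F(2) eta_in[OF F(4)]] by (auto intro!: act_path pathin_path_rev)
    then show "path_class ?X ?h \<in> carrier ?G" by (rule class_in_carrier)
    have "path_class ?X (path_join ?h (oact C k ?\<rho> \<circ> f)) =
        path_class ?X (oact C k ?\<rho> \<circ> path_join (path_rev f) f)"
      by (simp add: compose_path_join)
    also have "\<dots> = path_class ?X (oact C k ?\<rho> \<circ> (\<lambda>_. f 1))"
      using \<rho> F(1) by (intro path_class_eqI path_homotopic_compose[OF act_continuous]
          path_homotopic_rev_join) auto
    also have "oact C k ?\<rho> \<circ> (\<lambda>_. f 1) = (\<lambda>_. basept \<eta> k)"
      using act_inv[OF F(2) eta_in[OF F(4)]] F(6) by (auto simp: basept_def)
    finally show "path_class ?X ?h \<otimes>\<^bsub>?G\<^esub> A = \<one>\<^bsub>?G\<^esub>"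
      unfolding f(2) pi1_rel_mult_class[OF h f(1)] one_pi1_rel .
  qed
  fix B assume "B \<in> carrier ?G"
  then obtain \<tau> g where g: "based_path k \<tau> g" "B = path_class ?X g" by (rule pi1_rel_cases)
  note G = ordered_pathD[OF g(1)]
  note fg = ordered_path_join[OF f(1) g(1)]
  show "A \<otimes>\<^bsub>?G\<^esub> B \<in> carrier ?G"
    unfolding f(2) g(2) pi1_rel_mult_class[OF f(1) g(1)] using fg by (rule class_in_carrier)
  fix D assume "D \<in> carrier ?G"
  then obtain \<rho> h where h: "based_path k \<rho> h" "D = path_class ?X h" by (rule pi1_rel_cases)
  note H = ordered_pathD[OF h(1)]
  note gh = ordered_path_join[OF g(1) h(1)]
  have "path_class ?X (path_join (path_join f (oact C k \<sigma> \<circ> g)) (oact C k (\<tau> \<circ> \<sigma>) \<circ> h)) =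
      path_class ?X (path_join (path_join f (oact C k \<sigma> \<circ> g)) (oact C k \<sigma> \<circ> (oact C k \<tau> \<circ> h)))"
    using act_comp[OF F(2) G(2) pathin_in[OF H(1)]] ordered_pathD(1)[OF ordered_path_join[OF fg h(1)]]
    by (intro path_class_eqI path_homotopic_eq path_join_eq) auto
  also have "\<dots> = path_class ?X (path_join f (path_join (oact C k \<sigma> \<circ> g) (oact C k \<sigma> \<circ>
      (oact C k \<tau> \<circ> h))))"
    using F G H by (intro path_class_eqI path_homotopic_assoc act_path) auto
  finally show "A \<otimes>\<^bsub>?G\<^esub> B \<otimes>\<^bsub>?G\<^esub> D = A \<otimes>\<^bsub>?G\<^esub> (B \<otimes>\<^bsub>?G\<^esub> D)"
    unfolding f(2) g(2) h(2) pi1_rel_mult_class[OF f(1) g(1)] pi1_rel_mult_class[OF g(1) h(1)]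
      pi1_rel_mult_class[OF fg h(1)] pi1_rel_mult_class[OF f(1) gh] compose_path_join .
qed (use class_in_carrier[OF based_path_const] in \<open>simp add: one_pi1_rel\<close>)

lemma path_comp_eq:
  "length gs = length ms \<Longrightarrow> path_comp ms f ((!) gs) t = ocomp C ms (f t) (map (\<lambda>g. g t) gs)"
  unfolding path_comp_def by (auto intro!: arg_cong[where f = "ocomp C ms _"] nth_equalityI)

lemma rel_comp_based:
  assumes "based_path (length ms) \<sigma> f" "length \<tau>s = length ms"
    and "\<And>i. i < length ms \<Longrightarrow> based_path (ms ! i) (\<tau>s ! i) (gs ! i)"
  shows "rel_comp C \<eta> ms (path_class (ospace C (length ms)) f)
      (map (\<lambda>i. path_class (ospace C (ms ! i)) (gs ! i)) [0..<length ms]) =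
    straight_class (sum_list ms) (intervals_comp (std_intervals (length ms)) (map std_intervals ms))
      (block_perm ms \<sigma> \<tau>s)
      (intervals_comp (std_intervals (length ms)) (permute_inv \<sigma> (map std_intervals ms)))
      (path_comp ms f ((!) gs))"
    and "ordered_path (sum_list ms) (intervals_comp (std_intervals (length ms)) (map std_intervals ms))
      (block_perm ms \<sigma> \<tau>s)
      (intervals_comp (std_intervals (length ms)) (permute_inv \<sigma> (map std_intervals ms)))
      (path_comp ms f ((!) gs))"
  by (rule rel_comp_class, use assms in auto) (rule ordered_path_comp, use assms in auto)

lemma rel_comp_closed:
  assumes "a \<in> carrier (pi1_rel C \<eta> (length ms))" "list_all2 (\<lambda>m b. b \<in> carrier (pi1_rel C \<eta> m)) ms bs"
  shows "rel_comp C \<eta> ms a bs \<in> carrier (pi1_rel C \<eta> (sum_list ms))"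
    and "rel_boundary C \<eta> (sum_list ms) (rel_comp C \<eta> ms a bs) =
      block_perm ms (rel_boundary C \<eta> (length ms) a) (map2 (rel_boundary C \<eta>) ms bs)"
proof -
  obtain \<sigma> f where f: "based_path (length ms) \<sigma> f" "a = path_class (ospace C (length ms)) f"
    using assms(1) by (rule pi1_rel_cases)
  obtain \<tau>s gs where g: "length \<tau>s = length ms" "length gs = length ms"
    "\<And>i. i < length ms \<Longrightarrow> based_path (ms ! i) (\<tau>s ! i) (gs ! i)"
    "bs = map (\<lambda>i. path_class (ospace C (ms ! i)) (gs ! i)) [0..<length ms]"
    using assms(2) by (rule pi1_rel_list_cases) blast
  have \<tau>s: "map2 (rel_boundary C \<eta>) ms bs = \<tau>s"
    using g by (auto intro!: nth_equalityI simp: rel_boundary_class)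
  note op = rel_comp_based(2)[OF f(1) g(1), of gs]
  have comp: "rel_comp C \<eta> ms a bs = straight_class (sum_list ms)
      (intervals_comp (std_intervals (length ms)) (map std_intervals ms)) (block_perm ms \<sigma> \<tau>s)
      (intervals_comp (std_intervals (length ms)) (permute_inv \<sigma> (map std_intervals ms)))
      (path_comp ms f ((!) gs))"
    unfolding f(2) g(4) by (rule rel_comp_based(1)[OF f(1) g(1,3)])
  show "rel_comp C \<eta> ms a bs \<in> carrier (pi1_rel C \<eta> (sum_list ms))"
    unfolding comp by (rule straight_class_in_carrier, rule op, rule g(3))
  have "rel_boundary C \<eta> (sum_list ms) (rel_comp C \<eta> ms a bs) = block_perm ms \<sigma> \<tau>s"
    unfolding comp by (rule rel_boundary_straight_class, rule op, rule g(3))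
  then show "rel_boundary C \<eta> (sum_list ms) (rel_comp C \<eta> ms a bs) =
      block_perm ms (rel_boundary C \<eta> (length ms) a) (map2 (rel_boundary C \<eta>) ms bs)"
    unfolding \<tau>s f(2) rel_boundary_class[OF f(1)] .
qed

text \<open>
  Both sides are represented by the same path, namely the pointwise composite of all paths: inner
  composites may be replaced by the ordered paths that they straighten.
\<close>

lemma rel_comp_assoc:
  assumes a: "a \<in> carrier (pi1_rel C \<eta> (length nss))"
    and bs: "list_all2 (\<lambda>ns b. b \<in> carrier (pi1_rel C \<eta> (length ns))) nss bs"
    and css: "list_all2 (list_all2 (\<lambda>n c. c \<in> carrier (pi1_rel C \<eta> n))) nss css"
  shows "rel_comp C \<eta> (concat nss) (rel_comp C \<eta> (map length nss) a bs) (concat css) =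
    rel_comp C \<eta> (map sum_list nss) a (map (\<lambda>i. rel_comp C \<eta> (nss ! i) (bs ! i) (css ! i)) [0..<length
        nss])"
proof -
  define k where "k = length nss"
  define ms where "ms = map length nss"
  have lms: "length ms = k" and msi: "\<And>i. i < k \<Longrightarrow> ms ! i = length (nss ! i)"
    by (simp_all add: ms_def k_def)
  obtain \<sigma> f where f: "based_path k \<sigma> f" "a = path_class (ospace C k) f"
    using a unfolding k_def by (rule pi1_rel_cases)
  have "list_all2 (\<lambda>m b. b \<in> carrier (pi1_rel C \<eta> m)) ms bs"
    using bs by (simp add: ms_def list_all2_conv_all_nth)
  then obtain \<tau>s gs where g: "length \<tau>s = length ms" "length gs = length ms"
    "\<And>i. i < length ms \<Longrightarrow> based_path (ms ! i) (\<tau>s ! i) (gs ! i)"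
    "bs = map (\<lambda>i. path_class (ospace C (ms ! i)) (gs ! i)) [0..<length ms]"
    by (rule pi1_rel_list_cases) blast
  let ?Q = "\<lambda>i \<rho>s hs. length \<rho>s = length (nss ! i) \<and> length hs = length (nss ! i) \<and>
      (\<forall>j<length (nss ! i). based_path (nss ! i ! j) (\<rho>s ! j) (hs ! j)) \<and>
      css ! i = map (\<lambda>j. path_class (ospace C (nss ! i ! j)) (hs ! j)) [0..<length (nss ! i)]"
  have "\<forall>i. \<exists>\<rho>s hs. i < k \<longrightarrow> ?Q i \<rho>s hs"
  proof
    fix i
    show "\<exists>\<rho>s hs. i < k \<longrightarrow> ?Q i \<rho>s hs"
    proof (cases "i < k")
      case True
      then have "list_all2 (\<lambda>n c. c \<in> carrier (pi1_rel C \<eta> n)) (nss ! i) (css ! i)"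
        using css by (simp add: list_all2_conv_all_nth k_def)
      then show ?thesis by (rule pi1_rel_list_cases) blast
    qed simp
  qed
  then obtain R Hs where RH: "\<forall>i. i < k \<longrightarrow> ?Q i (R i) (Hs i)"
    unfolding choice_iff by (elim exE) (rule that)
  define \<rho>ss hss where "\<rho>ss = map R [0..<k]" and "hss = map Hs [0..<k]"
  have lens: "length bs = k" "length css = k" "length \<rho>ss = k" "length hss = k"
    using list_all2_lengthD[OF bs] list_all2_lengthD[OF css] by (simp_all add: \<rho>ss_def hss_def k_def)
  have maplen: "map length \<rho>ss = ms" "map length hss = ms" "map length css = ms"
    using RH lens by (auto intro!: nth_equalityI simp: ms_def k_def \<rho>ss_def hss_def)
  let ?N = "sum_list (concat nss)"
  have lc: "length (concat nss) = sum_list ms" "length (concat \<rho>ss) = sum_list ms"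
    "length (concat hss) = sum_list ms" "length (concat css) = sum_list ms"
    using maplen by (simp_all add: length_concat ms_def)
  have h: "based_path (concat nss ! x) (concat \<rho>ss ! x) (concat hss ! x) \<and>
      concat css ! x = path_class (ospace C (concat nss ! x)) (concat hss ! x)" if "x < length (concat
          nss)" for x
  proof -
    from that obtain i j where ij: "i < length ms" "j < ms ! i" "x = offset ms i + j"
      unfolding lc by (rule offset_cases)
    then have i: "i < k" and j: "j < length (nss ! i)" using lms msi by auto
    have "concat nss ! x = nss ! i ! j" "concat \<rho>ss ! x = R i ! j" "concat hss ! x =
        Hs i ! j" "concat css ! x = css ! i ! j"
      using concat_nth_offset[of i nss j] concat_nth_offset[of i \<rho>ss j] concat_nth_offset[of i hss j]
        concat_nth_offset[of i css j] maplen lens i j RH ij(3)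
      by (simp_all add: ms_def[symmetric] k_def[symmetric] \<rho>ss_def hss_def)
    then show ?thesis using RH i j by simp
  qed
  let ?s = "map std_intervals ms"
  let ?S = "map (map std_intervals) nss"
  have S: "map std_intervals (concat nss) = concat ?S" by (rule map_concat)
  note B1 = rel_comp_based[of ms \<sigma> f \<tau>s gs, unfolded lms, OF f(1) g(1,3)[unfolded lms]]
  let ?u1 = "intervals_comp (std_intervals k) ?s"
  let ?v1 = "intervals_comp (std_intervals k) (permute_inv \<sigma> ?s)"
  let ?p1 = "path_comp ms f ((!) gs)"
  let ?b1 = "block_perm ms \<sigma> \<tau>s"
  have ab: "rel_comp C \<eta> ms a bs = straight_class (sum_list ms) ?u1 ?b1 ?v1 ?p1"
    unfolding f(2) g(4) lms by (rule B1(1))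
  have cc: "concat css = map (\<lambda>x. straight_class (concat nss ! x) (concat ?S ! x) (concat \<rho>ss ! x)
      (concat ?S ! x) (concat hss ! x))
      [0..<length (concat nss)]"
    using h lc by (auto intro!: nth_equalityI simp: straight_class_based S[symmetric])
  let ?pL = "path_comp (concat nss) ?p1 ((!) (concat hss))"
  let ?uL = "intervals_comp ?u1 (concat ?S)" and ?vL = "intervals_comp ?v1 (permute_inv ?b1 (concat ?S))"
  have hL: "ordered_path (concat nss ! x) (concat ?S ! x) (concat \<rho>ss ! x) (concat ?S ! x)
      (concat hss ! x)"
    if "x < length (concat nss)" for x
    using h[OF that] that by (simp add: S[symmetric])
  have lS: "length (concat ?S) = length (concat nss)" by (simp add: S[symmetric])
  have LHS: "rel_comp C \<eta> (concat nss) (rel_comp C \<eta> ms a bs) (concat css) =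
      straight_class ?N ?uL (block_perm (concat nss) ?b1 (concat \<rho>ss)) ?vL ?pL"
    unfolding ab cc lc(1)[symmetric]
    by (rule rel_comp_straight_class) (use hL lS lc B1(2) in auto)
  have oL: "ordered_path ?N ?uL (block_perm (concat nss) ?b1 (concat \<rho>ss)) ?vL ?pL"
    by (rule ordered_path_comp) (use hL lS lc B1(2) in auto)
  let ?u2 = "map2 intervals_comp ?s ?S"
  let ?v2 = "map2 intervals_comp ?s (map2 permute_inv \<tau>s ?S)"
  let ?b2 = "map (\<lambda>i. block_perm (nss ! i) (\<tau>s ! i) (\<rho>ss ! i)) [0..<k]"
  let ?p2 = "map (\<lambda>i. path_comp (nss ! i) (gs ! i) ((!) (hss ! i))) [0..<k]"
  let ?ns = "map sum_list nss"
  have inner: "rel_comp C \<eta> (nss ! i) (bs ! i) (css ! i) =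
      straight_class (?ns ! i) (?u2 ! i) (?b2 ! i) (?v2 ! i) (?p2 ! i)"
    "ordered_path (?ns ! i) (?u2 ! i) (?b2 ! i) (?v2 ! i) (?p2 ! i)" if i: "i < k" for i
  proof -
    have gi: "based_path (length (nss ! i)) (\<tau>s ! i) (gs ! i)" using g(3)[of i] i lms msi by simp
    have hi: "length (\<rho>ss ! i) = length (nss ! i)"
      "\<And>j. j < length (nss ! i) \<Longrightarrow> based_path (nss ! i ! j) (\<rho>ss ! i ! j) (hss ! i ! j)"
      "css ! i = map (\<lambda>j. path_class (ospace C (nss ! i ! j)) (hss ! i ! j)) [0..<length (nss ! i)]"
      using RH i by (auto simp: \<rho>ss_def hss_def)
    have bi: "bs ! i = path_class (ospace C (length (nss ! i))) (gs ! i)" using g(4) i lms msi by simp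
    have eqs: "?ns ! i = sum_list (nss ! i)" "?b2 ! i = block_perm (nss ! i) (\<tau>s ! i) (\<rho>ss ! i)"
      "?p2 ! i = path_comp (nss ! i) (gs ! i) ((!) (hss ! i))"
      "?u2 ! i = intervals_comp (std_intervals (length (nss ! i))) (map std_intervals (nss ! i))"
      "?v2 ! i = intervals_comp (std_intervals (length (nss ! i))) (permute_inv (\<tau>s ! i)
          (map std_intervals (nss ! i)))"
      using i g(1) lms msi by (simp_all add: k_def)
    show "rel_comp C \<eta> (nss ! i) (bs ! i) (css ! i) =
        straight_class (?ns ! i) (?u2 ! i) (?b2 ! i) (?v2 ! i) (?p2 ! i)"
      unfolding eqs bi hi(3) by (rule rel_comp_based(1)[OF gi hi(1,2)])
    show "ordered_path (?ns ! i) (?u2 ! i) (?b2 ! i) (?v2 ! i) (?p2 ! i)"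
      unfolding eqs by (rule rel_comp_based(2)[OF gi hi(1,2)])
  qed
  let ?uR = "intervals_comp (std_intervals k) ?u2" and ?vR =
      "intervals_comp (std_intervals k) (permute_inv \<sigma> ?v2)"
  let ?pR = "path_comp ?ns f ((!) ?p2)"
  have lns: "length ?ns = k" by (simp add: k_def)
  have l2: "length ?u2 = length ?ns" "length ?v2 = length ?ns" "length ?b2 = length ?ns"
    using g(1) lms by (simp_all add: k_def)
  have a': "a = straight_class (length ?ns) (std_intervals k) \<sigma> (std_intervals k) f"
    using straight_class_based[OF f(1)] f(2) lns by simp
  have f': "ordered_path (length ?ns) (std_intervals k) \<sigma> (std_intervals k) f" using f(1) lns by simp
  have RHS: "rel_comp C \<eta> ?ns a (map (\<lambda>i. rel_comp C \<eta> (nss ! i) (bs ! i) (css ! i)) [0..<length nss]) =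
      straight_class (sum_list ?ns) ?uR (block_perm ?ns \<sigma> ?b2) ?vR ?pR"
  proof -
    have E: "map (\<lambda>i. rel_comp C \<eta> (nss ! i) (bs ! i) (css ! i)) [0..<length nss] =
        map (\<lambda>i. straight_class (?ns ! i) (?u2 ! i) (?b2 ! i) (?v2 ! i) (?p2 ! i)) [0..<length ?ns]"
      using inner(1) by (intro map_cong) (auto simp: k_def)
    show ?thesis
      unfolding E unfolding a' by (rule rel_comp_straight_class[OF f' l2(3,1,2)])
          (use inner(2) lns in auto)
  qed
  have oR: "ordered_path (sum_list ?ns) ?uR (block_perm ?ns \<sigma> ?b2) ?vR ?pR"
    using inner(2) lns by (intro ordered_path_comp[OF f' l2(3,1,2)]) auto
  have \<sigma>: "\<sigma> permutes {..<k}" using f(1) by (rule ordered_pathD)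
  have \<tau>: "\<tau>s ! i permutes {..<ms ! i}" if "i < k" for i
    using g(3)[of i] that lms by (auto dest: ordered_pathD)
  have "list_all2 (\<lambda>b cs. length b = length cs) ?s ?S"
    by (auto simp: list_all2_conv_all_nth ms_def)
  then have u: "?uL = ?uR"
    by (intro intervals_comp_assoc) (simp_all add: lms)
  have perm: "permute_inv ?b1 (concat ?S) = concat (permute_inv \<sigma> (map2 permute_inv \<tau>s ?S))"
    by (rule permute_inv_concat) (use \<sigma> \<tau> g(1) lms in \<open>auto simp: k_def ms_def intro!: nth_equalityI\<close>)
  have "list_all2 (\<lambda>b cs. length b = length cs) (permute_inv \<sigma> ?s) (permute_inv \<sigma>
      (map2 permute_inv \<tau>s ?S))"
    using g(1) lms msi permutes_inv_less[OF \<sigma>]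
    by (auto simp: list_all2_conv_all_nth permute_list_def k_def)
  then have "?vL = intervals_comp (std_intervals k)
      (map2 intervals_comp (permute_inv \<sigma> ?s) (permute_inv \<sigma> (map2 permute_inv \<tau>s ?S)))"
    unfolding perm by (intro intervals_comp_assoc) (simp_all add: lms)
  also have "map2 intervals_comp (permute_inv \<sigma> ?s) (permute_inv \<sigma> (map2 permute_inv \<tau>s ?S)) =
      permute_inv \<sigma> ?v2"
    using g(1) lms permutes_inv_less[OF \<sigma>]
    by (auto intro!: nth_equalityI simp: permute_list_def k_def)
  finally have v: "?vL = ?vR" .
  have p: "?pL t = ?pR t" if t: "t \<in> {0..1}" for t
  proof -
    let ?b = "map (\<lambda>g. g t) gs" and ?c = "map (map (\<lambda>h. h t)) hss"
    have "?pL t = ocomp C (concat nss) (ocomp C ms (f t) ?b) (concat ?c)"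
      using lc g(2) by (simp add: path_comp_eq map_concat)
    also have "\<dots> = ocomp C ?ns (f t) (map (\<lambda>i. ocomp C (nss ! i) (?b ! i) (?c ! i)) [0..<length nss])"
      unfolding ms_def
    proof (rule comp_assoc)
      show "f t \<in> oset C (length nss)"
        using pathin_in[OF ordered_pathD(1)[OF f(1)] t] by (simp add: k_def)
      show "list_all2 (\<lambda>ns b. b \<in> oset C (length ns)) nss ?b"
        using g(2) lms msi pathin_in[OF ordered_pathD(1)[OF g(3)] t]
        by (auto simp: list_all2_conv_all_nth k_def)
      have "(Hs i ! j) t \<in> oset C (nss ! i ! j)" if "i < k" "j < length (nss ! i)" for i j
        by (rule pathin_in[OF ordered_pathD(1) t]) (use RH that in blast)
      then show "list_all2 (list_all2 (\<lambda>n c. c \<in> oset C n)) nss ?c"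
        using RH by (auto simp: list_all2_conv_all_nth k_def hss_def)
    qed
    also have "map (\<lambda>i. ocomp C (nss ! i) (?b ! i) (?c ! i)) [0..<length nss] = map (\<lambda>p. p t) ?p2"
      using g(2) lms RH by (auto simp: k_def hss_def path_comp_eq)
    also have "ocomp C ?ns (f t) (map (\<lambda>p. p t) ?p2) = ?pR t"
      by (rule path_comp_eq[symmetric]) (simp add: k_def)
    finally show ?thesis .
  qed
  have "straight_class ?N ?uL (block_perm (concat nss) ?b1 (concat \<rho>ss)) ?vL ?pL =
      straight_class (sum_list ?ns) ?uR (block_perm ?ns \<sigma> ?b2) ?vR ?pR"
    using straight_class_eqI[OF oL oR[unfolded sum_list_concat_map] u v p]
        by (simp add: sum_list_concat_map)
  then show ?thesis using LHS RHS by (simp add: ms_def)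
qed

text \<open>
  Pointwise composition commutes with concatenation, and in the second half of the concatenated paths
  equivariance collects the permutations into a block permutation.
\<close>

lemma rel_comp_interchange:
  assumes a: "a \<in> carrier (pi1_rel C \<eta> (length ms))" and a': "a' \<in> carrier (pi1_rel C \<eta> (length ms))"
    and bs: "list_all2 (\<lambda>m b. b \<in> carrier (pi1_rel C \<eta> m)) ms bs"
    and bs': "list_all2 (\<lambda>m b. b \<in> carrier (pi1_rel C \<eta> m)) ms bs'"
  shows "rel_comp C \<eta> ms (a \<otimes>\<^bsub>pi1_rel C \<eta> (length ms)\<^esub> a')
      (map (\<lambda>i. bs ! i \<otimes>\<^bsub>pi1_rel C \<eta> (ms ! i)\<^esub> bs' ! i) [0..<length ms]) =
    rel_comp C \<eta> ms a bs \<otimes>\<^bsub>pi1_rel C \<eta> (sum_list ms)\<^esub>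
      rel_comp C \<eta> (permute_inv (rel_boundary C \<eta> (length ms) a) ms) a'
        (permute_inv (rel_boundary C \<eta> (length ms) a) bs')"
proof -
  define k where "k = length ms"
  obtain \<sigma> f where f: "based_path k \<sigma> f" "a = path_class (ospace C k) f"
    using a unfolding k_def by (rule pi1_rel_cases)
  obtain \<sigma>' f' where f': "based_path k \<sigma>' f'" "a' = path_class (ospace C k) f'"
    using a' unfolding k_def by (rule pi1_rel_cases)
  obtain \<tau>s gs where g: "length \<tau>s = k" "length gs = k"
    "\<And>i. i < k \<Longrightarrow> based_path (ms ! i) (\<tau>s ! i) (gs ! i)"
    "bs = map (\<lambda>i. path_class (ospace C (ms ! i)) (gs ! i)) [0..<k]"
    using bs unfolding k_def by (rule pi1_rel_list_cases) blast
  obtain \<tau>s' gs' where g': "length \<tau>s' = k" "length gs' = k"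
    "\<And>i. i < k \<Longrightarrow> based_path (ms ! i) (\<tau>s' ! i) (gs' ! i)"
    "bs' = map (\<lambda>i. path_class (ospace C (ms ! i)) (gs' ! i)) [0..<k]"
    using bs' unfolding k_def by (rule pi1_rel_list_cases) blast
  note F = ordered_pathD[OF f(1)] and F' = ordered_pathD[OF f'(1)]
  note G = ordered_pathD[OF g(3)] and G' = ordered_pathD[OF g'(3)]
  have \<sigma>: "\<sigma> permutes {..<length ms}" and \<sigma>': "\<sigma>' permutes {..<length ms}"
    using F(2) F'(2) by (simp_all add: k_def)
  let ?s = "map std_intervals ms"
  let ?ms = "permute_inv \<sigma> ms"
  let ?U = "intervals_comp (std_intervals k) ?s"
  let ?V = "intervals_comp (std_intervals k) (permute_inv \<sigma> ?s)"
  let ?W = "intervals_comp (std_intervals k) (permute_inv (\<sigma>' \<circ> \<sigma>) ?s)"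
  let ?b = "block_perm ms \<sigma> \<tau>s"
  let ?ff = "path_join f (oact C k \<sigma> \<circ> f')"
  let ?gg = "map (\<lambda>i. path_join (gs ! i) (oact C (ms ! i) (\<tau>s ! i) \<circ> gs' ! i)) [0..<k]"
  let ?tt = "map (\<lambda>i. \<tau>s' ! i \<circ> \<tau>s ! i) [0..<k]"
  have ff: "based_path (length ms) (\<sigma>' \<circ> \<sigma>) ?ff"
    using ordered_path_join[OF f(1) f'(1)] by (simp add: k_def)
  have gg: "based_path (ms ! i) (?tt ! i) (?gg ! i)" if "i < length ms" for i
    using ordered_path_join[OF g(3) g'(3), of i] that by (simp add: k_def)
  have lt: "length ?tt = length ms" by (simp add: k_def)
  have aa: "a \<otimes>\<^bsub>pi1_rel C \<eta> (length ms)\<^esub> a' = path_class (ospace C (length ms)) ?ff"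
    using pi1_rel_mult_class[OF f(1) f'(1)] f(2) f'(2) by (simp add: k_def)
  have bb: "map (\<lambda>i. bs ! i \<otimes>\<^bsub>pi1_rel C \<eta> (ms ! i)\<^esub> bs' ! i) [0..<length ms] =
      map (\<lambda>i. path_class (ospace C (ms ! i)) (?gg ! i)) [0..<length ms]"
    using pi1_rel_mult_class[OF g(3) g'(3)] g(4) g'(4) by (simp add: k_def)
  note L = rel_comp_based[OF ff lt gg, folded aa bb k_def]
  have A: "rel_comp C \<eta> ms a bs = straight_class (sum_list ms) ?U ?b ?V (path_comp ms f ((!) gs))"
    "ordered_path (sum_list ms) ?U ?b ?V (path_comp ms f ((!) gs))"
    using rel_comp_based[of ms \<sigma> f \<tau>s gs] f g by (simp_all add: k_def)
  have \<sigma>a: "rel_boundary C \<eta> (length ms) a = \<sigma>"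
    using rel_boundary_class[OF f(1)] f(2) by (simp add: k_def)
  let ?ts = "permute_inv \<sigma> \<tau>s'" and ?gs = "permute_inv \<sigma> gs'"
  let ?b' = "block_perm ?ms \<sigma>' ?ts"
  have f'': "based_path (length ?ms) \<sigma>' f'" using f'(1) by (simp add: k_def)
  have lts: "length ?ts = length ?ms" using g' by (simp add: k_def)
  have g'': "based_path (?ms ! i) (?ts ! i) (?gs ! i)" if "i < length ?ms" for i
    using g'(1-3) permutes_inv_less[OF \<sigma>] that by (simp add: permute_list_def k_def)
  have bs'': "permute_inv \<sigma> bs' = map (\<lambda>i. path_class (ospace C (?ms ! i)) (?gs ! i)) [0..<length ?ms]"
    using g'(2,4) permutes_inv_less[OF \<sigma>] by (auto intro!: nth_equalityI simp: permute_list_def k_def)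
  have perm: "map std_intervals ?ms = permute_inv \<sigma> ?s"
    by (rule permute_list_map[OF permutes_inv[OF \<sigma>], symmetric])
  have perm': "permute_inv \<sigma>' (permute_inv \<sigma> ?s) = permute_inv (\<sigma>' \<circ> \<sigma>) ?s"
    by (rule permute_inv_compose[symmetric]) (use \<sigma> \<sigma>' in simp_all)
  have A': "rel_comp C \<eta> ?ms a' (permute_inv \<sigma> bs') =
      straight_class (sum_list ms) ?V ?b' ?W (path_comp ?ms f' ((!) ?gs))"
    "ordered_path (sum_list ms) ?V ?b' ?W (path_comp ?ms f' ((!) ?gs))"
    using rel_comp_based[OF f'' lts g'', folded bs'', unfolded perm perm' sum_list_permute_inv[OF \<sigma>]]
        f'(2)
    by (simp_all add: k_def)
  have R: "rel_comp C \<eta> ms a bs \<otimes>\<^bsub>pi1_rel C \<eta> (sum_list ms)\<^esub> rel_comp C \<eta> ?ms a' (permute_inv \<sigma> bs') =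
      straight_class (sum_list ms) ?U (?b' \<circ> ?b) ?W
        (path_join (path_comp ms f ((!) gs)) (oact C (sum_list ms) ?b \<circ> path_comp ?ms f' ((!) ?gs)))"
    unfolding A(1) A'(1) by (rule straight_class_mult[OF A(2) A'(2)])
  have equi: "ocomp C ms (oact C k \<sigma> (f' t)) (map (\<lambda>i. oact C (ms ! i) (\<tau>s ! i) ((gs' ! i) t)) [0..<k]) =
      oact C (sum_list ms) ?b (path_comp ?ms f' ((!) ?gs) t)" if t: "t \<in> {0..1}" for t
  proof -
    let ?x = "map (\<lambda>g. g t) gs'"
    have "ocomp C ms (oact C (length ms) \<sigma> (f' t)) (map (\<lambda>i. oact C (ms ! i) (\<tau>s ! i)
        (?x ! i)) [0..<length ms]) =
        oact C (sum_list ms) ?b (ocomp C ?ms (f' t) (permute_inv \<sigma> ?x))"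
    proof (rule equivariant)
      show "f' t \<in> oset C (length ms)" using pathin_in[OF F'(1) t] by (simp add: k_def)
      show "list_all2 (\<lambda>m \<tau>. \<tau> \<in> carrier (perm_group m)) ms \<tau>s"
        using g(1) G(2) by (simp add: list_all2_conv_all_nth k_def)
      show "list_all2 (\<lambda>m b. b \<in> oset C m) ms ?x"
        using g'(2) pathin_in[OF G'(1) t] by (simp add: list_all2_conv_all_nth k_def)
    qed (use \<sigma> in simp)
    moreover have "permute_inv \<sigma> ?x = map (\<lambda>g. g t) ?gs"
      using \<sigma> g'(2) by (intro permute_list_map permutes_inv) (simp add: k_def)
    moreover have "map (\<lambda>i. oact C (ms ! i) (\<tau>s ! i) (?x ! i)) [0..<length ms] =
        map (\<lambda>i. oact C (ms ! i) (\<tau>s ! i) ((gs' ! i) t)) [0..<k]"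
      using g'(2) by (simp add: k_def)
    ultimately show ?thesis using g'(2) by (simp add: path_comp_eq k_def)
  qed
  have "path_comp ms ?ff ((!) ?gg) t =
      path_join (path_comp ms f ((!) gs)) (oact C (sum_list ms) ?b \<circ> path_comp ?ms f' ((!) ?gs)) t"
    if t: "t \<in> {0..1}" for t
  proof (cases "t \<le> 1/2")
    case True
    then show ?thesis by (auto simp: path_comp_def path_join_def k_def intro!: arg_cong2[where f =
        "ocomp C ms"])
  next
    case False
    then have "path_comp ms ?ff ((!) ?gg) t = ocomp C ms (oact C k \<sigma> (f' (2 * t - 1)))
        (map (\<lambda>i. oact C (ms ! i) (\<tau>s ! i) ((gs' ! i) (2 * t - 1))) [0..<k])"
      by (auto simp: path_comp_def path_join_def k_def intro!: arg_cong2[where f = "ocomp C ms"])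
    then show ?thesis using equi[of "2 * t - 1"] False t by (simp add: path_join_def)
  qed
  then have "straight_class (sum_list ms) ?U (block_perm ms (\<sigma>' \<circ> \<sigma>) ?tt) ?W (path_comp ms ?ff
      ((!) ?gg)) =
      straight_class (sum_list ms) ?U (?b' \<circ> ?b) ?W
        (path_join (path_comp ms f ((!) gs)) (oact C (sum_list ms) ?b \<circ> path_comp ?ms f' ((!) ?gs)))"
    by (intro straight_class_eqI[OF L(2) ordered_path_join[OF A(2) A'(2)] refl refl])
  then show ?thesis unfolding \<sigma>a R using L(1) by (simp add: k_def)
qed

lemma rel_comp_unit_left:
  assumes "a \<in> carrier (pi1_rel C \<eta> n)"
  shows "rel_comp C \<eta> [n] \<one>\<^bsub>pi1_rel C \<eta> 1\<^esub> [a] = a"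
proof -
  obtain \<sigma> f where f: "based_path n \<sigma> f" "a = path_class (ospace C n) f"
    using assms by (rule pi1_rel_cases)
  let ?c = "\<lambda>_::real. basept \<eta> (length [n])"
  have c: "based_path (length [n]) id ?c" by (rule based_path_const)
  have g: "based_path ([n] ! i) ([\<sigma>] ! i) ([f] ! i)" if "i < length [n]" for i using f that by simp
  have B: "rel_comp C \<eta> [n] (path_class (ospace C 1) ?c) [path_class (ospace C n) f] =
      straight_class n (std_intervals n) (block_perm [n] id [\<sigma>]) (std_intervals n) (path_comp [n] ?c
          ((!) [f]))"
    "ordered_path n (std_intervals n) (block_perm [n] id [\<sigma>]) (std_intervals n) (path_comp [n] ?c
        ((!) [f]))"
    using rel_comp_based[OF c _ g]
    by (simp_all add: std_intervals_1 intervals_comp_unit_left del: intervals_comp_Cons)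
  have e: "basept \<eta> (Suc 0) = ounit C" by (simp add: basept_def eta_unit)
  have "path_comp [n] ?c ((!) [f]) t = f t" if "t \<in> {0..1}" for t
    using unit_left[OF pathin_in[OF ordered_pathD(1)[OF f(1)] that]]
    by (simp add: path_comp_def e)
  then have "straight_class n (std_intervals n) (block_perm [n] id [\<sigma>]) (std_intervals n)
      (path_comp [n] ?c ((!) [f])) =
      straight_class n (std_intervals n) \<sigma> (std_intervals n) f"
    using B(2) f(1) by (intro straight_class_eqI) auto
  then show ?thesis
    using B(1) straight_class_based[OF f(1)] f(2) by (simp add: one_pi1_rel)
qed

lemma rel_comp_unit_right:
  assumes "a \<in> carrier (pi1_rel C \<eta> n)"
  shows "rel_comp C \<eta> (replicate n 1) a (replicate n \<one>\<^bsub>pi1_rel C \<eta> 1\<^esub>) = a"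
proof -
  obtain \<sigma> f where f: "based_path n \<sigma> f" "a = path_class (ospace C n) f"
    using assms by (rule pi1_rel_cases)
  let ?ms = "replicate n (Suc 0)"
  let ?c = "\<lambda>_::real. basept \<eta> (Suc 0)"
  have f': "based_path (length ?ms) \<sigma> f" using f(1) by simp
  have g: "based_path (?ms ! i) (replicate n id ! i) (replicate n ?c ! i)" if "i < length ?ms" for i
    using that based_path_const[of "Suc 0"] by simp
  have perm: "permute_inv \<sigma> (replicate n x) = replicate n x" for x :: "(real \<times> real) list"
    using permutes_inv_less[OF ordered_pathD(2)[OF f(1)]]
    by (auto intro!: nth_equalityI simp: permute_list_def)
  have iv: "intervals_comp (std_intervals n) (replicate n [(0, 1)]) = std_intervals n"
    using intervals_comp_unit_right[of "std_intervals n"] by simp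
  have B: "rel_comp C \<eta> ?ms (path_class (ospace C n) f)
      (map (\<lambda>i. path_class (ospace C (?ms ! i)) (replicate n ?c ! i)) [0..<n]) =
    straight_class n (std_intervals n) (block_perm ?ms \<sigma> (replicate n id)) (std_intervals n)
      (path_comp ?ms f ((!) (replicate n ?c)))"
    "ordered_path n (std_intervals n) (block_perm ?ms \<sigma> (replicate n id)) (std_intervals n)
      (path_comp ?ms f ((!) (replicate n ?c)))"
    using rel_comp_based[OF f' _ g] by (simp_all add: sum_list_replicate std_intervals_1 perm iv)
  have e: "basept \<eta> (Suc 0) = ounit C" by (simp add: basept_def eta_unit)
  have "path_comp ?ms f ((!) (replicate n ?c)) t = f t" if "t \<in> {0..1}" for t
    using unit_right[OF pathin_in[OF ordered_pathD(1)[OF f(1)] that]]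
    by (simp add: path_comp_eq e)
  then have "straight_class n (std_intervals n) (block_perm ?ms \<sigma> (replicate n id)) (std_intervals n)
      (path_comp ?ms f ((!) (replicate n ?c))) =
          straight_class n (std_intervals n) \<sigma> (std_intervals n) f"
    using B(2) f(1) by (intro straight_class_eqI) auto
  moreover have "map (\<lambda>i. path_class (ospace C (?ms ! i)) (replicate n ?c ! i)) [0..<n] =
      replicate n \<one>\<^bsub>pi1_rel C \<eta> 1\<^esub>"
    by (auto intro!: nth_equalityI simp: one_pi1_rel)
  ultimately show ?thesis
    using B(1) straight_class_based[OF f(1)] f(2) by simp
qed

lemma carrier_pi1_rel_0: "\<exists>p. carrier (pi1_rel C \<eta> 0) = {p}"
proof -
  obtain p where p: "oset C 0 = {p}" using space_0 by blast
  have "A = \<one>\<^bsub>pi1_rel C \<eta> 0\<^esub>" if A: "A \<in> carrier (pi1_rel C \<eta> 0)" for A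
  proof -
    obtain \<sigma> f where f: "based_path 0 \<sigma> f" "A = path_class (ospace C 0) f"
      using A by (rule pi1_rel_cases)
    note F = ordered_pathD[OF f(1)]
    have "f t = basept \<eta> 0" if "t \<in> {0..1}" for t
      using pathin_in[OF F(1) that] eta_in[OF std_ordered, of 0] p by (simp add: basept_def)
    then show ?thesis
      unfolding f(2) one_pi1_rel by (intro path_class_eqI path_homotopic_eq F(1))
  qed
  moreover have "\<one>\<^bsub>pi1_rel C \<eta> 0\<^esub> \<in> carrier (pi1_rel C \<eta> 0)"
    using group_pi1_rel[of 0] by (simp add: group.is_monoid)
  ultimately show ?thesis by blast
qed

lemma rel_boundary_hom: "rel_boundary C \<eta> k \<in> hom (pi1_rel C \<eta> k) (perm_group k)"
proof (rule homI)
  fix A assume "A \<in> carrier (pi1_rel C \<eta> k)"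
  then obtain \<sigma> f where f: "based_path k \<sigma> f" "A = path_class (ospace C k) f" by (rule pi1_rel_cases)
  show "rel_boundary C \<eta> k A \<in> carrier (perm_group k)"
    unfolding f(2) rel_boundary_class[OF f(1)] using ordered_pathD(2)[OF f(1)] by simp
  fix B assume "B \<in> carrier (pi1_rel C \<eta> k)"
  then obtain \<tau> g where g: "based_path k \<tau> g" "B = path_class (ospace C k) g" by (rule pi1_rel_cases)
  show "rel_boundary C \<eta> k (A \<otimes>\<^bsub>pi1_rel C \<eta> k\<^esub> B) =
      rel_boundary C \<eta> k A \<otimes>\<^bsub>perm_group k\<^esub> rel_boundary C \<eta> k B"
    unfolding f(2) g(2) pi1_rel_mult_class[OF f(1) g(1)] rel_boundary_class[OF f(1)]
        rel_boundary_class[OF g(1)]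
      rel_boundary_class[OF ordered_path_join[OF f(1) g(1)]] by (simp add: mult_perm_group)
qed

lemma pi1_rel_group_operad_laws: "group_operad_laws (pi1_rel C \<eta>) (rel_comp C \<eta>) (rel_boundary C \<eta>)"
  by (rule group_operad_laws.intro)
    (rule group_pi1_rel carrier_pi1_rel_0 rel_comp_closed rel_comp_assoc rel_comp_unit_left
      rel_comp_unit_right rel_boundary_hom rel_comp_interchange; assumption)+

lemma rel_boundary_surj:
  assumes \<sigma>: "\<sigma> permutes {..<k}"
  obtains A where "A \<in> carrier (pi1_rel C \<eta> k)" "rel_boundary C \<eta> k A = \<sigma>"
proof -
  have "\<eta> k (std_intervals k) \<in> oset C k" by (rule eta_in[OF std_ordered])
  then obtain f where "pathin (ospace C k) f" "f 0 = \<eta> k (std_intervals k)"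
    "f 1 = oact C k \<sigma> (\<eta> k (std_intervals k))"
    using path_connected[of k] act_in[OF \<sigma>] unfolding path_connected_space_def by blast
  then have f: "based_path k \<sigma> f" using \<sigma> by (simp add: ordered_path_def std_ordered)
  show thesis
    by (rule that[OF class_in_carrier[OF f] rel_boundary_class[OF f]])
qed


section \<open>The quotients by the symmetric groups\<close>

lemma mem_orbit_map: "y \<in> orbit_map C k x \<longleftrightarrow> (\<exists>\<sigma>. \<sigma> permutes {..<k} \<and> y = oact C k \<sigma> x)"
  by (auto simp: orbit_map_def orbit_def)

lemma orbit_map_act:
  assumes x: "x \<in> oset C k" and \<sigma>: "\<sigma> permutes {..<k}"
  shows "orbit_map C k (oact C k \<sigma> x) = orbit_map C k x"
proof (intro equalityI subsetI)
  fix z assume "z \<in> orbit_map C k (oact C k \<sigma> x)"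
  then obtain \<tau> where \<tau>: "\<tau> permutes {..<k}" "z = oact C k \<tau> (oact C k \<sigma> x)"
    unfolding mem_orbit_map by blast
  then have "z = oact C k (\<sigma> \<circ> \<tau>) x" using act_comp[OF \<tau>(1) \<sigma> x] by simp
  then show "z \<in> orbit_map C k x"
    unfolding mem_orbit_map using permutes_compose[OF \<tau>(1) \<sigma>] by blast
next
  fix z assume "z \<in> orbit_map C k x"
  then obtain \<tau> where \<tau>: "\<tau> permutes {..<k}" "z = oact C k \<tau> x" unfolding mem_orbit_map by blast
  have i: "inv_into UNIV \<sigma> permutes {..<k}" using \<sigma> by (rule permutes_inv)
  have "z = oact C k (inv_into UNIV \<sigma> \<circ> \<tau>) (oact C k \<sigma> x)"
    using act_comp[OF \<tau>(1) i act_in[OF \<sigma> x]] act_inv[OF \<sigma> x] \<tau>(2) by simp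
  then show "z \<in> orbit_map C k (oact C k \<sigma> x)"
    unfolding mem_orbit_map using permutes_compose[OF \<tau>(1) i] by blast
qed

lemma orbit_map_eq:
  assumes "x \<in> oset C k" "y \<in> oset C k"
  shows "orbit_map C k x = orbit_map C k y \<longleftrightarrow> (\<exists>\<sigma>. \<sigma> permutes {..<k} \<and> y = oact C k \<sigma> x)"
proof
  assume eq: "orbit_map C k x = orbit_map C k y"
  have "y \<in> orbit_map C k y"
    unfolding mem_orbit_map by (rule exI[of _ id]) (use act_id[OF assms(2)] in \<open>auto intro: permutes_id\<close>)
  then show "\<exists>\<sigma>. \<sigma> permutes {..<k} \<and> y = oact C k \<sigma> x"
    unfolding eq[symmetric] mem_orbit_map .
qed (use orbit_map_act[OF assms(1)] in auto)

lemma continuous_orbit_map: "continuous_map (ospace C k) (orbit_space C k) (orbit_map C k)"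
  by (rule quotient_imp_continuous_map[OF quotient_map_orbit_map])

lemma open_orbit_map: "open_map (ospace C k) (orbit_space C k) (orbit_map C k)"
  unfolding open_map_def openin_orbit_space
proof (intro allI impI conjI)
  fix U assume U: "openin (ospace C k) U"
  then have sub: "U \<subseteq> oset C k" by (rule openin_subset)
  then show "orbit_map C k ` U \<subseteq> orbit_map C k ` oset C k" by blast
  have "{x \<in> oset C k. orbit_map C k x \<in> orbit_map C k ` U} =
      (\<Union>\<sigma>\<in>{\<sigma>. \<sigma> permutes {..<k}}. {x \<in> oset C k. oact C k \<sigma> x \<in> U})"
  proof (intro equalityI subsetI)
    fix x assume "x \<in> {x \<in> oset C k. orbit_map C k x \<in> orbit_map C k ` U}"
    then obtain u where "x \<in> oset C k" "u \<in> U" "orbit_map C k x = orbit_map C k u" by blast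
    then show "x \<in> (\<Union>\<sigma>\<in>{\<sigma>. \<sigma> permutes {..<k}}. {x \<in> oset C k. oact C k \<sigma> x \<in> U})"
      using orbit_map_eq[of x k u] sub by blast
  next
    fix x assume "x \<in> (\<Union>\<sigma>\<in>{\<sigma>. \<sigma> permutes {..<k}}. {x \<in> oset C k. oact C k \<sigma> x \<in> U})"
    then show "x \<in> {x \<in> oset C k. orbit_map C k x \<in> orbit_map C k ` U}"
      using orbit_map_act[of x k] by (auto simp: image_iff)
  qed
  moreover have "openin (ospace C k) {x \<in> oset C k. oact C k \<sigma> x \<in> U}" if "\<sigma> permutes {..<k}" for \<sigma>
    using act_continuous[of \<sigma> k] U that by (intro openin_continuous_map_preimage) auto
  ultimately show "openin (ospace C k) {x \<in> oset C k. orbit_map C k x \<in> orbit_map C k ` U}" by auto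
qed

lemma free_neighbourhood:
  assumes "x \<in> oset C k"
  obtains U where "openin (ospace C k) U" "x \<in> U" "inj_on (orbit_map C k) U"
proof -
  obtain U where U: "openin (ospace C k) U" "x \<in> U"
    "\<forall>\<sigma>\<in>carrier (perm_group k). \<sigma> \<noteq> \<one>\<^bsub>perm_group k\<^esub> \<longrightarrow> oact C k \<sigma> ` U \<inter> U = {}"
    using covering[OF assms] by blast
  have "inj_on (orbit_map C k) U"
  proof (rule inj_onI)
    fix u v assume u: "u \<in> U" and v: "v \<in> U" and eq: "orbit_map C k u = orbit_map C k v"
    have uv: "u \<in> oset C k" "v \<in> oset C k" using u v openin_subset[OF U(1)] by auto
    then obtain \<sigma> where \<sigma>: "\<sigma> permutes {..<k}" "v = oact C k \<sigma> u" using eq orbit_map_eq by blast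
    then have "oact C k \<sigma> ` U \<inter> U \<noteq> {}" using u v by blast
    then have "\<sigma> = id" using bspec[OF U(3), of \<sigma>] \<sigma>(1)
        by (auto simp only: one_perm_group carrier_perm_group)
    then show "u = v" using \<sigma>(2) act_id[OF uv(1)] by simp
  qed
  then show thesis using U that by blast
qed

text \<open>
  A neighbourhood \<open>U\<close> that is disjoint from its translates is mapped homeomorphically onto an open set.
  The section over this set through a point of \<open>\<sigma>U\<close> is the inverse homeomorphism followed by \<open>\<sigma>\<close>.
\<close>

lemma covering_proj_orbit_map: "covering_proj (ospace C k) (orbit_space C k) (orbit_map C k)"
  unfolding covering_proj_def
proof (intro conjI ballI Hausdorff continuous_orbit_map)
  let ?X = "ospace C k" and ?Y = "orbit_space C k" and ?q = "orbit_map C k"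
  show "\<exists>U. openin ?X U \<and> x \<in> U \<and> inj_on ?q U" if "x \<in> oset C k" for x
    using free_neighbourhood[OF that] by metis
  fix y assume "y \<in> topspace ?Y"
  then obtain x0 where x0: "x0 \<in> oset C k" "y = ?q x0" by (auto simp: topspace_orbit_space)
  obtain U where U: "openin ?X U" "x0 \<in> U" "inj_on ?q U" using free_neighbourhood[OF x0(1)] .
  have sub: "U \<subseteq> oset C k" using U(1) by (rule openin_subset)
  have tU: "topspace (subtopology ?X U) = U" using sub by (simp add: Int_absorb1)
  have V: "openin ?Y (?q ` U)" using open_orbit_map U(1) by (simp add: open_map_def)
  have "homeomorphic_map (subtopology ?X U) (subtopology ?Y (?q ` U)) ?q"
  proof (rule bijective_open_imp_homeomorphic_map)
    show "continuous_map (subtopology ?X U) (subtopology ?Y (?q ` U)) ?q"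
      using continuous_orbit_map by (auto simp: continuous_map_in_subtopology intro:
          continuous_map_from_subtopology)
    show "open_map (subtopology ?X U) (subtopology ?Y (?q ` U)) ?q"
      by (intro open_map_into_subtopology open_map_from_subtopology open_orbit_map U(1)) auto
    show "?q ` topspace (subtopology ?X U) = topspace (subtopology ?Y (?q ` U))"
      unfolding tU using openin_subset[OF V] by auto
    show "inj_on ?q (topspace (subtopology ?X U))" unfolding tU by (rule U(3))
  qed
  then obtain g where g: "homeomorphic_maps (subtopology ?X U) (subtopology ?Y (?q ` U)) ?q g"
    unfolding homeomorphic_map_maps by blast
  have gc: "continuous_map (subtopology ?Y (?q ` U)) ?X g"
    using g by (simp add: homeomorphic_maps_def continuous_map_in_subtopology)
  have gq: "g (?q u) = u" if "u \<in> U" for u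
    using g that sub by (auto simp: homeomorphic_maps_def)
  have local_section: "\<exists>r. continuous_map (subtopology ?Y (?q ` U)) ?X r \<and> (\<forall>z\<in>?q ` U. ?q (r z) =
      z) \<and> r (?q x) = x"
    if x: "x \<in> oset C k" "?q x \<in> ?q ` U" for x
  proof -
    obtain u where u: "u \<in> U" "?q u = ?q x" using x(2) by force
    then obtain \<sigma> where \<sigma>: "\<sigma> permutes {..<k}" "x = oact C k \<sigma> u"
      using orbit_map_eq[of u k x] sub x(1) by blast
    have "continuous_map (subtopology ?Y (?q ` U)) ?X (oact C k \<sigma> \<circ> g)"
      using gc act_continuous[of \<sigma> k] \<sigma>(1) by (auto intro: continuous_map_compose)
    moreover have "?q ((oact C k \<sigma> \<circ> g) z) = z" if "z \<in> ?q ` U" for z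
      using that gq sub orbit_map_act[OF _ \<sigma>(1)] by auto
    moreover have "(oact C k \<sigma> \<circ> g) (?q x) = x" using gq[OF u(1)] u(2) \<sigma>(2) by simp
    ultimately show ?thesis by blast
  qed
  show "\<exists>V. openin ?Y V \<and> y \<in> V \<and> (\<forall>x\<in>oset C k. ?q x \<in> V \<longrightarrow>
      (\<exists>r. continuous_map (subtopology ?Y V) ?X r \<and> (\<forall>z\<in>V. ?q (r z) = z) \<and> r (?q x) = x))"
    by (intro exI[of _ "?q ` U"] conjI V ballI impI local_section) (use x0(2) U(2) in auto)
qed

lemma rel_project_class:
  assumes f: "pathin (ospace C k) f"
  shows "rel_project C k (path_class (ospace C k) f) = path_class (orbit_space C k) (orbit_map C k \<circ> f)"
proof -
  have "path_class (orbit_space C k) (orbit_map C k \<circ> g) =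
      path_class (orbit_space C k) (orbit_map C k \<circ> f)"
    if "g \<in> path_class (ospace C k) f" for g
    using that by (intro path_class_eqI[symmetric] path_homotopic_compose[OF continuous_orbit_map])
        (simp add: mem_path_class)
  then show ?thesis
    unfolding rel_project_def using path_class_self[OF f] by blast
qed

lemma fundamental_group_mult:
  assumes "pathin X f" "pathin X g" "f 1 = g 0"
  shows "path_class X f \<otimes>\<^bsub>fundamental_group X x\<^esub> path_class X g = path_class X (path_join f g)"
proof -
  have same: "path_class X (path_join f' g') = path_class X (path_join f g)"
    if "f' \<in> path_class X f" "g' \<in> path_class X g" for f' g'
    using that assms(3) by (intro path_class_eqI[symmetric] path_homotopic_path_join) (auto simp:
        mem_path_class)
  have "path_class X f \<otimes>\<^bsub>fundamental_group X x\<^esub> path_class X g =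
      (\<Union>f'\<in>path_class X f. \<Union>g'\<in>path_class X g. path_class X (path_join f' g'))"
    by (simp add: fundamental_group_def)
  also have "\<dots> = path_class X (path_join f g)"
    using path_class_self[OF assms(1)] path_class_self[OF assms(2)] same by (intro UN2_const)
  finally show ?thesis .
qed

text \<open>
  Surjectivity is path lifting and injectivity is homotopy lifting. Products correspond because the orbit
  map does not see the translation of the second factor.
\<close>

lemma rel_project_iso: "rel_project C k \<in> iso (pi1_rel C \<eta> k) (pi1_quotient C \<eta> k)"
proof -
  let ?X = "ospace C k" and ?Y = "orbit_space C k" and ?q = "orbit_map C k"
  let ?G = "pi1_rel C \<eta> k" and ?H = "pi1_quotient C \<eta> k" and ?y = "orbit_map C k (basept \<eta> k)"
  have e: "basept \<eta> k \<in> oset C k" using eta_in[OF std_ordered] by (simp add: basept_def)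
  have loop: "pathin ?Y (?q \<circ> f)" "(?q \<circ> f) 0 = ?y" "(?q \<circ> f) 1 = ?y" if "based_path k \<sigma> f" for \<sigma> f
    using ordered_pathD[OF that] e orbit_map_act[OF e, of \<sigma>]
    by (auto simp: pathin_def basept_def intro: continuous_map_compose continuous_orbit_map)
  have carrier: "carrier ?H = path_class ?Y ` {p. pathin ?Y p \<and> p 0 = ?y \<and> p 1 = ?y}"
    by (simp add: pi1_quotient_def fundamental_group_def)
  have "rel_project C k \<in> hom ?G ?H"
  proof (rule homI)
    fix A assume "A \<in> carrier ?G"
    then obtain \<sigma> f where f: "based_path k \<sigma> f" "A = path_class ?X f" by (rule pi1_rel_cases)
    note F = ordered_pathD[OF f(1)]
    show "rel_project C k A \<in> carrier ?H"
      unfolding f(2) rel_project_class[OF F(1)] carrier using loop[OF f(1)] by blast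
    fix B assume "B \<in> carrier ?G"
    then obtain \<tau> g where g: "based_path k \<tau> g" "B = path_class ?X g" by (rule pi1_rel_cases)
    note G = ordered_pathD[OF g(1)]
    note fg = ordered_path_join[OF f(1) g(1)]
    have "rel_project C k (A \<otimes>\<^bsub>?G\<^esub> B) = path_class ?Y (?q \<circ> path_join f (oact C k \<sigma> \<circ> g))"
      unfolding f(2) g(2) pi1_rel_mult_class[OF f(1) g(1)] rel_project_class[OF ordered_pathD(1)[OF
          fg]] ..
    also have "\<dots> = path_class ?Y (path_join (?q \<circ> f) (?q \<circ> g))"
      unfolding compose_path_join
    proof (rule path_class_eqI, rule path_homotopic_eq)
      show "pathin ?Y (path_join (?q \<circ> f) (?q \<circ> (oact C k \<sigma> \<circ> g)))"
        using loop(1)[OF fg] by (simp add: compose_path_join)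
      show "path_join (?q \<circ> f) (?q \<circ> (oact C k \<sigma> \<circ> g)) t = path_join (?q \<circ> f) (?q \<circ> g) t"
          if "t \<in> {0..1}" for t
        by (rule path_join_eq[OF that]) (simp_all add: orbit_map_act[OF pathin_in[OF G(1)] F(2)])
    qed
    also have "\<dots> = rel_project C k A \<otimes>\<^bsub>?H\<^esub> rel_project C k B"
      unfolding f(2) g(2) rel_project_class[OF F(1)] rel_project_class[OF G(1)] pi1_quotient_def
      using loop[OF f(1)] loop[OF g(1)] by (intro fundamental_group_mult[symmetric]) simp_all
    finally show "rel_project C k (A \<otimes>\<^bsub>?G\<^esub> B) = rel_project C k A \<otimes>\<^bsub>?H\<^esub> rel_project C k B" .
  qed
  moreover have "inj_on (rel_project C k) (carrier ?G)"
  proof (rule inj_onI)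
    fix A B assume "A \<in> carrier ?G" "B \<in> carrier ?G" and eq: "rel_project C k A = rel_project C k B"
    then obtain \<sigma> f \<tau> g where f: "based_path k \<sigma> f" "A = path_class ?X f"
      and g: "based_path k \<tau> g" "B = path_class ?X g" by (elim pi1_rel_cases)
    note F = ordered_pathD[OF f(1)] and G = ordered_pathD[OF g(1)]
    have "path_homotopic ?Y (?q \<circ> f) (?q \<circ> g)"
      using eq path_class_eq_iff[OF loop(1)[OF g(1)]]
      by (simp add: f(2) g(2) rel_project_class[OF F(1)] rel_project_class[OF G(1)])
    then have "path_homotopic ?X f g"
      using F G by (intro path_homotopic_lift[OF covering_proj_orbit_map]) auto
    then show "A = B" unfolding f(2) g(2) by (rule path_class_eqI)
  qed
  moreover have "carrier ?H \<subseteq> rel_project C k ` carrier ?G"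
  proof
    fix P assume "P \<in> carrier ?H"
    then obtain p where p: "pathin ?Y p" "p 0 = ?y" "p 1 = ?y" "P = path_class ?Y p"
      unfolding carrier by blast
    obtain f where f: "pathin ?X f" "\<And>t. t \<in> {0..1} \<Longrightarrow> ?q (f t) = p t" "f 0 = basept \<eta> k"
      using path_lift[OF covering_proj_orbit_map p(1) e] p(2) by metis
    have "?q (basept \<eta> k) = ?q (f 1)" using f(2)[of 1] p(3) by simp
    then obtain \<sigma> where "\<sigma> permutes {..<k}" "f 1 = oact C k \<sigma> (basept \<eta> k)"
      using orbit_map_eq[OF e pathin_in[OF f(1), of 1]] by auto
    then have bf: "based_path k \<sigma> f"
      using f by (simp add: ordered_path_def std_ordered basept_def)
    have "rel_project C k (path_class ?X f) = P"
      unfolding rel_project_class[OF f(1)] p(4)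
      by (intro path_class_eqI path_homotopic_eq loop(1)[OF bf]) (simp add: f(2))
    then show "P \<in> rel_project C k ` carrier ?G" using class_in_carrier[OF bf] by blast
  qed
  ultimately show ?thesis
    by (auto simp: iso_def bij_betw_def hom_def)
qed

lemma group_pi1_quotient: "group (pi1_quotient C \<eta> k)"
proof -
  let ?G = "pi1_rel C \<eta> k" and ?H = "pi1_quotient C \<eta> k"
  interpret G: group ?G by (rule group_pi1_rel)
  have e: "pathin (ospace C k) (\<lambda>_. basept \<eta> k)"
    using ordered_pathD(1)[OF based_path_const] .
  have "rel_project C k \<one>\<^bsub>?G\<^esub> = \<one>\<^bsub>?H\<^esub>"
    by (simp add: one_pi1_rel rel_project_class[OF e] pi1_quotient_def fundamental_group_def o_def)
  then have "?H \<lparr>one := rel_project C k \<one>\<^bsub>?G\<^esub>\<rparr> = ?H" by simp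
  then show ?thesis using G.iso_imp_img_group[OF rel_project_iso] by simp
qed

lemma pi1_quotient_group_operad_laws:
  "group_operad_laws (pi1_quotient C \<eta>) (pi1_comp C \<eta>) (pi1_boundary C \<eta>)"
  by (rule group_operad_laws.transport[OF pi1_rel_group_operad_laws rel_project_iso group_pi1_quotient,
        where \<psi> = "rel_lift C \<eta>"])
    (simp_all add: rel_lift_def pi1_comp_def pi1_boundary_def)

lemma crossed_pi1_quotient: "crossed_group_operad (pi1_quotient C \<eta>) (pi1_comp C \<eta>) (pi1_boundary C \<eta>)"
proof (rule crossed_group_operad.intro)
  show "group_operad (pi1_quotient C \<eta>) (pi1_comp C \<eta>) (pi1_boundary C \<eta>)"
    by (rule group_operad_laws.group_operad[OF pi1_quotient_group_operad_laws])
  show "crossed_group_operad_axioms (pi1_quotient C \<eta>) (pi1_boundary C \<eta>)"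
  proof
    let ?\<sigma> = "Transposition.transpose (0::nat) 1"
    have "?\<sigma> permutes {..<2}" by (rule permutes_swap_id) auto
    then obtain A where A: "A \<in> carrier (pi1_rel C \<eta> 2)" "rel_boundary C \<eta> 2 A = ?\<sigma>"
      by (rule rel_boundary_surj)
    let ?P = "rel_project C 2 A"
    have bij: "bij_betw (rel_project C 2) (carrier (pi1_rel C \<eta> 2)) (carrier (pi1_quotient C \<eta> 2))"
      using rel_project_iso[of 2] by (simp add: iso_def)
    have "rel_lift C \<eta> 2 ?P = A"
      unfolding rel_lift_def by (rule bij_betw_inv_into_left[OF bij A(1)])
    moreover have "?\<sigma> \<noteq> id"
      by (metis id_apply Transposition.transpose_apply_first zero_neq_one)
    ultimately have "pi1_boundary C \<eta> 2 ?P \<noteq> id" by (simp add: pi1_boundary_def A(2))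
    then show "\<exists>n. \<exists>a\<in>carrier (pi1_quotient C \<eta> n). pi1_boundary C \<eta> n a \<noteq> id"
      using bij_betwE[OF bij] A(1) by blast
  qed
qed

end

theorem theorem3p4:
  fixes C :: "('a, 'z) sym_operad_scheme"
    and \<eta> :: "nat \<Rightarrow> (real \<times> real) list \<Rightarrow> 'a"
  assumes "covering_symmetric_operad C"
    and "\<And>k. path_connected_space (ospace C k)"
    and "operad_morphism little_intervals0 C \<eta>"
  shows "(\<forall>k. rel_project C k \<in> iso (pi1_rel C \<eta> k) (pi1_quotient C \<eta> k)) \<and>
    crossed_group_operad (pi1_quotient C \<eta>) (pi1_comp C \<eta>) (pi1_boundary C \<eta>)"
proof -
  interpret based_operad C \<eta>
    using assms by (auto intro: based_operad.intro based_operad_axioms.intro)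
  show ?thesis using rel_project_iso crossed_pi1_quotient by blast
qed

end
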